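(* Fix $d\ge 2$. There is an algorithm which, given the upset presentation of an interval $Q\subseteq\mathbb N^d$ with $\|Q\|=n$, computes an initial scaffold of $Q$ in time (i) $O(n\log n)$ if $d=2,3$; (ii) $O(n^4)$ if $d>3$. In the case that $Q$ is finite, these bounds also hold when $Q$ is instead specified by its extrema (its minima and its maxima, given separately), with $n$ the total number of these.
   Context: $\mathbb N=\{0,1,2,\dots\}$ and $\mathbb N^d$ has the product partial order. Minima, maxima and extrema mean minimal elements, maximal elements, and both; $M_Q$ is the set of minima of $Q$. A subposet $P\subseteq Q$ is a poset whose elements are elements of $Q$ and whose relations are relations of $Q$ (not necessarily all). A poset is connected if it is nonempty and any two elements are joined by a finite sequence of elements in which consecutive elements are comparable; otherwise (in particular if empty) it is disconnected. A component is a maximal connected subposet. An interval $Q\subseteq \mathbb N^d$ is a nonempty connected subset, with the full inherited order, such that $p\le q\le r$ with $p,r\in Q$ and $q\in\mathbb N^d$ implies $q\in Q$. Let $\operatorname{up}[Q]=\{p\in\mathbb N^d\mid p\ge q\text{ for some }q\in Q\}$ and $Q'=\operatorname{up}[Q]\setminus Q$. The upset presentation of $Q$ is the pair $(M_Q,M_{Q'})$, and $\|Q\|=|M_Q|+|M_{Q'}|$ (always finite). For $q\in Q$, $\operatorname{dn}(q)=\{p\in Q\mid p<q\}$ with the full inherited order, and $I_Q=\{q\in Q\mid \operatorname{dn}(q)\text{ is disconnected}\}$ (this contains all minima). An initial scaffold of $Q$ is a subposet $P\subseteq Q$ with set of elements $I_Q$ such that for each $p\in P$ and each component $A$ of $\operatorname{dn}(p)$,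 $P$ contains exactly one relation $m<p$ with $m\in A$, and this $m$ is a minimum of $Q$; $P$ has no other non-identity relations. Computing $P$ means outputting its elements and relations. Running times count elementary operations (including comparisons of coordinates) at unit cost; $d$ is treated as a constant; $\log n$ is read as $\max\{1,\log n\}$. *)

theory Defs
  imports "HOL-Library.Landau_Symbols"
begin

section \<open>Posets, subposets, connectivity\<close>

text \<open>A poset is a carrier together with its reflexive order relation. A subposet need not
  inherit all relations between its elements.\<close>

type_synonym 'a poset = "'a set \<times> 'a rel"

definition poset :: "'a poset \<Rightarrow> bool" where
  "poset P \<longleftrightarrow> partial_order_on (fst P) (snd P)"

definition subposet :: "'a poset \<Rightarrow> 'a poset \<Rightarrow> bool" where
  "subposet P Q \<longleftrightarrow> poset P \<and> poset Q \<and> fst P \<subseteq> fst Q \<and> snd P \<subseteq> snd Q"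

definition connected_poset :: "'a poset \<Rightarrow> bool" where
  "connected_poset P \<longleftrightarrow>
     fst P \<noteq> {} \<and> (\<forall>x \<in> fst P. \<forall>y \<in> fst P. (x, y) \<in> (snd P \<union> (snd P)\<inverse>)\<^sup>*)"

definition component_of :: "'a poset \<Rightarrow> 'a poset \<Rightarrow> bool" where
  "component_of P A \<longleftrightarrow>
     subposet A P \<and> connected_poset A \<and>
     (\<forall>B. subposet B P \<and> connected_poset B \<and> subposet A B \<longrightarrow> B = A)"


section \<open>Intervals in \<open>\<nat>\<^sup>d\<close> and initial scaffolds\<close>

text \<open>Points of \<open>\<nat>\<^sup>d\<close> are lists of length \<open>d\<close>, ordered componentwise
  (not by one of the library's lexicographic or prefix orders).\<close>

type_synonym point = "nat list"

definition space_N :: "nat \<Rightarrow> point set" where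
  "space_N d = {p. length p = d}"

definition pt_le :: "point \<Rightarrow> point \<Rightarrow> bool" (infix "\<preceq>" 50) where
  "p \<preceq> q \<longleftrightarrow> list_all2 (\<le>) p q"

definition full :: "point set \<Rightarrow> point poset" where
  "full S = (S, {(p, q). p \<in> S \<and> q \<in> S \<and> p \<preceq> q})"

definition minima :: "point set \<Rightarrow> point set" where
  "minima S = {q \<in> S. \<forall>p \<in> S. p \<preceq> q \<longrightarrow> p = q}"

definition maxima :: "point set \<Rightarrow> point set" where
  "maxima S = {q \<in> S. \<forall>p \<in> S. q \<preceq> p \<longrightarrow> p = q}"

definition interval :: "nat \<Rightarrow> point set \<Rightarrow> bool" where
  "interval d Q \<longleftrightarrow>
     Q \<subseteq> space_N d \<and> connected_poset (full Q) \<and>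
     (\<forall>p \<in> Q. \<forall>r \<in> Q. \<forall>q \<in> space_N d. p \<preceq> q \<and> q \<preceq> r \<longrightarrow> q \<in> Q)"

definition up :: "nat \<Rightarrow> point set \<Rightarrow> point set" where
  "up d Q = {p \<in> space_N d. \<exists>q \<in> Q. q \<preceq> p}"

definition upset_presentation :: "nat \<Rightarrow> point set \<Rightarrow> point set \<times> point set" where
  "upset_presentation d Q = (minima Q, minima (up d Q - Q))"

definition extrema :: "point set \<Rightarrow> point set \<times> point set" where
  "extrema Q = (minima Q, maxima Q)"

definition dn :: "point set \<Rightarrow> point \<Rightarrow> point set" where
  "dn Q q = {p \<in> Q. p \<preceq> q \<and> p \<noteq> q}"

definition initial_points :: "point set \<Rightarrow> point set" where
  "initial_points Q = {q \<in> Q. \<not> connected_poset (full (dn Q q))}"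

definition initial_scaffold :: "point set \<Rightarrow> point poset \<Rightarrow> bool" where
  "initial_scaffold Q P \<longleftrightarrow>
     subposet P (full Q) \<and>
     fst P = initial_points Q \<and>
     (\<forall>p \<in> fst P. \<forall>A. component_of (full (dn Q p)) A \<longrightarrow>
        (\<exists>!m. m \<in> fst A \<and> (m, p) \<in> snd P) \<and>
        (\<forall>m. m \<in> fst A \<and> (m, p) \<in> snd P \<longrightarrow> m \<in> minima Q)) \<and>
     (\<forall>m p. (m, p) \<in> snd P \<and> m \<noteq> p \<longrightarrow>
        (\<exists>A. component_of (full (dn Q p)) A \<and> m \<in> fst A))"


section \<open>A unit-cost random access machine\<close>

text \<open>
  A program is a finite piece of structured code. It works on registers and arrays of natural
  numbers; register and array names are literals in the code, so a program mentions only
  finitely many of them, while array cells are addressed indirectly. The arithmetic operations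
  are addition and truncated subtraction; there is deliberately no multiplication or division,
  as these at unit cost on unbounded numbers would make the machine unrealistically strong.
  Every operation, memory access, comparison and branching costs one unit.
\<close>

datatype exp =
    Lit nat
  | Reg nat
  | Read nat exp      \<comment> \<open>array name, index\<close>
  | Add exp exp
  | Sub exp exp

datatype test =
    Less exp exp
  | Neg test
  | Conj test test

datatype com =
    Skip
  | SetReg nat exp
  | Write nat exp exp   \<comment> \<open>array name, index, value\<close>
  | Seq com com
  | Cond test com com
  | Loop test com

record state =
  reg :: "nat \<Rightarrow> nat"
  arr :: "nat \<Rightarrow> nat \<Rightarrow> nat"

fun exp_val :: "exp \<Rightarrow> state \<Rightarrow> nat" where
  "exp_val (Lit n) s = n"
| "exp_val (Reg x) s = reg s x"
| "exp_val (Read a e) s = arr s a (exp_val e s)"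
| "exp_val (Add e f) s = exp_val e s + exp_val f s"
| "exp_val (Sub e f) s = exp_val e s - exp_val f s"

fun exp_cost :: "exp \<Rightarrow> nat" where
  "exp_cost (Lit n) = 1"
| "exp_cost (Reg x) = 1"
| "exp_cost (Read a e) = 1 + exp_cost e"
| "exp_cost (Add e f) = 1 + exp_cost e + exp_cost f"
| "exp_cost (Sub e f) = 1 + exp_cost e + exp_cost f"

fun test_val :: "test \<Rightarrow> state \<Rightarrow> bool" where
  "test_val (Less e f) s \<longleftrightarrow> exp_val e s < exp_val f s"
| "test_val (Neg b) s \<longleftrightarrow> \<not> test_val b s"
| "test_val (Conj b c) s \<longleftrightarrow> test_val b s \<and> test_val c s"

fun test_cost :: "test \<Rightarrow> nat" where
  "test_cost (Less e f) = 1 + exp_cost e + exp_cost f"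
| "test_cost (Neg b) = 1 + test_cost b"
| "test_cost (Conj b c) = 1 + test_cost b + test_cost c"

definition set_reg :: "nat \<Rightarrow> nat \<Rightarrow> state \<Rightarrow> state" where
  "set_reg x v s = s\<lparr>reg := (reg s)(x := v)\<rparr>"

definition set_cell :: "nat \<Rightarrow> nat \<Rightarrow> nat \<Rightarrow> state \<Rightarrow> state" where
  "set_cell a i v s = s\<lparr>arr := (arr s)(a := (arr s a)(i := v))\<rparr>"

text \<open>\<open>exec c s t s'\<close>: started in \<open>s\<close>, program \<open>c\<close> halts in \<open>s'\<close> after exactly \<open>t\<close> units of time.\<close>

inductive exec :: "com \<Rightarrow> state \<Rightarrow> nat \<Rightarrow> state \<Rightarrow> bool" where
  exec_Skip: "exec Skip s 1 s"
| exec_SetReg: "exec (SetReg x e) s (1 + exp_cost e) (set_reg x (exp_val e s) s)"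
| exec_Write: "exec (Write a i e) s (1 + exp_cost i + exp_cost e)
    (set_cell a (exp_val i s) (exp_val e s) s)"
| exec_Seq: "exec c s t s' \<Longrightarrow> exec c' s' t' s'' \<Longrightarrow> exec (Seq c c') s (t + t') s''"
| exec_Cond_True: "test_val b s \<Longrightarrow> exec c s t s' \<Longrightarrow>
    exec (Cond b c c') s (1 + test_cost b + t) s'"
| exec_Cond_False: "\<not> test_val b s \<Longrightarrow> exec c' s t s' \<Longrightarrow>
    exec (Cond b c c') s (1 + test_cost b + t) s'"
| exec_Loop_False: "\<not> test_val b s \<Longrightarrow> exec (Loop b c) s (1 + test_cost b) s"
| exec_Loop_True: "test_val b s \<Longrightarrow> exec c s t s' \<Longrightarrow> exec (Loop b c) s' t' s'' \<Longrightarrow>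
    exec (Loop b c) s (1 + test_cost b + t + t') s''"

lemma exec_deterministic:
  "exec c s t s' \<Longrightarrow> exec c s u s'' \<Longrightarrow> u = t \<and> s'' = s'"
proof (induction arbitrary: u s'' rule: exec.induct)
  case (exec_Seq c s t s' c' t' s2)
  from exec_Seq.prems show ?case
    by cases (auto dest!: exec_Seq.IH(1) exec_Seq.IH(2))
next
  case (exec_Cond_True b s c t s' c')
  from exec_Cond_True.prems exec_Cond_True.hyps show ?case
    by cases (auto dest!: exec_Cond_True.IH)
next
  case (exec_Cond_False b s c' t s' c)
  from exec_Cond_False.prems exec_Cond_False.hyps show ?case
    by cases (auto dest!: exec_Cond_False.IH)
next
  case (exec_Loop_True b s c t s' t' s2)
  from exec_Loop_True.prems exec_Loop_True.hyps show ?case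
    by cases (auto dest!: exec_Loop_True.IH)
qed (erule exec.cases; simp)+


section \<open>Computing an initial scaffold\<close>

definition lists_set :: "'a list \<Rightarrow> 'a set \<Rightarrow> bool" where
  "lists_set xs A \<longleftrightarrow> distinct xs \<and> set xs = A"

text \<open>Input: registers 0 and 1 hold the lengths of the two lists of points, arrays 0 and 1
  hold their coordinates, point after point. All other memory is initially zero.\<close>

definition cells :: "nat list \<Rightarrow> nat \<Rightarrow> nat" where
  "cells l i = (if i < length l then l ! i else 0)"

definition input_state :: "point list \<Rightarrow> point list \<Rightarrow> state" where
  "input_state xs ys =
     \<lparr>reg = (\<lambda>_. 0)(0 := length xs, 1 := length ys),
      arr = (\<lambda>_ _. 0)(0 := cells (concat xs), 1 := cells (concat ys))\<rparr>"

text \<open>Output: registers 2 and 3 hold the number of elements and of relations, array 2 holds the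
  coordinates of the elements, and array 3 those of the relations, each relation \<open>(m, p)\<close> being
  written as the coordinates of \<open>m\<close> followed by those of \<open>p\<close>. The elements, and the
  relations other than the identities, are each listed exactly once, in any order.\<close>

definition array_holds :: "state \<Rightarrow> nat \<Rightarrow> nat list \<Rightarrow> bool" where
  "array_holds s a l \<longleftrightarrow> (\<forall>i < length l. arr s a i = l ! i)"

definition outputs_poset :: "state \<Rightarrow> point poset \<Rightarrow> bool" where
  "outputs_poset s P \<longleftrightarrow>
     (\<exists>es rs. lists_set es (fst P) \<and> lists_set rs (snd P - Id) \<and>
        reg s 2 = length es \<and> array_holds s 2 (concat es) \<and>
        reg s 3 = length rs \<and> array_holds s 3 (concat (map (\<lambda>(m, p). m @ p) rs)))"

definition computes_initial_scaffold ::
    "com \<Rightarrow> point list \<Rightarrow> point list \<Rightarrow> point set \<Rightarrow> nat \<Rightarrow> bool" where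
  "computes_initial_scaffold c xs ys Q b \<longleftrightarrow>
     (\<exists>t s P. exec c (input_state xs ys) t s \<and> t \<le> b \<and>
        initial_scaffold Q P \<and> outputs_poset s P)"

text \<open>The specifying pair of point sets is presented by arbitrary repetition-free lists; the
  bound \<open>T\<close> is a function of the total number of points in the specification. Here \<open>spec\<close> is
  the way of specifying an interval (its upset presentation, or its extrema) and \<open>\<Q>\<close> the
  class of admissible intervals.\<close>

definition scaffold_algorithm ::
    "com \<Rightarrow> (point set \<Rightarrow> point set \<times> point set) \<Rightarrow> point set set \<Rightarrow> (nat \<Rightarrow> nat) \<Rightarrow> bool" where
  "scaffold_algorithm c spec \<Q> T \<longleftrightarrow>
     (\<forall>Q \<in> \<Q>. \<forall>xs ys. lists_set xs (fst (spec Q)) \<and> lists_set ys (snd (spec Q)) \<longrightarrow>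
        computes_initial_scaffold c xs ys Q (T (card (fst (spec Q)) + card (snd (spec Q)))))"

end

theory Submission
  imports Defs "HOL-Library.Product_Lexorder"
begin

text \<open>
  Let \<open>q\<close> be a point of \<open>Q\<close> that is not minimal. Two elements of \<open>dn(q)\<close> that differ from \<open>q\<close> in a
  common coordinate lie in the same component: they lie above minima \<open>m\<close> and \<open>m'\<close>, and the join of
  \<open>m\<close> and \<open>m'\<close> still differs from \<open>q\<close> in that coordinate, hence is an element of \<open>dn(q)\<close> above both
  (\<open>conn_if_common_coordinate\<close>). So the components of \<open>dn(q)\<close> correspond to classes of coordinates:
  for each minimum below \<open>q\<close>, the coordinates in which it differs from \<open>q\<close> are in the same class
  (\<open>conn_iff_linked\<close>). There are at most \<open>d\<close> classes, and if there are at least two then \<open>q\<close> is the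
  join of any two minima that belong to different ones (\<open>initial_point_join\<close>). A scaffold is
  therefore known once all such \<open>q\<close> are listed, each with one minimum per class
  (\<open>initial_scaffold_scaffold_of\<close>). Whether a point above a minimum belongs to \<open>Q\<close> is seen from the
  second half of the input (\<open>member_by_upset_presentation\<close>, \<open>member_by_extrema\<close>).

  For \<open>d > 3\<close> the algorithm examines the joins of all \<open>O(n\<^sup>2)\<close> pairs of minima. For each it takes
  \<open>O(n)\<close> steps to decide membership in \<open>Q\<close>, to find the classes of coordinates by uniting labels,
  and to pick the minima, and \<open>O(n\<^sup>2)\<close> steps to look for the join in the output written so far.
  This amounts to \<open>O(n\<^sup>4)\<close> (\<open>runs_all_joins\<close>).

  For \<open>d \<le> 3\<close> there is little room: of two disjoint classes one is a single coordinate \<open>c\<close>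
  (\<open>single_exists\<close>). A minimum \<open>x\<close> that differs from \<open>q\<close> in \<open>c\<close> only is such that \<open>q\<close> arises from
  \<open>x\<close> by raising the coordinate \<open>c\<close> to the first level at which some other minimum is not larger
  than \<open>x\<close> in the two other coordinates (\<open>owns_imp\<close>). So there are at most \<open>3n\<close> candidates. The level
  is the answer to two dominance queries, and the minima that these find represent the components
  other than that of \<open>x\<close> (\<open>represents_reps\<close>). A candidate that arises from several directions \<open>c\<close> is
  kept for the least one only, so that nothing is listed twice. Membership in \<open>Q\<close> is a dominance
  query as well (\<open>best_member\<close>). All queries of a kind are answered together, in \<open>O(n log n)\<close>: the
  points are sorted by one coordinate, and then by another one with a merge sort, which remembers
  during each merge the best element of the left half that has been placed; this element is offered
  to the elements of the right half when they are placed (\<open>merge_best_best\<close>,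
  \<open>merge_pass_blocks_ok\<close>, \<open>runs_dominance\<close>). The two-dimensional case is not treated separately;
  a missing third coordinate counts as zero.

  The programs are verified by running loop-free code symbolically (\<open>runs_effect\<close>) and by rules for
  loops (\<open>runs_Loop\<close>, \<open>runs_For\<close>), which bound the time by the number of iterations times a constant
  that depends on the program only.
\<close>


section \<open>Points and components\<close>

lemma pt_le_iff: "p \<preceq> q \<longleftrightarrow> length p = length q \<and> (\<forall>k < length p. p ! k \<le> q ! k)"
  by (auto simp: pt_le_def list_all2_conv_all_nth)

lemma pt_le_refl [simp]: "p \<preceq> p"
  by (simp add: pt_le_iff)

lemma pt_le_trans: "p \<preceq> q \<Longrightarrow> q \<preceq> r \<Longrightarrow> p \<preceq> r"
  unfolding pt_le_def using list_all2_trans[of "(\<le>)" "(\<le>)" "(\<le>)" p q r] by auto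

lemma pt_le_antisym: "p \<preceq> q \<Longrightarrow> q \<preceq> p \<Longrightarrow> p = q"
  by (auto simp: pt_le_iff intro!: nth_equalityI order.antisym)

lemma fst_full [simp]: "fst (full S) = S"
  by (simp add: full_def)

lemma poset_full: "poset (full S)"
  unfolding poset_def full_def partial_order_on_def preorder_on_def
  by (auto simp: refl_on_def trans_def antisym_def intro: pt_le_trans pt_le_antisym)

definition conn :: "point set \<Rightarrow> point rel" where
  "conn S = (snd (full S) \<union> (snd (full S))\<inverse>)\<^sup>*"

lemma sym_conn: "sym (conn S)"
  unfolding conn_def by (intro sym_rtrancl) (auto simp: sym_def)

lemma conn_refl [simp]: "(p, p) \<in> conn S"
  by (simp add: conn_def)

lemma conn_trans: "(p, q) \<in> conn S \<Longrightarrow> (q, r) \<in> conn S \<Longrightarrow> (p, r) \<in> conn S"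
  by (simp add: conn_def)

lemma conn_le: "p \<in> S \<Longrightarrow> q \<in> S \<Longrightarrow> p \<preceq> q \<Longrightarrow> (p, q) \<in> conn S"
  by (auto simp: conn_def full_def)

lemma conn_ge: "p \<in> S \<Longrightarrow> q \<in> S \<Longrightarrow> q \<preceq> p \<Longrightarrow> (p, q) \<in> conn S"
  by (auto simp: conn_def full_def)

lemma connected_full: "connected_poset (full S) \<longleftrightarrow> S \<noteq> {} \<and> (\<forall>x \<in> S. \<forall>y \<in> S. (x, y) \<in> conn S)"
  by (simp add: connected_poset_def conn_def)

definition class_of :: "point set \<Rightarrow> point \<Rightarrow> point set" where
  "class_of S x = {y \<in> S. (x, y) \<in> conn S}"

text \<open>A chain of comparabilities that starts in a class never leaves it, so it is also a chain
  inside the class.\<close>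

lemma conn_class_of:
  assumes "(x, y) \<in> conn S" "x \<in> S"
  shows "(x, y) \<in> conn (class_of S x) \<and> y \<in> class_of S x"
  using assms(1) unfolding conn_def[of S]
proof (induction rule: rtrancl_induct)
  case base
  then show ?case using assms by (simp add: class_of_def)
next
  case (step y z)
  have "(x, z) \<in> conn S"
    using step.hyps unfolding conn_def by (rule rtrancl_into_rtrancl)
  moreover have "z \<in> S" "y \<preceq> z \<or> z \<preceq> y"
    using step.hyps(2) by (auto simp: full_def)
  ultimately have "z \<in> class_of S x"
    by (simp add: class_of_def)
  moreover have "(y, z) \<in> conn (class_of S x)"
    using calculation step.IH \<open>y \<preceq> z \<or> z \<preceq> y\<close> conn_le conn_ge by blast
  ultimately show ?case
    using step.IH conn_trans by blast
qed

lemma conn_mono: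
  assumes "subposet B (full S)" "(x, y) \<in> (snd B \<union> (snd B)\<inverse>)\<^sup>*"
  shows "(x, y) \<in> conn S"
proof -
  have "snd B \<union> (snd B)\<inverse> \<subseteq> snd (full S) \<union> (snd (full S))\<inverse>"
    using assms(1) by (auto simp: subposet_def)
  from rtrancl_mono[OF this] assms(2) show ?thesis
    by (auto simp: conn_def)
qed

lemma connected_subposet_class:
  assumes "subposet B (full S)" "connected_poset B" "x \<in> fst B"
  shows "fst B \<subseteq> class_of S x" "snd B \<subseteq> snd (full (class_of S x))"
proof -
  show 1: "fst B \<subseteq> class_of S x"
    using assms conn_mono[OF assms(1)]
    by (auto simp: class_of_def connected_poset_def subposet_def)
  have "snd B \<subseteq> fst B \<times> fst B"
    using assms(1) by (auto simp: subposet_def poset_def partial_order_on_def preorder_on_def refl_on_def)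
  moreover have "snd B \<subseteq> snd (full S)"
    using assms(1) by (simp add: subposet_def)
  ultimately show "snd B \<subseteq> snd (full (class_of S x))"
    using 1 by (fastforce simp: full_def)
qed

lemma connected_full_class_of:
  assumes "x \<in> S"
  shows "connected_poset (full (class_of S x))"
proof -
  have "(y, z) \<in> conn (class_of S x)" if "y \<in> class_of S x" "z \<in> class_of S x" for y z
  proof -
    have "(x, y) \<in> conn (class_of S x)" "(x, z) \<in> conn (class_of S x)"
      using that conn_class_of assms by (auto simp: class_of_def)
    then show ?thesis
      using sym_conn conn_trans by (metis symD)
  qed
  moreover have "x \<in> class_of S x"
    using assms by (simp add: class_of_def)
  ultimately show ?thesis
    by (auto simp: connected_full)
qed

text \<open>A connected subposet lies within a class, and the class itself, with all inherited relations, is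
  connected; so the classes are the maximal connected subposets.\<close>

lemma component_of_full_iff:
  "component_of (full S) A \<longleftrightarrow> (\<exists>x \<in> S. A = full (class_of S x))"
proof
  assume A: "component_of (full S) A"
  then have sub: "subposet A (full S)" and con: "connected_poset A"
    by (auto simp: component_of_def)
  then obtain x where x: "x \<in> fst A"
    by (auto simp: connected_poset_def)
  have "x \<in> S" using x sub by (auto simp: subposet_def)
  moreover have "subposet (full (class_of S x)) (full S)"
    by (simp add: subposet_def poset_full) (auto simp: class_of_def full_def)
  moreover have "subposet A (full (class_of S x))"
    using connected_subposet_class[OF sub con x] sub by (auto simp: subposet_def poset_full)
  ultimately show "\<exists>x \<in> S. A = full (class_of S x)"
    using A connected_full_class_of unfolding component_of_def by blast
next
  assume "\<exists>x \<in> S. A = full (class_of S x)"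
  then obtain x where x: "x \<in> S" and A: "A = full (class_of S x)" by blast
  have "B = A" if B: "subposet B (full S)" "connected_poset B" "subposet A B" for B
  proof -
    have "x \<in> fst B"
      using B(3) x unfolding subposet_def A by (auto simp: class_of_def)
    from connected_subposet_class[OF B(1,2) this] B(3) show ?thesis
      unfolding A by (auto simp: subposet_def prod_eq_iff)
  qed
  moreover have "subposet A (full S)"
    by (simp add: A subposet_def poset_full) (auto simp: class_of_def full_def)
  ultimately show "component_of (full S) A"
    using connected_full_class_of[OF x] by (auto simp: A component_of_def)
qed


section \<open>Components of \<open>dn(q)\<close> and coordinates\<close>

definition below :: "nat \<Rightarrow> point \<Rightarrow> point \<Rightarrow> nat set" where
  "below d q p = {k. k < d \<and> p ! k < q ! k}"

definition minima_below :: "point set \<Rightarrow> point \<Rightarrow> point set" where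
  "minima_below Q q = {m \<in> minima Q. m \<preceq> q \<and> m \<noteq> q}"

text \<open>Two coordinates are linked if some minimum below \<open>q\<close> differs from \<open>q\<close> in both. The classes of the
  equivalence that this generates stand for the components of \<open>dn(q)\<close>.\<close>

definition link :: "nat \<Rightarrow> point set \<Rightarrow> point \<Rightarrow> nat rel" where
  "link d Q q = {(a, b). \<exists>m \<in> minima_below Q q. a \<in> below d q m \<and> b \<in> below d q m}"

definition linked :: "nat \<Rightarrow> point set \<Rightarrow> point \<Rightarrow> point \<Rightarrow> point \<Rightarrow> bool" where
  "linked d Q q p r \<longleftrightarrow> (\<exists>a \<in> below d q p. \<exists>b \<in> below d q r. (a, b) \<in> (link d Q q)\<^sup>*)"

definition join :: "point \<Rightarrow> point \<Rightarrow> point" where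
  "join p q = map2 max p q"

lemma nth_join [simp]: "k < length p \<Longrightarrow> k < length q \<Longrightarrow> join p q ! k = max (p ! k) (q ! k)"
  by (simp add: join_def)

lemma length_join [simp]: "length (join p q) = min (length p) (length q)"
  by (simp add: join_def)

definition represents :: "nat \<Rightarrow> point set \<Rightarrow> point \<Rightarrow> point list \<Rightarrow> bool" where
  "represents d Q q rl \<longleftrightarrow> distinct rl \<and> set rl \<subseteq> minima_below Q q \<and>
     (\<forall>m \<in> minima_below Q q. \<exists>!r. r \<in> set rl \<and> linked d Q q m r)"

lemma sum_list_less:
  assumes "p \<preceq> q" "p \<noteq> q"
  shows "sum_list p < sum_list q"
proof -
  have len: "length p = length q" and le: "\<And>k. k < length q \<Longrightarrow> p ! k \<le> q ! k"
    using assms(1) by (auto simp: pt_le_iff)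
  from assms(2) len obtain k where "k < length q" "p ! k \<noteq> q ! k"
    by (metis nth_equalityI)
  with le have "(\<Sum>k<length q. p ! k) < (\<Sum>k<length q. q ! k)"
    by (intro sum_strict_mono_ex1) (auto intro!: bexI[of _ k] le_neq_implies_less)
  then show ?thesis
    using len by (simp add: sum_list_sum_nth atLeast0LessThan)
qed

lemma exists_minimum_below:
  assumes "p \<in> S"
  shows "\<exists>m \<in> minima S. m \<preceq> p"
  using assms
proof (induction p rule: measure_induct_rule[of sum_list])
  case (less p)
  show ?case
  proof (cases "p \<in> minima S")
    case False
    then obtain r where "r \<in> S" "r \<preceq> p" "r \<noteq> p"
      using less.prems by (auto simp: minima_def)
    with less.IH[of r] show ?thesis
      using sum_list_less pt_le_trans by blast
  qed (use pt_le_refl in blast)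
qed

lemma exists_maximum_above:
  assumes "finite S" "p \<in> S"
  shows "\<exists>x \<in> maxima S. p \<preceq> x"
proof -
  define B where "B = {x \<in> S. p \<preceq> x}"
  have B: "finite B" "p \<in> B"
    using assms by (auto simp: B_def)
  then have "Max (sum_list ` B) \<in> sum_list ` B"
    by (intro Max_in) auto
  then obtain x where x: "x \<in> B" "sum_list x = Max (sum_list ` B)"
    by auto
  have "y = x" if "y \<in> S" "x \<preceq> y" for y
  proof (rule ccontr)
    assume "y \<noteq> x"
    then have "sum_list x < sum_list y"
      using sum_list_less that by blast
    moreover have "y \<in> B"
      using x(1) that pt_le_trans by (auto simp: B_def)
    then have "sum_list y \<le> sum_list x"
      using B x(2) by simp
    ultimately show False by simp
  qed
  then show ?thesis
    using x(1) by (auto simp: B_def maxima_def)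
qed

locale nat_interval =
  fixes d :: nat and Q :: "point set"
  assumes interval: "interval d Q"
begin

lemma length_eq: "p \<in> Q \<Longrightarrow> length p = d"
  using interval by (auto simp: interval_def space_N_def)

lemma convexD: "p \<in> Q \<Longrightarrow> r \<in> Q \<Longrightarrow> p \<preceq> q \<Longrightarrow> q \<preceq> r \<Longrightarrow> q \<in> Q"
  using interval unfolding interval_def space_N_def
  by (metis (mono_tags, lifting) length_eq mem_Collect_eq pt_le_iff)

lemma minima_in: "m \<in> minima Q \<Longrightarrow> m \<in> Q"
  by (simp add: minima_def)

lemma minima_antichain: "m \<in> minima Q \<Longrightarrow> p \<in> Q \<Longrightarrow> p \<preceq> m \<Longrightarrow> p = m"
  by (auto simp: minima_def)

lemma below_ne: "p \<in> dn Q q \<Longrightarrow> q \<in> Q \<Longrightarrow> below d q p \<noteq> {}"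
proof
  assume p: "p \<in> dn Q q" "q \<in> Q" "below d q p = {}"
  then have "p ! k = q ! k" if "k < d" for k
    using that length_eq[of p]
    by (auto simp: dn_def below_def pt_le_iff)
       (metis le_antisym linorder_not_less)
  then show False
    using p length_eq[of p] length_eq[of q] by (auto simp: dn_def intro: nth_equalityI)
qed

lemma minima_below_dn: "m \<in> minima_below Q q \<Longrightarrow> m \<in> dn Q q"
  by (auto simp: minima_below_def dn_def minima_def)

text \<open>Two elements of \<open>dn(q)\<close> that differ from \<open>q\<close> in a common coordinate lie above two minima
  whose join still differs from \<open>q\<close> in that coordinate; the join belongs to \<open>Q\<close> by convexity and
  connects them.\<close>

lemma conn_if_common_coordinate:
  assumes q: "q \<in> Q" and p: "p \<in> dn Q q" and p': "p' \<in> dn Q q"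
    and a: "a \<in> below d q p" "a \<in> below d q p'"
  shows "(p, p') \<in> conn (dn Q q)"
proof -
  obtain m where m: "m \<in> minima Q" "m \<preceq> p"
    using exists_minimum_below p by (auto simp: dn_def)
  obtain m' where m': "m' \<in> minima Q" "m' \<preceq> p'"
    using exists_minimum_below p' by (auto simp: dn_def)
  define j where "j = join m m'"
  have len: "length m = d" "length m' = d" "length q = d" "length p = d" "length p' = d"
    using m m' q p p' length_eq minima_in by (auto simp: dn_def)
  have mq: "m \<preceq> q" "m' \<preceq> q"
    using m m' p p' pt_le_trans by (auto simp: dn_def)
  have "m \<preceq> j" "m' \<preceq> j" "j \<preceq> q"
    using mq len by (auto simp: j_def pt_le_iff)
  moreover have "j ! a < q ! a"
    using a m(2) m'(2) len by (auto simp: j_def below_def pt_le_iff intro: le_less_trans)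
  moreover have "j \<in> Q"
    using convexD[OF minima_in[OF m(1)] q \<open>m \<preceq> j\<close> \<open>j \<preceq> q\<close>] .
  ultimately have j: "j \<in> dn Q q"
    by (auto simp: dn_def)
  have "m \<in> dn Q q" "m' \<in> dn Q q"
    using mq minima_in m m' p p' pt_le_antisym by (auto simp: dn_def)
  then show ?thesis
    using conn_ge[OF p _ m(2)] conn_le[OF _ j \<open>m \<preceq> j\<close>] conn_ge[OF j _ \<open>m' \<preceq> j\<close>]
      conn_le[OF _ p' m'(2)] conn_trans by blast
qed

text \<open>Walking along links from one coordinate to the next, the minima that witness the links connect
  the elements of \<open>dn(q)\<close> that differ from \<open>q\<close> in these coordinates.\<close>

lemma conn_if_link:
  assumes "(a, b) \<in> (link d Q q)\<^sup>*" "q \<in> Q" "p \<in> dn Q q" "p' \<in> dn Q q"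
    "a \<in> below d q p" "b \<in> below d q p'"
  shows "(p, p') \<in> conn (dn Q q)"
  using assms
proof (induction arbitrary: p' rule: rtrancl_induct)
  case base
  then show ?case using conn_if_common_coordinate by blast
next
  case (step b c)
  then obtain m where m: "m \<in> minima_below Q q" "b \<in> below d q m" "c \<in> below d q m"
    by (auto simp: link_def)
  with step show ?case
    using conn_if_common_coordinate[of q m p' c] minima_below_dn conn_trans by blast
qed

text \<open>A minimum below \<open>p\<close> differs from \<open>q\<close> in all coordinates in which \<open>p\<close> does.\<close>

lemma link_if_same_point:
  assumes "q \<in> Q" "p \<in> dn Q q" "a \<in> below d q p" "b \<in> below d q p"
  shows "(a, b) \<in> link d Q q"
proof -
  obtain m where m: "m \<in> minima Q" "m \<preceq> p"
    using exists_minimum_below assms by (auto simp: dn_def)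
  have len: "length m = d" "length p = d"
    using m minima_in assms length_eq by (auto simp: dn_def)
  have "m \<in> minima_below Q q"
    using m assms pt_le_trans pt_le_antisym by (fastforce simp: minima_below_def dn_def)
  moreover have "below d q p \<subseteq> below d q m"
    using m(2) len by (auto simp: below_def pt_le_iff intro: le_less_trans)
  ultimately show ?thesis
    using assms by (auto simp: link_def)
qed

text \<open>So each component of \<open>dn(q)\<close> is determined by the coordinates in which its elements differ
  from \<open>q\<close>, and the minima alone tell which coordinates go together.\<close>

lemma conn_iff_linked:
  assumes q: "q \<in> Q" and p: "p \<in> dn Q q" "p' \<in> dn Q q"
  shows "(p, p') \<in> conn (dn Q q) \<longleftrightarrow> linked d Q q p p'"
proof
  assume "linked d Q q p p'"
  then show "(p, p') \<in> conn (dn Q q)"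
    unfolding linked_def using conn_if_link assms by blast
next
  assume "(p, p') \<in> conn (dn Q q)"
  then show "linked d Q q p p'"
    using p(2) unfolding conn_def
  proof (induction rule: rtrancl_induct)
    case base
    then show ?case using below_ne[OF base q] by (auto simp: linked_def)
  next
    case (step y z)
    then have yz: "y \<in> dn Q q" "z \<in> dn Q q" "y \<preceq> z \<or> z \<preceq> y"
      by (auto simp: full_def)
    have "below d q y \<subseteq> below d q z \<or> below d q z \<subseteq> below d q y"
    proof -
      have len: "length y = d" "length z = d"
        using yz length_eq by (auto simp: dn_def)
      show ?thesis using yz(3)
      proof
        assume "y \<preceq> z"
        then have "below d q z \<subseteq> below d q y"
          using len by (auto simp: below_def pt_le_iff intro: le_less_trans)
        then show ?thesis ..
      next
        assume "z \<preceq> y"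
        then have "below d q y \<subseteq> below d q z"
          using len by (auto simp: below_def pt_le_iff intro: le_less_trans)
        then show ?thesis ..
      qed
    qed
    then obtain c where c: "c \<in> below d q y" "c \<in> below d q z"
      using below_ne[OF yz(1) q] below_ne[OF yz(2) q] by blast
    from step.IH[OF yz(1)] obtain a b where ab: "a \<in> below d q p" "b \<in> below d q y"
      "(a, b) \<in> (link d Q q)\<^sup>*"
      by (auto simp: linked_def)
    have "(b, c) \<in> link d Q q"
      using link_if_same_point q yz(1) ab(2) c(1) by blast
    with ab c(2) show ?case
      by (auto simp: linked_def intro: rtrancl_into_rtrancl)
  qed
qed

lemma dn_minimum: "q \<in> Q \<Longrightarrow> dn Q q = {} \<longleftrightarrow> q \<in> minima Q"
  by (auto simp: dn_def minima_def)

lemma minima_initial: "minima Q \<subseteq> initial_points Q"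
  using dn_minimum minima_in by (auto simp: initial_points_def connected_full)

lemma linked_minimum_below:
  assumes "q \<in> Q" "p \<in> dn Q q"
  obtains m where "m \<in> minima_below Q q" "m \<preceq> p" "(p, m) \<in> conn (dn Q q)"
proof -
  obtain m where m: "m \<in> minima Q" "m \<preceq> p"
    using exists_minimum_below assms by (auto simp: dn_def)
  then have "m \<in> minima_below Q q"
    using assms pt_le_trans pt_le_antisym by (fastforce simp: minima_below_def dn_def)
  with m that show ?thesis
    using conn_ge assms(2) minima_below_dn by blast
qed

lemma initial_points_iff:
  "q \<in> initial_points Q \<longleftrightarrow> q \<in> minima Q \<or>
     (q \<in> Q \<and> (\<exists>m \<in> minima_below Q q. \<exists>m' \<in> minima_below Q q. \<not> linked d Q q m m'))"
    (is "_ \<longleftrightarrow> _ \<or> (_ \<and> ?E)")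
proof (cases "q \<in> Q \<and> q \<notin> minima Q")
  case True
  then have q: "q \<in> Q" and ne: "dn Q q \<noteq> {}"
    using dn_minimum by auto
  have "connected_poset (full (dn Q q)) \<longleftrightarrow> \<not> ?E"
  proof
    assume "connected_poset (full (dn Q q))"
    then show "\<not> ?E"
      using conn_iff_linked[OF q] minima_below_dn by (auto simp: connected_full)
  next
    assume E: "\<not> ?E"
    have "(x, y) \<in> conn (dn Q q)" if xy: "x \<in> dn Q q" "y \<in> dn Q q" for x y
    proof -
      obtain m where m: "m \<in> minima_below Q q" "(x, m) \<in> conn (dn Q q)"
        using linked_minimum_below q xy by blast
      obtain m' where m': "m' \<in> minima_below Q q" "(y, m') \<in> conn (dn Q q)"
        using linked_minimum_below q xy by blast
      have "(m, m') \<in> conn (dn Q q)"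
        using E m m' conn_iff_linked q minima_below_dn by blast
      then show ?thesis
        using m(2) m'(2) sym_conn conn_trans by (metis symD)
    qed
    then show "connected_poset (full (dn Q q))"
      using ne by (simp add: connected_full)
  qed
  then show ?thesis
    using True by (auto simp: initial_points_def)
qed (use minima_initial in \<open>auto simp: initial_points_def\<close>)

text \<open>The poset that is output: a list of its elements, each with the minima that are related to it.\<close>

definition scaffold_of :: "(point \<times> point list) list \<Rightarrow> point poset" where
  "scaffold_of ol = (set (map fst ol),
     Id_on (set (map fst ol)) \<union> {(r, q). \<exists>rl. (q, rl) \<in> set ol \<and> r \<in> set rl})"

text \<open>Transitivity and antisymmetry are automatic because relations other than identities only go from
  minima of \<open>Q\<close> to elements that are not minima.\<close>

lemma initial_scaffold_scaffold_of:
  assumes set: "set (map fst ol) = initial_points Q"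
    and dist: "distinct (map fst ol)"
    and rep: "\<And>q rl. (q, rl) \<in> set ol \<Longrightarrow> represents d Q q rl"
  shows "initial_scaffold Q (scaffold_of ol)"
proof -
  define P where "P = scaffold_of ol"
  have fstP: "fst P = initial_points Q"
    using set by (simp add: P_def scaffold_of_def)
  have sndP: "(m, p) \<in> snd P \<longleftrightarrow> m = p \<and> p \<in> initial_points Q \<or> (\<exists>rl. (p, rl) \<in> set ol \<and> m \<in> set rl)"
    for m p
    using set by (auto simp: P_def scaffold_of_def)
  have rel: "m \<in> minima_below Q p \<and> p \<in> Q \<and> p \<in> initial_points Q"
    if "(p, rl) \<in> set ol" "m \<in> set rl" for m p rl
  proof -
    have "p \<in> initial_points Q"
      using that set by force
    then show ?thesis
      using rep[OF that(1)] that by (auto simp: represents_def initial_points_def)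
  qed
  have poset: "poset P"
    unfolding poset_def partial_order_on_def preorder_on_def fstP
  proof (intro conjI)
    show "snd P \<subseteq> initial_points Q \<times> initial_points Q"
      using sndP rel minima_initial by (fastforce simp: minima_below_def)
    show "refl_on (initial_points Q) (snd P)"
      by (auto simp: refl_on_def sndP)
    have kinds: "m = p \<or> m \<in> minima Q \<and> p \<notin> minima Q" if "(m, p) \<in> snd P" for m p
      using that rel[of p _ m] minima_antichain[of p m] minima_in
      by (auto simp: sndP minima_below_def)
    show "trans (snd P)"
      unfolding trans_def using kinds by blast
    show "antisym (snd P)"
      unfolding antisym_def using kinds by blast
  qed
  have sub: "subposet P (full Q)"
    using poset poset_full rel minima_in
    by (fastforce simp: subposet_def fstP initial_points_def full_def sndP minima_below_def)
  have cond: "(\<exists>!m. m \<in> fst A \<and> (m, p) \<in> snd P) \<and> (\<forall>m. m \<in> fst A \<and> (m, p) \<in> snd P \<longrightarrow> m \<in> minima Q)"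
    if p: "p \<in> fst P" and A: "component_of (full (dn Q p)) A" for p A
  proof -
    obtain x where x: "x \<in> dn Q p" and A: "fst A = class_of (dn Q p) x"
      using A by (auto simp: component_of_full_iff)
    have pQ: "p \<in> Q"
      using p by (simp add: fstP initial_points_def)
    obtain m where m: "m \<in> minima_below Q p" "(x, m) \<in> conn (dn Q p)"
      using linked_minimum_below pQ x by blast
    obtain rl where rl: "(p, rl) \<in> set ol"
      using p unfolding fstP set[symmetric] by auto
    have rl_unique: "rl' = rl" if "(p, rl') \<in> set ol" for rl'
      using that rl dist by (metis eq_key_imp_eq_value)
    have irr: "p \<notin> dn Q p"
      by (simp add: dn_def)
    have "m' \<in> fst A \<and> (m', p) \<in> snd P \<longleftrightarrow> m' \<in> set rl \<and> linked d Q p m m'" for m'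
    proof -
      have "m' \<in> fst A \<and> (m', p) \<in> snd P \<longleftrightarrow> m' \<in> set rl \<and> (x, m') \<in> conn (dn Q p)"
      proof
        assume L: "m' \<in> fst A \<and> (m', p) \<in> snd P"
        then have "m' \<noteq> p"
          using irr by (auto simp: A class_of_def)
        then show "m' \<in> set rl \<and> (x, m') \<in> conn (dn Q p)"
          using L rl_unique sndP[of m' p] by (auto simp: A class_of_def)
      next
        assume "m' \<in> set rl \<and> (x, m') \<in> conn (dn Q p)"
        then show "m' \<in> fst A \<and> (m', p) \<in> snd P"
          using rl rel[OF rl, of m'] minima_below_dn[of m' p] sndP[of m' p]
          by (auto simp: A class_of_def)
      qed
      also have "\<dots> \<longleftrightarrow> m' \<in> set rl \<and> (m, m') \<in> conn (dn Q p)"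
        using m(2) sym_conn conn_trans by (metis symD)
      also have "\<dots> \<longleftrightarrow> m' \<in> set rl \<and> linked d Q p m m'"
        using conn_iff_linked[OF pQ minima_below_dn[OF m(1)]] rel[OF rl] minima_below_dn by blast
      finally show ?thesis .
    qed
    moreover have "m' \<in> minima Q" if "m' \<in> set rl" for m'
      using rel[OF rl that] by (simp add: minima_below_def)
    ultimately show ?thesis
      using rep[OF rl] m(1) by (simp add: represents_def)
  qed
  have inside: "\<exists>A. component_of (full (dn Q p)) A \<and> m \<in> fst A" if mp: "(m, p) \<in> snd P" "m \<noteq> p" for m p
  proof -
    have "m \<in> dn Q p"
      using mp rel minima_below_dn by (auto simp: sndP)
    then have "component_of (full (dn Q p)) (full (class_of (dn Q p) m))" "m \<in> class_of (dn Q p) m"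
      unfolding component_of_full_iff by (auto simp: class_of_def)
    then show ?thesis
      by (metis fst_full)
  qed
  show ?thesis
    unfolding initial_scaffold_def P_def[symmetric] using sub fstP cond inside by blast
qed

lemma scaffold_of_relations:
  assumes dist: "distinct (map fst ol)"
    and rep: "\<And>q rl. (q, rl) \<in> set ol \<Longrightarrow> represents d Q q rl"
  shows "lists_set (concat (map (\<lambda>(q, rl). map (\<lambda>r. (r, q)) rl) ol)) (snd (scaffold_of ol) - Id)"
proof -
  have "distinct (concat (map (\<lambda>(q, rl). map (\<lambda>r. (r, q)) rl) ol))"
    using assms
  proof (induction ol)
    case (Cons x ol)
    obtain q rl where x: "x = (q, rl)" by fastforce
    have "distinct rl"
      using Cons.prems(2)[of q rl] by (simp add: x represents_def)
    moreover have "q \<noteq> q'" if "(q', rl') \<in> set ol" for q' rl'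
      using Cons.prems(1) that by (force simp: x)
    ultimately show ?case
      using Cons by (auto simp: x distinct_map inj_on_def)
  qed simp
  moreover have "r \<noteq> q" if "(q, rl) \<in> set ol" "r \<in> set rl" for q r rl
    using rep[OF that(1)] that(2) by (auto simp: represents_def minima_below_def)
  moreover have "set (concat (map (\<lambda>(q, rl). map (\<lambda>r. (r, q)) rl) ol)) =
      {(r, q). \<exists>rl. (q, rl) \<in> set ol \<and> r \<in> set rl}"
    by force
  ultimately show ?thesis
    unfolding lists_set_def scaffold_of_def snd_conv by (simp only: Un_Diff) (fastforce simp: Id_on_def)
qed

end


section \<open>Membership in an interval\<close>

text \<open>A way of specifying an interval, together with the membership test that it offers for points
  above a minimum: in the upset presentation, no point of the second list may be below; in the
  specification by extrema, some point of the second list must be above.\<close>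

definition member_by :: "bool \<Rightarrow> point set \<Rightarrow> point \<Rightarrow> bool" where
  "member_by upset Y q \<longleftrightarrow> (if upset then \<not> (\<exists>y \<in> Y. y \<preceq> q) else (\<exists>y \<in> Y. q \<preceq> y))"

lemma (in nat_interval) member_by_upset_presentation:
  assumes "m \<in> Q" "m \<preceq> q"
  shows "q \<in> Q \<longleftrightarrow> member_by True (snd (upset_presentation d Q)) q"
proof -
  have len: "length q = d"
    using assms length_eq by (simp add: pt_le_iff)
  have "q \<in> Q" if "\<not> (\<exists>y \<in> minima (up d Q - Q). y \<preceq> q)"
  proof (rule ccontr)
    assume "q \<notin> Q"
    then have "q \<in> up d Q - Q"
      using assms len by (auto simp: up_def space_N_def)
    then show False
      using exists_minimum_below that by blast
  qed
  moreover have "q \<notin> Q" if "y \<in> minima (up d Q - Q)" "y \<preceq> q" for y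
    using that convexD by (auto simp: minima_def up_def)
  ultimately show ?thesis
    by (auto simp: member_by_def upset_presentation_def)
qed

lemma (in nat_interval) member_by_extrema:
  assumes "m \<in> Q" "m \<preceq> q" "finite Q"
  shows "q \<in> Q \<longleftrightarrow> member_by False (snd (extrema Q)) q"
  using exists_maximum_above[OF assms(3)] convexD[OF assms(1) _ assms(2)]
  by (auto simp: member_by_def extrema_def maxima_def)


section \<open>Reasoning about programs and their running time\<close>

definition runs :: "com \<Rightarrow> state \<Rightarrow> nat \<Rightarrow> (state \<Rightarrow> bool) \<Rightarrow> bool" where
  "runs c s b Q \<longleftrightarrow> (\<exists>t s'. exec c s t s' \<and> t \<le> b \<and> Q s')"

text \<open>What a program can change is visible from its text. The rules below supply this information at
  each step, which keeps it out of the loop invariants.\<close>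

fun regs_of :: "com \<Rightarrow> nat set" where
  "regs_of Skip = {}"
| "regs_of (SetReg x e) = {x}"
| "regs_of (Write a i e) = {}"
| "regs_of (Seq c c') = regs_of c \<union> regs_of c'"
| "regs_of (Cond b c c') = regs_of c \<union> regs_of c'"
| "regs_of (Loop b c) = regs_of c"

fun arrs_of :: "com \<Rightarrow> nat set" where
  "arrs_of Skip = {}"
| "arrs_of (SetReg x e) = {}"
| "arrs_of (Write a i e) = {a}"
| "arrs_of (Seq c c') = arrs_of c \<union> arrs_of c'"
| "arrs_of (Cond b c c') = arrs_of c \<union> arrs_of c'"
| "arrs_of (Loop b c) = arrs_of c"

definition frame :: "nat set \<Rightarrow> nat set \<Rightarrow> state \<Rightarrow> state \<Rightarrow> bool" where
  "frame W A s s' \<longleftrightarrow> (\<forall>x. x \<notin> W \<longrightarrow> reg s' x = reg s x) \<and> (\<forall>a. a \<notin> A \<longrightarrow> arr s' a = arr s a)"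

lemma frame_reg: "frame W A s s' \<Longrightarrow> x \<notin> W \<Longrightarrow> reg s' x = reg s x"
  by (simp add: frame_def)

lemma frame_arr: "frame W A s s' \<Longrightarrow> a \<notin> A \<Longrightarrow> arr s' a = arr s a"
  by (simp add: frame_def)

lemma frame_refl [simp]: "frame W A s s"
  by (simp add: frame_def)

lemma frame_trans: "frame W A s s' \<Longrightarrow> frame W A s' s'' \<Longrightarrow> frame W A s s''"
  by (simp add: frame_def)

lemma frame_mono: "frame W A s s' \<Longrightarrow> W \<subseteq> W' \<Longrightarrow> A \<subseteq> A' \<Longrightarrow> frame W' A' s s'"
  by (auto simp: frame_def)

lemma reg_set_reg [simp]: "reg (set_reg x v s) y = (if y = x then v else reg s y)"
  by (simp add: set_reg_def)

lemma arr_set_reg [simp]: "arr (set_reg x v s) = arr s"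
  by (simp add: set_reg_def)

lemma reg_set_cell [simp]: "reg (set_cell a i v s) = reg s"
  by (simp add: set_cell_def)

lemma arr_set_cell [simp]: "arr (set_cell a i v s) b = (if b = a then (arr s a)(i := v) else arr s b)"
  by (simp add: set_cell_def)

lemma exec_frame: "exec c s t s' \<Longrightarrow> frame (regs_of c) (arrs_of c) s s'"
proof (induction rule: exec.induct)
  case (exec_Seq c s t s' c' t' s'')
  then show ?case
    by (auto intro: frame_trans frame_mono)
next
  case (exec_Loop_True b s c t s' t' s'')
  then show ?case
    by (auto intro: frame_trans)
qed (auto simp: frame_def)

lemma runs_frame:
  assumes "runs c s b R" "\<And>s'. frame (regs_of c) (arrs_of c) s s' \<Longrightarrow> R s' \<Longrightarrow> Q s'"
  shows "runs c s b Q"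
  using assms exec_frame unfolding runs_def by blast

lemma runs_mono: "runs c s b R \<Longrightarrow> b \<le> b' \<Longrightarrow> (\<And>s'. R s' \<Longrightarrow> Q s') \<Longrightarrow> runs c s b' Q"
  unfolding runs_def by (meson order.trans)

lemma runs_Seq:
  assumes "runs c s b R" "\<And>s'. R s' \<Longrightarrow> frame (regs_of c) (arrs_of c) s s' \<Longrightarrow> runs c' s' b' Q"
  shows "runs (Seq c c') s (b + b') Q"
  using assms exec_frame unfolding runs_def by (meson add_le_mono exec_Seq)

lemma runs_Cond:
  assumes "test_val b s \<Longrightarrow> runs c s B Q" "\<not> test_val b s \<Longrightarrow> runs c' s B' Q"
  shows "runs (Cond b c c') s (1 + test_cost b + B + B') Q"
proof (cases "test_val b s")
  case True
  with assms(1) obtain t s' where "exec c s t s'" "t \<le> B" "Q s'"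
    unfolding runs_def by blast
  then show ?thesis
    unfolding runs_def using exec_Cond_True[OF True, of c t s' c'] by (intro exI conjI) auto
next
  case False
  with assms(2) obtain t s' where "exec c' s t s'" "t \<le> B'" "Q s'"
    unfolding runs_def by blast
  then show ?thesis
    unfolding runs_def using exec_Cond_False[OF False, of c' t s' c] by (intro exI conjI) auto
qed

text \<open>The final state of code without loops is a function of the initial one, which the simplifier
  can compute, and its time has a bound that is the same for all states.\<close>

fun loop_free :: "com \<Rightarrow> bool" where
  "loop_free (Seq c c') \<longleftrightarrow> loop_free c \<and> loop_free c'"
| "loop_free (Cond b c c') \<longleftrightarrow> loop_free c \<and> loop_free c'"
| "loop_free (Loop b c) \<longleftrightarrow> False"
| "loop_free _ \<longleftrightarrow> True"

fun effect :: "com \<Rightarrow> state \<Rightarrow> state" where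
  "effect Skip s = s"
| "effect (SetReg x e) s = set_reg x (exp_val e s) s"
| "effect (Write a i e) s = set_cell a (exp_val i s) (exp_val e s) s"
| "effect (Seq c c') s = effect c' (effect c s)"
| "effect (Cond b c c') s = (if test_val b s then effect c s else effect c' s)"
| "effect (Loop b c) s = s"

fun max_cost :: "com \<Rightarrow> nat" where
  "max_cost Skip = 1"
| "max_cost (SetReg x e) = 1 + exp_cost e"
| "max_cost (Write a i e) = 1 + exp_cost i + exp_cost e"
| "max_cost (Seq c c') = max_cost c + max_cost c'"
| "max_cost (Cond b c c') = 1 + test_cost b + max_cost c + max_cost c'"
| "max_cost (Loop b c) = 0"

lemma runs_effect:
  assumes "loop_free c" "Q (effect c s)"
  shows "runs c s (max_cost c) Q"
proof -
  from assms(1) have "runs c s (max_cost c) (\<lambda>s'. s' = effect c s)"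
  proof (induction c arbitrary: s)
    case (Cond b c c')
    then show ?case
      using runs_Cond[of b s c "max_cost c" _ c' "max_cost c'"] by simp
  next
    case (Seq c c')
    then show ?case
      using runs_Seq[of c s "max_cost c" "\<lambda>s'. s' = effect c s" c' "max_cost c'"] by auto
  qed (auto simp: runs_def intro: exec.intros)
  then show ?thesis
    using runs_mono assms(2) by blast
qed

lemma effect_frame: "loop_free c \<Longrightarrow> frame (regs_of c) (arrs_of c) s (effect c s)"
  using runs_effect[of c "\<lambda>s'. s' = effect c s" s] exec_frame by (auto simp: runs_def)

text \<open>The dimension is a constant of the program, so work on the coordinates of a point is unrolled
  and stays free of loops.\<close>

fun seqs :: "com list \<Rightarrow> com" where
  "seqs [] = Skip"
| "seqs (c # cs) = Seq c (seqs cs)"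

lemma regs_of_seqs [simp]: "regs_of (seqs cs) = (\<Union>c \<in> set cs. regs_of c)"
  by (induction cs) auto

lemma arrs_of_seqs [simp]: "arrs_of (seqs cs) = (\<Union>c \<in> set cs. arrs_of c)"
  by (induction cs) auto

lemma loop_free_seqs [simp]: "loop_free (seqs cs) \<longleftrightarrow> (\<forall>c \<in> set cs. loop_free c)"
  by (induction cs) auto

lemma effect_seqs [simp]: "effect (seqs cs) s = fold effect cs s"
  by (induction cs arbitrary: s) auto

lemma fold_effect_upt:
  assumes "P 0 s" "\<And>k s. k < n \<Longrightarrow> P k s \<Longrightarrow> P (Suc k) (effect (f k) s)"
  shows "P n (fold effect (map f [0..<n]) s)"
proof -
  have "P m (fold effect (map f [0..<m]) s)" if "m \<le> n" for m
    using that assms by (induction m) auto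
  then show ?thesis by simp
qed

text \<open>Multiplication by a constant, as repeated addition.\<close>

fun mul :: "nat \<Rightarrow> exp \<Rightarrow> exp" where
  "mul 0 e = Lit 0"
| "mul (Suc k) e = Add e (mul k e)"

lemma exp_val_mul [simp]: "exp_val (mul k e) s = k * exp_val e s"
  by (induction k) auto

fun all_below :: "nat \<Rightarrow> (nat \<Rightarrow> test) \<Rightarrow> test" where
  "all_below 0 f = Less (Lit 0) (Lit 1)"
| "all_below (Suc k) f = Conj (all_below k f) (f k)"

lemma test_val_all_below [simp]: "test_val (all_below n f) s \<longleftrightarrow> (\<forall>k < n. test_val (f k) s)"
  by (induction n) (auto simp: less_Suc_eq)

definition For :: "nat \<Rightarrow> exp \<Rightarrow> com \<Rightarrow> com" where
  "For i e c = Seq (SetReg i (Lit 0))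
     (Loop (Less (Reg i) e) (Seq c (SetReg i (Add (Reg i) (Lit 1)))))"

lemma regs_of_For [simp]: "regs_of (For i e c) = insert i (regs_of c)"
  by (auto simp: For_def)

lemma arrs_of_For [simp]: "arrs_of (For i e c) = arrs_of c"
  by (auto simp: For_def)

text \<open>The invariant carries a variant, which bounds the number of iterations still to come.\<close>

lemma runs_Loop:
  assumes I: "I n s"
    and step: "\<And>n s. I n s \<Longrightarrow> test_val b s \<Longrightarrow> n > 0 \<and> runs c s B (I (n - 1))"
    and post: "\<And>n s. I n s \<Longrightarrow> \<not> test_val b s \<Longrightarrow> Q s"
  shows "runs (Loop b c) s (n * (B + test_cost b + 1) + test_cost b + 1) Q"
  using I
proof (induction n arbitrary: s)
  case 0
  then have "\<not> test_val b s"
    using step by blast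
  then show ?case
    using post[OF 0] exec_Loop_False[of b s c] unfolding runs_def by auto
next
  case (Suc n)
  show ?case
  proof (cases "test_val b s")
    case True
    with step[OF Suc.prems] obtain t s' where 1: "exec c s t s'" "t \<le> B" "I n s'"
      unfolding runs_def by auto
    from Suc.IH[OF 1(3)] obtain t' s'' where
      2: "exec (Loop b c) s' t' s''" "t' \<le> n * (B + test_cost b + 1) + test_cost b + 1" "Q s''"
      unfolding runs_def by auto
    show ?thesis
      using exec_Loop_True[OF True 1(1) 2(1)] 1(2) 2(2,3) unfolding runs_def
      by (intro exI conjI) auto
  next
    case False
    then show ?thesis
      using post[OF Suc.prems False] exec_Loop_False[of b s c] unfolding runs_def
      by (intro exI conjI) auto
  qed
qed

text \<open>The step and the final assertion may use that the memory not mentioned in the body is the same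
  as before the loop.\<close>

lemma runs_For:
  assumes init: "\<And>s'. s' = set_reg i 0 s \<Longrightarrow> I 0 s'"
    and step: "\<And>k s'. k < N \<Longrightarrow> I k s' \<Longrightarrow> reg s' i = k \<Longrightarrow>
      frame (insert i (regs_of c)) (arrs_of c) s s' \<Longrightarrow>
      runs c s' B (\<lambda>s''. I (Suc k) (set_reg i (Suc k) s''))"
    and i: "i \<notin> regs_of c"
    and bound: "\<And>s'. frame (insert i (regs_of c)) (arrs_of c) s s' \<Longrightarrow> exp_val e s' = N"
    and post: "\<And>s'. I N s' \<Longrightarrow> frame (insert i (regs_of c)) (arrs_of c) s s' \<Longrightarrow> Q s'"
  shows "runs (For i e c) s ((N + 1) * (B + exp_cost e + 7)) Q"
proof -
  define F where "F = frame (insert i (regs_of c)) (arrs_of c) s"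
  define J where "J = (\<lambda>n s'. \<exists>k. k + n = N \<and> reg s' i = k \<and> I k s' \<and> F s')"
  let ?b = "Less (Reg i) e" and ?c = "Seq c (SetReg i (Add (Reg i) (Lit 1)))"
  have loop: "runs (Loop ?b ?c) s' (N * ((B + 4) + test_cost ?b + 1) + test_cost ?b + 1) Q"
    if s': "s' = set_reg i 0 s" for s'
  proof (rule runs_Loop[where I = J])
    show "J N s'"
      using init[OF s'] s' by (auto simp: J_def F_def frame_def)
  next
    fix n s1 assume J: "J n s1" "test_val ?b s1"
    then obtain k where k: "k + n = N" "reg s1 i = k" "I k s1" "F s1"
      by (auto simp: J_def)
    have kN: "k < N"
      using J(2) k bound by (auto simp: F_def)
    have "runs ?c s1 (B + 4) (J (n - 1))"
    proof (rule runs_Seq)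
      show "runs c s1 B (\<lambda>s''. I (Suc k) (set_reg i (Suc k) s''))"
        using step[OF kN k(3) k(2)] k(4) by (simp add: F_def)
    next
      fix s2 assume I2: "I (Suc k) (set_reg i (Suc k) s2)" and fr: "frame (regs_of c) (arrs_of c) s1 s2"
      have "reg s2 i = k"
        using fr k(2) i frame_reg by blast
      then have ef: "effect (SetReg i (Add (Reg i) (Lit 1))) s2 = set_reg i (Suc k) s2"
        by simp
      have "F s2"
        using k(4) fr unfolding F_def by (meson frame_mono frame_trans order_refl subset_insertI)
      then have "F (set_reg i (Suc k) s2)"
        by (auto simp: F_def frame_def)
      then have "J (n - 1) (set_reg i (Suc k) s2)"
        using I2 k(1) kN by (auto simp: J_def)
      then show "runs (SetReg i (Add (Reg i) (Lit 1))) s2 4 (J (n - 1))"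
        using runs_effect[of "SetReg i (Add (Reg i) (Lit 1))" "J (n - 1)" s2, unfolded ef] by (simp add: numeral_eq_Suc)
    qed
    then show "n > 0 \<and> runs ?c s1 (B + 4) (J (n - 1))"
      using k(1) kN by simp
  next
    fix n s1 assume J: "J n s1" "\<not> test_val ?b s1"
    then obtain k where k: "k + n = N" "reg s1 i = k" "I k s1" "F s1"
      by (auto simp: J_def)
    moreover have "k = N"
      using J(2) k bound[of s1] by (auto simp: F_def)
    ultimately show "Q s1"
      using post by (auto simp: F_def)
  qed
  have init: "runs (SetReg i (Lit 0)) s 2 (\<lambda>s'. s' = set_reg i 0 s)"
    using runs_effect[of "SetReg i (Lit 0)" "\<lambda>s'. s' = set_reg i 0 s" s] by (simp add: numeral_eq_Suc)
  have "runs (For i e c) s (2 + (N * ((B + 4) + test_cost ?b + 1) + test_cost ?b + 1)) Q"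
    unfolding For_def by (rule runs_Seq[OF init loop])
  then show ?thesis
    by (rule runs_mono) (auto simp: algebra_simps)
qed


section \<open>Merge sort that answers dominance queries\<close>

definition best_in :: "(nat \<Rightarrow> 'b::linorder) \<Rightarrow> nat set \<Rightarrow> nat \<Rightarrow> bool" where
  "best_in f S x \<longleftrightarrow> x \<in> S \<and> (\<forall>y \<in> S. f x \<le> f y)"

text \<open>Merging with queries: \<open>b\<close> is the best element of the left list so far, where smaller values of \<open>f\<close>
  are better, and \<open>R\<close> maps each element to the best element known for it. Ties between keys go to the
  left list, which makes the sort stable and lets equal keys count as dominated.\<close>

fun merge_best :: "(nat \<Rightarrow> nat) \<Rightarrow> (nat \<Rightarrow> 'b::linorder) \<Rightarrow> nat list \<Rightarrow> nat list \<Rightarrow> nat \<Rightarrow>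
    (nat \<Rightarrow> nat) \<Rightarrow> nat list \<times> (nat \<Rightarrow> nat)" where
  "merge_best key f [] [] b R = ([], R)"
| "merge_best key f (l # ls) [] b R =
     apfst (Cons l) (merge_best key f ls [] (if f l < f b then l else b) R)"
| "merge_best key f [] (r # rs) b R =
     apfst (Cons r) (merge_best key f [] rs b (if f b < f (R r) then R(r := b) else R))"
| "merge_best key f (l # ls) (r # rs) b R =
     (if key l \<le> key r
      then apfst (Cons l) (merge_best key f ls (r # rs) (if f l < f b then l else b) R)
      else apfst (Cons r) (merge_best key f (l # ls) rs b (if f b < f (R r) then R(r := b) else R)))"

text \<open>The order in which a stable sort by \<open>key\<close> arranges a list that was arranged according to \<open>lt\<close>.\<close>

definition by_key :: "(nat \<Rightarrow> nat) \<Rightarrow> (nat \<Rightarrow> nat \<Rightarrow> bool) \<Rightarrow> nat \<Rightarrow> nat \<Rightarrow> bool" where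
  "by_key key lt x y \<longleftrightarrow> key x < key y \<or> key x = key y \<and> lt x y"

lemma set_merge_best [simp]:
  "set (fst (merge_best key f ls rs b R)) = set ls \<union> set rs"
  by (induction key f ls rs b R rule: merge_best.induct) auto

lemma length_merge_best [simp]:
  "length (fst (merge_best key f ls rs b R)) = length ls + length rs"
  by (induction key f ls rs b R rule: merge_best.induct) auto

lemma sorted_merge_best:
  assumes "sorted_wrt (by_key key lt) ls" "sorted_wrt (by_key key lt) rs"
    "\<And>x y. x \<in> set ls \<Longrightarrow> y \<in> set rs \<Longrightarrow> lt x y"
  shows "sorted_wrt (by_key key lt) (fst (merge_best key f ls rs b R))"
  using assms
  by (induction key f ls rs b R rule: merge_best.induct) (force simp: by_key_def)+

lemma merge_best_outside:
  "x \<notin> set rs \<Longrightarrow> snd (merge_best key f ls rs b R) x = R x"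
  by (induction key f ls rs b R rule: merge_best.induct) auto

lemma best_in_update:
  assumes "best_in f D b" "best_in f E (R r)"
  shows "best_in f (D \<union> E) ((if f b < f (R r) then R(r := b) else R) r)"
  using assms unfolding best_in_def by (cases "f b < f (R r)") (auto dest: order.strict_implies_order intro: order.trans)

text \<open>When an element of the right list is placed, the elements of the left list placed so far are
  those with a key at most as large, and \<open>b\<close> is the best of these.\<close>

lemma merge_best_best:
  assumes "sorted_wrt (\<lambda>x y. key x \<le> key y) ls" "sorted_wrt (\<lambda>x y. key x \<le> key y) rs"
    "distinct rs" "best_in f D b" "\<And>r. r \<in> set rs \<Longrightarrow> best_in f (E r) (R r)" "x \<in> set rs"
  shows "best_in f (D \<union> {l \<in> set ls. key l \<le> key x} \<union> E x) (snd (merge_best key f ls rs b R) x)"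
  using assms
proof (induction key f ls rs b R arbitrary: D rule: merge_best.induct)
    case (1 key f b R)
    then show ?case by simp
  next
    case (2 key f l ls b R)
    then show ?case by simp
  next
    case (3 key f r rs b R)
    let ?R = "if f b < f (R r) then R(r := b) else R"
    show ?case
    proof (cases "x = r")
      case True
      then have "snd (merge_best key f [] rs b ?R) x = ?R x"
        using 3 by (intro merge_best_outside) auto
      then show ?thesis
        using best_in_update[of f D b "E r" R r] "3.prems"(4) "3.prems"(5)[of r] True by simp
    next
      case False
      then have "best_in f (D \<union> {l \<in> set []. key l \<le> key x} \<union> E x) (snd (merge_best key f [] rs b ?R) x)"
        using 3 by (intro "3.IH") auto
      then show ?thesis by simp
    qed
  next
    case (4 key f l ls r rs b R)
    show ?case
    proof (cases "key l \<le> key r")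
      case True
      have "best_in f (insert l D) (if f l < f b then l else b)"
        using 4 by (auto simp: best_in_def)
      then have "best_in f (insert l D \<union> {l \<in> set ls. key l \<le> key x} \<union> E x)
          (snd (merge_best key f ls (r # rs) (if f l < f b then l else b) R) x)"
        using 4 by (intro "4.IH"(1)[OF True]) auto
      moreover have "key l \<le> key x"
        using 4 True by (auto intro: order.trans)
      then have "insert l D \<union> {y \<in> set ls. key y \<le> key x} \<union> E x = D \<union> {y \<in> set (l # ls). key y \<le> key x} \<union> E x"
        by auto
      ultimately show ?thesis
        using True by simp
    next
      case False
      let ?R = "if f b < f (R r) then R(r := b) else R"
      show ?thesis
      proof (cases "x = r")
        case True
        then have "snd (merge_best key f (l # ls) rs b ?R) x = ?R x"
          using 4 by (intro merge_best_outside) auto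
        then have "snd (merge_best key f (l # ls) (r # rs) b R) x = ?R r"
          using False True by simp
        moreover have "D \<union> {y \<in> set (l # ls). key y \<le> key x} \<union> E x = D \<union> E r"
          using 4(3) False True by (auto dest: order.trans)
        ultimately show ?thesis
          using best_in_update[of f D b "E r" R r] "4.prems"(4) "4.prems"(5)[of r]
          by (simp only: list.set_intros)
      next
        case xr: False
        then have "best_in f (D \<union> {y \<in> set (l # ls). key y \<le> key x} \<union> E x)
            (snd (merge_best key f (l # ls) rs b ?R) x)"
          using 4 by (intro "4.IH"(2)[OF False]) auto
        then show ?thesis
          using False by simp
      qed
    qed
qed

text \<open>A block that has been sorted: \<open>bs\<close> is \<open>os\<close> sorted by \<open>key\<close>, and \<open>R\<close> answers for each element the query
  that is restricted to this block. The dummy \<open>dm\<close> stands for the absence of an answer.\<close>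

definition block_ok where
  "block_ok key f lt dm R os bs \<longleftrightarrow> set bs = set os \<and> length bs = length os \<and>
     sorted_wrt (by_key key lt) bs \<and>
     (\<forall>x \<in> set os. best_in f (insert dm {y \<in> set os. lt y x \<and> key y \<le> key x}) (R x))"

lemma block_ok_cong:
  "block_ok key f lt dm R os bs \<Longrightarrow> (\<And>x. x \<in> set os \<Longrightarrow> R' x = R x) \<Longrightarrow> block_ok key f lt dm R' os bs"
  by (simp add: block_ok_def)

text \<open>For an element of the right block, the candidates are those of its own block, among which \<open>R\<close> has
  the best one, and the elements of the left block with keys at most as large, all of which come
  earlier.\<close>

lemma block_ok_merge:
  assumes 1: "block_ok key f lt dm R os bs" and 2: "block_ok key f lt dm R os' bs'"
    and lt: "sorted_wrt lt (os @ os')" and asym: "\<And>x y. lt x y \<Longrightarrow> \<not> lt y x"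
    and dist: "distinct (os @ os')"
  shows "block_ok key f lt dm (snd (merge_best key f bs bs' dm R)) (os @ os')
    (fst (merge_best key f bs bs' dm R))"
proof -
  let ?R = "snd (merge_best key f bs bs' dm R)"
  have lt': "lt x y" if "x \<in> set os" "y \<in> set os'" for x y
    using lt that by (auto simp: sorted_wrt_append)
  have sorted: "sorted_wrt (\<lambda>x y. key x \<le> key y) b" if "sorted_wrt (by_key key lt) b" for b
    using that by (rule sorted_wrt_mono_rel[rotated]) (auto simp: by_key_def)
  have dist': "distinct bs'"
    using 2 dist by (auto simp: block_ok_def card_distinct distinct_card)
  have "best_in f (insert dm {y \<in> set (os @ os'). lt y x \<and> key y \<le> key x}) (?R x)"
    if x: "x \<in> set (os @ os')" for x
  proof (cases "x \<in> set os'")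
    case True
    have D: "best_in f {dm} dm"
      by (simp add: best_in_def)
    have "best_in f ({dm} \<union> {l \<in> set bs. key l \<le> key x} \<union>
        insert dm {y \<in> set os'. lt y x \<and> key y \<le> key x}) (?R x)"
      by (rule merge_best_best[where E = "\<lambda>x. insert dm {y \<in> set os'. lt y x \<and> key y \<le> key x}"])
         (use 1 2 D dist' sorted True in \<open>auto simp: block_ok_def\<close>)
    also have "{dm} \<union> {l \<in> set bs. key l \<le> key x} \<union> insert dm {y \<in> set os'. lt y x \<and> key y \<le> key x}
      = insert dm {y \<in> set (os @ os'). lt y x \<and> key y \<le> key x}"
      using 1 lt' True by (auto simp: block_ok_def)
    finally show ?thesis .
  next
    case False
    then have "x \<in> set os" using x by simp
    moreover from this have "{y \<in> set (os @ os'). lt y x \<and> key y \<le> key x} = {y \<in> set os. lt y x \<and> key y \<le> key x}"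
      using lt' asym by auto
    moreover have "?R x = R x"
      using 2 False by (intro merge_best_outside) (auto simp: block_ok_def)
    ultimately show ?thesis
      using 1 by (simp add: block_ok_def)
  qed
  moreover have "sorted_wrt (by_key key lt) (fst (merge_best key f bs bs' dm R))"
    using 1 2 lt' by (intro sorted_merge_best) (auto simp: block_ok_def)
  ultimately show ?thesis
    using 1 2 by (auto simp: block_ok_def)
qed

text \<open>The list falls into consecutive blocks of length \<open>w\<close>, the last of which may be shorter.\<close>

inductive blocks_ok for key f lt dm w R where
  Nil: "blocks_ok key f lt dm w R [] []"
| Blocks: "length bs = length os \<Longrightarrow> block_ok key f lt dm R (take w os) (take w bs) \<Longrightarrow>
    blocks_ok key f lt dm w R (drop w os) (drop w bs) \<Longrightarrow> blocks_ok key f lt dm w R os bs"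

lemma blocks_okD:
  assumes "blocks_ok key f lt dm w R os bs"
  shows "length bs = length os" "block_ok key f lt dm R (take w os) (take w bs)"
    "blocks_ok key f lt dm w R (drop w os) (drop w bs)"
proof -
  show "length bs = length os"
    using assms by cases auto
  show "block_ok key f lt dm R (take w os) (take w bs)"
    using assms by cases (auto simp: block_ok_def)
  show "blocks_ok key f lt dm w R (drop w os) (drop w bs)"
    using assms by cases (auto intro: blocks_ok.Nil)
qed

lemma blocks_ok_cong:
  assumes "blocks_ok key f lt dm w R os bs" "\<And>x. x \<in> set os \<Longrightarrow> R' x = R x"
  shows "blocks_ok key f lt dm w R' os bs"
  using assms
proof (induction rule: blocks_ok.induct)
  case (Blocks bs os)
  show ?case
    by (rule blocks_ok.Blocks)
       (use Blocks in \<open>auto intro: block_ok_cong dest: in_set_takeD in_set_dropD\<close>)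
qed (rule blocks_ok.Nil)

lemma blocks_ok_init:
  assumes "\<And>x. x \<in> set os \<Longrightarrow> R x = dm" "\<And>x. \<not> lt x x"
  shows "blocks_ok key f lt dm 1 R os os"
  using assms
proof (induction os)
  case (Cons x os)
  have x: "block_ok key f lt dm R [x] [x]"
    using Cons.prems by (auto simp: block_ok_def best_in_def)
  show ?case
    by (rule blocks_ok.Blocks) (use Cons x in auto)
qed (rule blocks_ok.Nil)

lemma blocks_ok_single:
  assumes "blocks_ok key f lt dm w R os bs" "length os \<le> w"
  shows "block_ok key f lt dm R os bs"
  using blocks_okD(1,2)[OF assms(1)] assms(2) by simp

function merge_pass :: "(nat \<Rightarrow> nat) \<Rightarrow> (nat \<Rightarrow> 'b::linorder) \<Rightarrow> nat \<Rightarrow> nat \<Rightarrow> nat list \<Rightarrow> (nat \<Rightarrow> nat) \<Rightarrow>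
    nat list \<times> (nat \<Rightarrow> nat)" where
  "merge_pass key f dm w xs R = (if xs = [] \<or> w = 0 then ([], R) else
     let (m, R1) = merge_best key f (take w xs) (take w (drop w xs)) dm R;
         (ys, R2) = merge_pass key f dm w (drop w (drop w xs)) R1
     in (m @ ys, R2))"
  by pat_completeness auto
termination
  by (relation "measure (\<lambda>(key, f, dm, w, xs, R). length xs)") auto

declare merge_pass.simps [simp del]

lemma merge_pass_Nil [simp]: "merge_pass key f dm w [] R = ([], R)"
  by (simp add: merge_pass.simps)

text \<open>The answers for a block are changed by the merge of this block only, hence are not spoilt by the
  rest of the pass.\<close>

lemma merge_pass_blocks_ok:
  assumes w: "w > 0" and asym: "\<And>x y. lt x y \<Longrightarrow> \<not> lt y x"
    and ok: "blocks_ok key f lt dm w R os bs" and lt: "sorted_wrt lt os" and dist: "distinct os"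
  shows "blocks_ok key f lt dm (w + w) (snd (merge_pass key f dm w bs R)) os (fst (merge_pass key f dm w bs R)) \<and>
    (\<forall>x. x \<notin> set os \<longrightarrow> snd (merge_pass key f dm w bs R) x = R x)"
  using ok lt dist
proof (induction os arbitrary: bs R rule: length_induct)
  case (1 os)
  note ok = 1(2)
  show ?case
  proof (cases "os = []")
    case True
    then show ?thesis
      using blocks_okD(1)[OF ok] by (auto intro: blocks_ok.Nil)
  next
    case False
    then have ne: "bs \<noteq> []"
      using blocks_okD(1)[OF ok] by auto
    define o1 o2 o3 where o: "o1 = take w os" "o2 = take w (drop w os)" "o3 = drop w (drop w os)"
    define b1 b2 b3 where b: "b1 = take w bs" "b2 = take w (drop w bs)" "b3 = drop w (drop w bs)"
    have os: "os = (o1 @ o2) @ o3"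
      unfolding o by (simp only: append_assoc append_take_drop_id)
    have ok1: "block_ok key f lt dm R o1 b1" and ok2: "block_ok key f lt dm R o2 b2"
      and ok3: "blocks_ok key f lt dm w R o3 b3"
      using blocks_okD[OF ok] blocks_okD[OF blocks_okD(3)[OF ok]] by (auto simp: o b)
    have lt: "sorted_wrt lt (o1 @ o2)" "sorted_wrt lt o3"
      and dist: "distinct (o1 @ o2)" "distinct o3" "set (o1 @ o2) \<inter> set o3 = {}"
      using 1(3,4) unfolding os sorted_wrt_append distinct_append by auto
    obtain m R1 where m: "merge_best key f b1 b2 dm R = (m, R1)" by fastforce
    obtain ys R2 where ys: "merge_pass key f dm w b3 R1 = (ys, R2)" by fastforce
    have step: "merge_pass key f dm w bs R = (m @ ys, R2)"
      using ne w m ys by (subst merge_pass.simps) (simp add: b)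
    have mok: "block_ok key f lt dm R1 (o1 @ o2) m"
      using block_ok_merge[OF ok1 ok2 lt(1) asym dist(1)] m by auto
    have R1: "R1 x = R x" if "x \<notin> set o2" for x
      using merge_best_outside[of x b2 key f b1 dm R] that ok2 m by (simp add: block_ok_def)
    have "blocks_ok key f lt dm w R1 o3 b3"
      using blocks_ok_cong[OF ok3] R1 dist(3) by auto
    moreover have "length o3 < length os"
      using w False by (simp add: o)
    ultimately have IH: "blocks_ok key f lt dm (w + w) R2 o3 ys" "\<And>x. x \<notin> set o3 \<Longrightarrow> R2 x = R1 x"
      using 1(1) lt(2) dist(2) ys by (metis fst_conv snd_conv)+
    have mok2: "block_ok key f lt dm R2 (o1 @ o2) m"
      using block_ok_cong[OF mok] IH(2) dist(3) by auto
    have lm: "length m = length (o1 @ o2)"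
      using mok by (simp add: block_ok_def)
    have ly: "length ys = length o3"
      using blocks_okD(1)[OF IH(1)] .
    have split: "take (w + w) os = o1 @ o2" "drop (w + w) os = o3"
      by (auto simp: o take_add)
    have split': "take (w + w) (m @ ys) = m" "drop (w + w) (m @ ys) = ys"
    proof -
      have "length m = w + w \<or> length m \<le> w + w \<and> ys = []"
        using lm ly by (auto simp: o)
      then show "take (w + w) (m @ ys) = m" "drop (w + w) (m @ ys) = ys"
        by auto
    qed
    have "length (m @ ys) = length os"
      using lm ly by (simp add: os)
    then have "blocks_ok key f lt dm (w + w) R2 os (m @ ys)"
      by (rule blocks_ok.Blocks) (simp_all only: split split' mok2 IH(1))
    moreover have "R2 x = R x" if "x \<notin> set os" for x
      using that IH(2) R1 by (auto simp: os)
    ultimately show ?thesis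
      by (simp add: step)
  qed
qed


section \<open>Sorting on the machine\<close>

text \<open>Names for working memory: those that begin with \<open>r\<close> are registers, those that begin with \<open>a\<close> are
  arrays. The numbers up to 3 are taken by the input and the output.\<close>

abbreviation (input) "rN \<equiv> 4 :: nat"
abbreviation (input) "rW \<equiv> 5 :: nat"
abbreviation (input) "rK \<equiv> 6 :: nat"
abbreviation (input) "rI \<equiv> 7 :: nat"
abbreviation (input) "rMid \<equiv> 8 :: nat"
abbreviation (input) "rJ \<equiv> 9 :: nat"
abbreviation (input) "rHi \<equiv> 10 :: nat"
abbreviation (input) "rBest \<equiv> 11 :: nat"
abbreviation (input) "rX \<equiv> 12 :: nat"
abbreviation (input) "aV \<equiv> 6 :: nat"
abbreviation (input) "aA \<equiv> 7 :: nat"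
abbreviation (input) "aB \<equiv> 8 :: nat"

definition seg :: "(nat \<Rightarrow> nat) \<Rightarrow> nat \<Rightarrow> nat \<Rightarrow> nat list" where
  "seg g a b = map g [a..<b]"

lemma seg_empty [simp]: "b \<le> a \<Longrightarrow> seg g a b = []"
  by (simp add: seg_def)

lemma length_seg [simp]: "length (seg g a b) = b - a"
  by (simp add: seg_def)

lemma seg_eq_Nil [simp]: "seg g a b = [] \<longleftrightarrow> b \<le> a"
  by (auto simp: seg_def)

lemma seg_Cons: "a < b \<Longrightarrow> seg g a b = g a # seg g (Suc a) b"
  by (simp add: seg_def upt_conv_Cons)

lemma seg_snoc: "a \<le> b \<Longrightarrow> seg g a (Suc b) = seg g a b @ [g b]"
  by (simp add: seg_def)

lemma take_seg: "take w (seg g a b) = seg g a (min (a + w) b)"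
  by (cases "a + w \<le> b") (auto simp: seg_def take_map min_def)

lemma drop_seg: "drop w (seg g a b) = seg g (a + w) b"
  by (simp add: seg_def drop_map)

lemma seg_cong: "(\<And>i. a \<le> i \<Longrightarrow> i < b \<Longrightarrow> g i = h i) \<Longrightarrow> seg g a b = seg h a b"
  by (simp add: seg_def)

text \<open>Subtraction is truncated, which yields minimum and maximum without branching.\<close>

definition minE :: "exp \<Rightarrow> exp \<Rightarrow> exp" where
  "minE e e' = Sub e (Sub e e')"

definition maxE :: "exp \<Rightarrow> exp \<Rightarrow> exp" where
  "maxE e e' = Add e (Sub e' e)"

lemma exp_val_minE [simp]: "exp_val (minE e e') s = min (exp_val e s) (exp_val e' s)"
  by (simp add: minE_def)

lemma exp_val_maxE [simp]: "exp_val (maxE e e') s = max (exp_val e s) (exp_val e' s)"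
  by (simp add: maxE_def)

text \<open>Better means a smaller value, with ties broken by the key. Without the second criterion a query
  would find some minimum at the right level, but not the one that tells whether two directions
  belong to the same component.\<close>

definition better :: "nat \<Rightarrow> exp \<Rightarrow> exp \<Rightarrow> test" where
  "better \<kappa> e e' = Neg (Conj (Neg (Less (Read aV e) (Read aV e')))
     (Neg (Conj (Neg (Less (Read aV e') (Read aV e))) (Less (Read \<kappa> e) (Read \<kappa> e')))))"

definition item_value :: "nat \<Rightarrow> state \<Rightarrow> nat \<Rightarrow> nat \<times> nat" where
  "item_value \<kappa> s x = (arr s aV x, arr s \<kappa> x)"

lemma test_val_better [simp]:
  "test_val (better \<kappa> e e') s \<longleftrightarrow> item_value \<kappa> s (exp_val e s) < item_value \<kappa> s (exp_val e' s)"
  by (auto simp: better_def item_value_def)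

text \<open>One iteration of a pass places one element and, if the current two blocks are exhausted, starts
  with the next two. So a pass is a single loop whose iterations take constant time.\<close>

definition next_block :: com where
  "next_block = Cond (Less (Reg rK) (Reg rHi)) Skip
     (seqs [SetReg rI (Reg rK), SetReg rMid (minE (Add (Reg rK) (Reg rW)) (Reg rN)),
       SetReg rJ (Reg rMid), SetReg rHi (minE (Add (Reg rMid) (Reg rW)) (Reg rN)),
       SetReg rBest (Reg rN)])"

definition place_next :: "nat \<Rightarrow> nat \<Rightarrow> com" where
  "place_next \<kappa> \<rho> = Cond (Conj (Less (Reg rI) (Reg rMid)) (Neg (Conj (Less (Reg rJ) (Reg rHi))
        (Less (Read \<kappa> (Read aA (Reg rJ))) (Read \<kappa> (Read aA (Reg rI)))))))
     (seqs [SetReg rX (Read aA (Reg rI)), Write aB (Reg rK) (Reg rX),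
        Cond (better \<kappa> (Reg rX) (Reg rBest)) (SetReg rBest (Reg rX)) Skip,
        SetReg rI (Add (Reg rI) (Lit 1))])
     (seqs [SetReg rX (Read aA (Reg rJ)), Write aB (Reg rK) (Reg rX),
        Cond (better \<kappa> (Reg rBest) (Read \<rho> (Reg rX))) (Write \<rho> (Reg rX) (Reg rBest)) Skip,
        SetReg rJ (Add (Reg rJ) (Lit 1))])"

definition pass :: "nat \<Rightarrow> nat \<Rightarrow> com" where
  "pass \<kappa> \<rho> = Seq (seqs [SetReg rI (Lit 0), SetReg rMid (Lit 0), SetReg rJ (Lit 0), SetReg rHi (Lit 0)])
     (Seq (For rK (Reg rN) (Seq next_block (place_next \<kappa> \<rho>)))
       (For rK (Reg rN) (Write aA (Reg rK) (Read aB (Reg rK)))))"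

definition msort :: "nat \<Rightarrow> nat \<Rightarrow> com" where
  "msort \<kappa> \<rho> = Seq (For rK (Reg rN) (Write \<rho> (Reg rK) (Reg rN)))
     (Seq (SetReg rW (Lit 1))
       (Loop (Less (Reg rW) (Reg rN)) (Seq (pass \<kappa> \<rho>) (SetReg rW (Add (Reg rW) (Reg rW))))))"

text \<open>What remains to be done in a pass: merge the rest of the current two blocks, then continue.\<close>

definition pending where
  "pending key f dm w ls rs b R rest =
     (let (m, R1) = merge_best key f ls rs b R; (ys, R2) = merge_pass key f dm w rest R1
      in (m @ ys, R2))"

lemma pending_Nil [simp]: "pending key f dm w [] [] b R rest = merge_pass key f dm w rest R"
  by (simp add: pending_def split: prod.splits)

lemma pending_start:
  assumes "xs \<noteq> []" "w > 0"
  shows "merge_pass key f dm w xs R =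
    pending key f dm w (take w xs) (take w (drop w xs)) dm R (drop w (drop w xs))"
  using assms by (subst merge_pass.simps) (simp add: pending_def)

lemma pending_left:
  assumes "rs = [] \<or> key l \<le> key (hd rs)"
  shows "pending key f dm w (l # ls) rs b R rest =
    apfst (Cons l) (pending key f dm w ls rs (if f l < f b then l else b) R rest)"
  using assms by (cases rs) (auto simp: pending_def split: prod.splits)

lemma pending_right:
  assumes "ls = [] \<or> key r < key (hd ls)"
  shows "pending key f dm w ls (r # rs) b R rest =
    apfst (Cons r) (pending key f dm w ls rs b (if f b < f (R r) then R(r := b) else R) rest)"
  using assms by (cases ls) (auto simp: pending_def split: prod.splits)

text \<open>The elements placed so far, followed by the outcome of the pending work, are the outcome of the
  whole pass. As the number of placed elements is known, the end of a block is recognised by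
  comparing \<open>k\<close> with \<open>hi\<close>.\<close>

definition pass_inv where
  "pass_inv key f N w A goal k i mid j hi b B R \<longleftrightarrow>
     i \<le> mid \<and> mid \<le> j \<and> j \<le> hi \<and> hi \<le> N \<and> hi = k + (mid - i) + (hi - j) \<and>
     apfst ((@) (seg B 0 k)) (pending key f N w (seg A i mid) (seg A j hi) b R (seg A hi N)) = goal"

lemma pass_inv_init:
  "pass_inv key f N w A (merge_pass key f N w (seg A 0 N) R) 0 0 0 0 0 b B R"
  by (simp add: pass_inv_def seg_def apfst_def map_prod_def split: prod.splits)

lemma pass_inv_next_block:
  assumes "pass_inv key f N w A goal k i mid j hi b B R" "k < N" "\<not> k < hi" "w > 0"
  shows "pass_inv key f N w A goal k k (min (k + w) N) (min (k + w) N)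
    (min (min (k + w) N + w) N) N B R"
    "k < min (min (k + w) N + w) N"
proof -
  have "k = hi" "mid \<le> i" "hi \<le> j"
    using assms by (auto simp: pass_inv_def)
  then have "apfst ((@) (seg B 0 k)) (merge_pass key f N w (seg A k N) R) = goal"
    using assms(1) by (simp add: pass_inv_def)
  moreover have "merge_pass key f N w (seg A k N) R =
    pending key f N w (seg A k (min (k + w) N)) (seg A (min (k + w) N) (min (min (k + w) N + w) N)) N R
      (seg A (min (min (k + w) N + w) N) N)"
  proof -
    have eqs: "seg A (k + w) (min (k + w + w) N) = seg A (min (k + w) N) (min (min (k + w) N + w) N)"
       "seg A (k + w + w) N = seg A (min (min (k + w) N + w) N) N"
      by (cases "k + w \<le> N"; cases "k + w + w \<le> N"; simp)+
    show ?thesis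
      using pending_start[of "seg A k N" w key f N R] assms(2,4)
      by (simp add: take_seg drop_seg eqs)
  qed
  ultimately show "pass_inv key f N w A goal k k (min (k + w) N) (min (k + w) N)
    (min (min (k + w) N + w) N) N B R"
    using assms(2) by (auto simp: pass_inv_def)
  show "k < min (min (k + w) N + w) N"
    using assms(2,4) by auto
qed

lemma pass_inv_left:
  assumes "pass_inv key f N w A goal k i mid j hi b B R"
    "i < mid" "j < hi \<Longrightarrow> key (A i) \<le> key (A j)"
  shows "pass_inv key f N w A goal (Suc k) (Suc i) mid j hi (if f (A i) < f b then A i else b)
    (B(k := A i)) R"
proof -
  have "seg (B(k := A i)) 0 (Suc k) = seg B 0 k @ [A i]"
    by (auto simp: seg_snoc intro: seg_cong)
  moreover have "pending key f N w (A i # seg A (Suc i) mid) (seg A j hi) b R (seg A hi N) =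
      apfst (Cons (A i)) (pending key f N w (seg A (Suc i) mid) (seg A j hi) (if f (A i) < f b then A i else b) R (seg A hi N))"
    using assms(3) by (intro pending_left) (cases "j < hi"; simp add: seg_Cons)
  ultimately show ?thesis
    using assms(1,2) by (auto simp: pass_inv_def seg_Cons[of i mid] apfst_def map_prod_def split: prod.splits)
qed

lemma pass_inv_right:
  assumes "pass_inv key f N w A goal k i mid j hi b B R"
    "j < hi" "i < mid \<Longrightarrow> key (A j) < key (A i)"
  shows "pass_inv key f N w A goal (Suc k) i mid (Suc j) hi b
    (B(k := A j)) (if f b < f (R (A j)) then R(A j := b) else R)"
proof -
  have "seg (B(k := A j)) 0 (Suc k) = seg B 0 k @ [A j]"
    by (auto simp: seg_snoc intro: seg_cong)
  moreover have "pending key f N w (seg A i mid) (A j # seg A (Suc j) hi) b R (seg A hi N) =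
      apfst (Cons (A j)) (pending key f N w (seg A i mid) (seg A (Suc j) hi) b (if f b < f (R (A j)) then R(A j := b) else R) (seg A hi N))"
    using assms(3) by (intro pending_right) (cases "i < mid"; simp add: seg_Cons)
  ultimately show ?thesis
    using assms(1,2) by (auto simp: pass_inv_def seg_Cons[of j hi] apfst_def map_prod_def split: prod.splits)
qed

definition pass_state :: "nat \<Rightarrow> nat \<Rightarrow> state \<Rightarrow> _ \<Rightarrow> nat \<Rightarrow> state \<Rightarrow> bool" where
  "pass_state \<kappa> \<rho> s0 goal k s \<longleftrightarrow>
     arr s \<kappa> = arr s0 \<kappa> \<and> arr s aV = arr s0 aV \<and> arr s aA = arr s0 aA \<and>
     reg s rN = reg s0 rN \<and> reg s rW = reg s0 rW \<and>
     pass_inv (arr s0 \<kappa>) (item_value \<kappa> s0) (reg s0 rN) (reg s0 rW) (arr s0 aA) goal k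
       (reg s rI) (reg s rMid) (reg s rJ) (reg s rHi) (reg s rBest) (arr s aB) (arr s \<rho>)"

lemma pass_body_state:
  assumes inv: "pass_state \<kappa> \<rho> s0 goal k s" and k: "reg s rK = k" "k < reg s0 rN" and w: "reg s0 rW > 0"
    and ne: "\<kappa> \<notin> {aA, aB, \<rho>}" "\<rho> \<notin> {aV, aA, aB}"
  shows "pass_state \<kappa> \<rho> s0 goal (Suc k)
    (set_reg rK (Suc k) (effect (Seq next_block (place_next \<kappa> \<rho>)) s))"
proof -
  define s1 where "s1 = effect next_block s"
  have 1: "pass_state \<kappa> \<rho> s0 goal k s1 \<and> reg s1 rK = k \<and> k < reg s1 rHi"
  proof (cases "k < reg s rHi")
    case True
    then show ?thesis using inv k by (simp add: s1_def next_block_def)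
  next
    case False
    then show ?thesis
      using inv k w pass_inv_next_block[of "arr s0 \<kappa>" "item_value \<kappa> s0" "reg s0 rN" "reg s0 rW" "arr s0 aA" goal k
          "reg s rI" "reg s rMid" "reg s rJ" "reg s rHi" "reg s rBest" "arr s aB" "arr s \<rho>"]
      by (simp add: s1_def next_block_def pass_state_def)
  qed
  have iv: "item_value \<kappa> s1 = item_value \<kappa> s0"
    using 1 by (auto simp: item_value_def pass_state_def)
  have iv': "item_value \<kappa> (set_cell aB i v (set_reg x u s1)) = item_value \<kappa> s0" for i v x u
    using 1 ne by (auto simp: item_value_def pass_state_def)
  let ?left = "reg s1 rI < reg s1 rMid \<and> \<not> (reg s1 rJ < reg s1 rHi \<and>
    arr s1 \<kappa> (arr s1 aA (reg s1 rJ)) < arr s1 \<kappa> (arr s1 aA (reg s1 rI)))"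
  show ?thesis
  proof (cases ?left)
    case True
    then have "reg s1 rJ < reg s1 rHi \<Longrightarrow> arr s0 \<kappa> (arr s0 aA (reg s1 rI)) \<le> arr s0 \<kappa> (arr s0 aA (reg s1 rJ))"
      using 1 by (auto simp: pass_state_def)
    with True show ?thesis
      using 1 ne pass_inv_left[of "arr s0 \<kappa>" "item_value \<kappa> s0" "reg s0 rN" "reg s0 rW" "arr s0 aA" goal k
          "reg s1 rI" "reg s1 rMid" "reg s1 rJ" "reg s1 rHi" "reg s1 rBest" "arr s1 aB" "arr s1 \<rho>"]
      by (simp add: s1_def[symmetric] place_next_def pass_state_def iv' split: if_splits)
  next
    case False
    then have "reg s1 rJ < reg s1 rHi" "reg s1 rI < reg s1 rMid \<Longrightarrow>
      arr s1 \<kappa> (arr s1 aA (reg s1 rJ)) < arr s1 \<kappa> (arr s1 aA (reg s1 rI))"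
      using 1 by (auto simp: pass_state_def pass_inv_def)
    with False show ?thesis
      using 1 ne pass_inv_right[of "arr s0 \<kappa>" "item_value \<kappa> s0" "reg s0 rN" "reg s0 rW" "arr s0 aA" goal k
          "reg s1 rI" "reg s1 rMid" "reg s1 rJ" "reg s1 rHi" "reg s1 rBest" "arr s1 aB" "arr s1 \<rho>"]
      by (simp add: s1_def[symmetric] place_next_def pass_state_def iv' split: if_splits; blast)
  qed
qed

lemma regs_of_msort [simp]:
  "regs_of next_block = {rI, rMid, rJ, rHi, rBest}"
  "regs_of (place_next \<kappa> \<rho>) = {rX, rBest, rI, rJ}"
  "regs_of (pass \<kappa> \<rho>) = {rI, rMid, rJ, rHi, rBest, rX, rK}"
  "regs_of (msort \<kappa> \<rho>) = {rI, rMid, rJ, rHi, rBest, rX, rK, rW}"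
  by (auto simp: next_block_def place_next_def pass_def msort_def)

lemma arrs_of_msort [simp]:
  "arrs_of next_block = {}"
  "arrs_of (place_next \<kappa> \<rho>) = {aB, \<rho>}"
  "arrs_of (pass \<kappa> \<rho>) = {aA, aB, \<rho>}"
  "arrs_of (msort \<kappa> \<rho>) = {aA, aB, \<rho>}"
  by (auto simp: next_block_def place_next_def pass_def msort_def)

lemma loop_free_msort [simp]: "loop_free next_block" "loop_free (place_next \<kappa> \<rho>)"
  by (auto simp: next_block_def place_next_def)

definition pass_const :: "nat \<Rightarrow> nat \<Rightarrow> nat" where
  "pass_const \<kappa> \<rho> = max_cost (next_block) + max_cost (place_next \<kappa> \<rho>) + 100"

lemma runs_pass:
  assumes w: "reg s rW > 0" and ne: "\<kappa> \<notin> {aA, aB, \<rho>}" "\<rho> \<notin> {aV, aA, aB}"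
  shows "runs (pass \<kappa> \<rho>) s ((reg s rN + 1) * (2 * pass_const \<kappa> \<rho>))
    (\<lambda>s'. (seg (arr s' aA) 0 (reg s rN), arr s' \<rho>) =
       merge_pass (arr s \<kappa>) (item_value \<kappa> s) (reg s rN) (reg s rW) (seg (arr s aA) 0 (reg s rN)) (arr s \<rho>))"
    (is "runs _ _ _ ?Q")
proof -
  let ?N = "reg s rN"
  define goal where "goal = merge_pass (arr s \<kappa>) (item_value \<kappa> s) ?N (reg s rW) (seg (arr s aA) 0 ?N) (arr s \<rho>)"
  let ?init = "seqs [SetReg rI (Lit 0), SetReg rMid (Lit 0), SetReg rJ (Lit 0), SetReg rHi (Lit 0)]"
  let ?body = "Seq next_block (place_next \<kappa> \<rho>)"
  have init: "runs ?init s 9 (\<lambda>s'. pass_state \<kappa> \<rho> s goal 0 s')"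
    using runs_effect[of ?init "\<lambda>s'. pass_state \<kappa> \<rho> s goal 0 s'" s]
    by (simp add: pass_state_def goal_def pass_inv_init numeral_eq_Suc)
  have loop: "runs (For rK (Reg rN) ?body) s' ((?N + 1) * (max_cost ?body + exp_cost (Reg rN) + 7))
      (\<lambda>s'. seg (arr s' aB) 0 ?N = fst goal \<and> arr s' \<rho> = snd goal \<and> reg s' rN = ?N)"
    if s': "pass_state \<kappa> \<rho> s goal 0 s'" for s'
  proof (rule runs_For[where I = "pass_state \<kappa> \<rho> s goal"])
    show "pass_state \<kappa> \<rho> s goal 0 s1" if "s1 = set_reg rK 0 s'" for s1
      using s' that by (simp add: pass_state_def)
    show "exp_val (Reg rN) s1 = ?N"
      if "frame (insert rK (regs_of ?body)) (arrs_of ?body) s' s1" for s1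
      using frame_reg[OF that, of rN] s' by (simp add: pass_state_def)
    show "runs ?body s1 (max_cost ?body) (\<lambda>s2. pass_state \<kappa> \<rho> s goal (Suc k) (set_reg rK (Suc k) s2))"
      if "k < ?N" "pass_state \<kappa> \<rho> s goal k s1" "reg s1 rK = k" for k s1
      using pass_body_state[OF that(2,3,1) w ne] by (intro runs_effect) auto
    show "seg (arr s1 aB) 0 ?N = fst goal \<and> arr s1 \<rho> = snd goal \<and> reg s1 rN = ?N"
      if "pass_state \<kappa> \<rho> s goal ?N s1" for s1
      using that by (auto simp: pass_state_def pass_inv_def seg_def apfst_def map_prod_def split: prod.splits)
  qed simp
  have copy: "runs (For rK (Reg rN) (Write aA (Reg rK) (Read aB (Reg rK)))) s'
      ((?N + 1) * (max_cost (Write aA (Reg rK) (Read aB (Reg rK))) + exp_cost (Reg rN) + 7)) ?Q"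
    if s': "seg (arr s' aB) 0 ?N = fst goal" "arr s' \<rho> = snd goal" "reg s' rN = ?N" for s'
  proof (rule runs_For[where I = "\<lambda>k s1. seg (arr s1 aA) 0 k = seg (arr s' aB) 0 k"], goal_cases)
    case (2 k s1)
    have "arr s1 aB = arr s' aB"
      using frame_arr[OF 2(4)] by simp
    moreover have "seg ((arr s1 aA)(k := v)) 0 k = seg (arr s1 aA) 0 k" for v
      by (rule seg_cong) auto
    ultimately show ?case
      using 2 by (intro runs_effect) (auto simp: seg_snoc)
  next
    case (4 s1)
    then show ?case
      using frame_reg[OF 4] s' by simp
  next
    case (5 s1)
    then show ?case
      using frame_arr[OF 5(2), of \<rho>] s' ne by (simp add: goal_def)
  qed auto
  have "runs (pass \<kappa> \<rho>) s (9 + ((?N + 1) * (max_cost ?body + exp_cost (Reg rN) + 7) +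
      (?N + 1) * (max_cost (Write aA (Reg rK) (Read aB (Reg rK))) + exp_cost (Reg rN) + 7))) ?Q"
    unfolding pass_def by (intro runs_Seq[OF init] runs_Seq[OF loop] copy) auto
  then show ?thesis
    by (rule runs_mono) (auto simp: pass_const_def algebra_simps)
qed

definition sorted_state where
  "sorted_state \<kappa> \<rho> lt N os s \<longleftrightarrow>
     block_ok (arr s \<kappa>) (item_value \<kappa> s) lt N (arr s \<rho>) os (seg (arr s aA) 0 N)"

text \<open>The width of the blocks doubles with each pass and stays below \<open>N\<close> before a pass, so there are at
  most \<open>L\<close> passes if \<open>N \<le> 2 ^ L\<close>.\<close>

lemma runs_msort:
  assumes N: "reg s rN \<le> 2 ^ L" and ne: "\<kappa> \<notin> {aA, aB, \<rho>}" "\<rho> \<notin> {aV, aA, aB}"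
    and os: "os = seg (arr s aA) 0 (reg s rN)"
    and lt: "sorted_wrt lt os" and asym: "\<And>x y. lt x y \<Longrightarrow> \<not> lt y x" and dist: "distinct os"
    and set: "set os \<subseteq> {..<reg s rN}"
  shows "runs (msort \<kappa> \<rho>) s ((L + 2) * ((reg s rN + 1) * (3 * pass_const \<kappa> \<rho>)))
    (sorted_state \<kappa> \<rho> lt (reg s rN) os)"
proof -
  let ?N = "reg s rN" and ?key = "arr s \<kappa>" and ?f = "item_value \<kappa> s"
  define good where "good s' \<longleftrightarrow> reg s' rN = ?N \<and> arr s' \<kappa> = arr s \<kappa> \<and> arr s' aV = arr s aV" for s' :: state
  have irr: "\<not> lt x x" for x
    using asym by blast
  have iv: "item_value \<kappa> s' = ?f" if "good s'" for s'
    using that by (auto simp: good_def item_value_def)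
  let ?init = "For rK (Reg rN) (Write \<rho> (Reg rK) (Reg rN))"
  have init: "runs ?init s ((?N + 1) * (3 + exp_cost (Reg rN) + 7))
    (\<lambda>s'. good s' \<and> arr s' aA = arr s aA \<and> (\<forall>x < ?N. arr s' \<rho> x = ?N))"
  proof (rule runs_For[where I = "\<lambda>k s'. \<forall>x<k. arr s' \<rho> x = ?N" and N = ?N], goal_cases)
    case (2 k s')
    then have "reg s' rN = ?N"
      using frame_reg[OF 2(4)] by simp
    then show ?case
      using 2 runs_effect[of "Write \<rho> (Reg rK) (Reg rN)"] by (auto simp: less_Suc_eq numeral_eq_Suc)
  next
    case (4 s')
    then show ?case using frame_reg[OF 4] by simp
  next
    case (5 s')
    then show ?case
      using frame_reg[OF 5(2)] frame_arr[OF 5(2)] ne by (simp add: good_def)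
  qed auto
  let ?start = "SetReg rW (Lit 1)"
  \<comment> \<open>After \<open>p\<close> passes the blocks have width \<open>2 ^ p\<close>.\<close>
  define J where "J = (\<lambda>n s'. \<exists>p. p + n = L \<and> good s' \<and> reg s' rW = 2 ^ p \<and>
    blocks_ok ?key ?f lt ?N (2 ^ p) (arr s' \<rho>) os (seg (arr s' aA) 0 ?N))"
  have start: "runs ?start s' 2 (J L)"
    if s': "good s' \<and> arr s' aA = arr s aA \<and> (\<forall>x < ?N. arr s' \<rho> x = ?N)" for s'
  proof -
    have "blocks_ok ?key ?f lt ?N 1 (arr s' \<rho>) os os"
      using s' set irr by (intro blocks_ok_init) auto
    then have "J L (set_reg rW 1 s')"
      unfolding J_def using s' os by (intro exI[of _ 0]) (auto simp: good_def)
    then show ?thesis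
      using runs_effect[of ?start "J L" s'] by (simp add: numeral_eq_Suc)
  qed
  let ?b = "Less (Reg rW) (Reg rN)"
  let ?c = "Seq (pass \<kappa> \<rho>) (SetReg rW (Add (Reg rW) (Reg rW)))"
  let ?B = "(?N + 1) * (2 * pass_const \<kappa> \<rho>) + 4"
  have loop: "runs (Loop ?b ?c) s' (L * (?B + test_cost ?b + 1) + test_cost ?b + 1)
    (sorted_state \<kappa> \<rho> lt ?N os)" if "J L s'" for s'
  proof (rule runs_Loop[where I = J])
    show "J L s'" by fact
  next
    fix n s1 assume J: "J n s1" "test_val ?b s1"
    then obtain p where p: "p + n = L" "good s1" "reg s1 rW = 2 ^ p"
      "blocks_ok ?key ?f lt ?N (2 ^ p) (arr s1 \<rho>) os (seg (arr s1 aA) 0 ?N)"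
      by (auto simp: J_def)
    have "2 ^ p < ?N"
      using J(2) p(2,3) by (simp add: good_def)
    also note N
    finally have "p < L"
      by (rule power_less_imp_less_exp[rotated]) simp
    then have "n > 0"
      using p(1) by simp
    have g: "reg s1 rN = ?N" "arr s1 \<kappa> = ?key" "item_value \<kappa> s1 = ?f"
      using p(2) iv[OF p(2)] by (auto simp: good_def)
    have "runs ?c s1 ?B (J (n - 1))"
    proof (rule runs_Seq[OF runs_pass[OF _ ne, of s1, unfolded g p(3)]])
      fix s2 assume s2: "(seg (arr s2 aA) 0 ?N, arr s2 \<rho>) =
          merge_pass ?key ?f ?N (2 ^ p) (seg (arr s1 aA) 0 ?N) (arr s1 \<rho>)"
        and fr: "frame (regs_of (pass \<kappa> \<rho>)) (arrs_of (pass \<kappa> \<rho>)) s1 s2"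
      have "blocks_ok ?key ?f lt ?N (2 ^ p + 2 ^ p) (arr s2 \<rho>) os (seg (arr s2 aA) 0 ?N)"
        using merge_pass_blocks_ok[OF _ asym p(4) lt dist] unfolding s2[symmetric] by simp
      moreover have "good s2" "reg s2 rW = 2 ^ p"
        using p(2,3) frame_reg[OF fr] frame_arr[OF fr] ne by (auto simp: good_def)
      ultimately have "J (n - 1) (set_reg rW (2 ^ p + 2 ^ p) s2)"
        unfolding J_def using p(1) \<open>n > 0\<close>
        by (intro exI[of _ "Suc p"]) (auto simp: good_def mult_2)
      then show "runs (SetReg rW (Add (Reg rW) (Reg rW))) s2 4 (J (n - 1))"
        using runs_effect[of "SetReg rW (Add (Reg rW) (Reg rW))" "J (n - 1)" s2] \<open>reg s2 rW = 2 ^ p\<close>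
        by (simp add: numeral_eq_Suc)
    qed simp
    then show "n > 0 \<and> runs ?c s1 ?B (J (n - 1))"
      using \<open>n > 0\<close> by simp
  next
    fix n s1 assume J: "J n s1" "\<not> test_val ?b s1"
    then obtain p where p: "p + n = L" "good s1" "reg s1 rW = 2 ^ p"
      "blocks_ok ?key ?f lt ?N (2 ^ p) (arr s1 \<rho>) os (seg (arr s1 aA) 0 ?N)"
      by (auto simp: J_def)
    then have "block_ok ?key ?f lt ?N (arr s1 \<rho>) os (seg (arr s1 aA) 0 ?N)"
      using J(2) by (intro blocks_ok_single) (auto simp: good_def os)
    then show "sorted_state \<kappa> \<rho> lt ?N os s1"
      using p(2) iv[OF p(2)] by (simp add: sorted_state_def good_def)
  qed
  have "runs (msort \<kappa> \<rho>) s ((?N + 1) * (3 + exp_cost (Reg rN) + 7) +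
      (2 + (L * (?B + test_cost ?b + 1) + test_cost ?b + 1))) (sorted_state \<kappa> \<rho> lt ?N os)"
    unfolding msort_def by (rule runs_Seq[OF init], rule runs_Seq[OF start], assumption, rule loop)
  then show ?thesis
  proof (rule runs_mono)
    have "?B + test_cost ?b + 1 \<le> (?N + 1) * (3 * pass_const \<kappa> \<rho>)"
      by (auto simp: pass_const_def algebra_simps)
    then have "L * (?B + test_cost ?b + 1) \<le> L * ((?N + 1) * (3 * pass_const \<kappa> \<rho>))"
      by (rule mult_le_mono2)
    then show "(?N + 1) * (3 + exp_cost (Reg rN) + 7) + (2 + (L * (?B + test_cost ?b + 1) + test_cost ?b + 1))
      \<le> (L + 2) * ((?N + 1) * (3 * pass_const \<kappa> \<rho>))"
      by (auto simp: pass_const_def algebra_simps)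
  qed
qed


section \<open>Writing the output\<close>

abbreviation (input) "aQ \<equiv> 10 :: nat"

definition rels :: "(point \<times> point list) list \<Rightarrow> (point \<times> point) list" where
  "rels ol = concat (map (\<lambda>(q, rl). map (\<lambda>r. (r, q)) rl) ol)"

lemma rels_snoc [simp]:
  "rels (ol @ [(q, [])]) = rels ol"
  "rels (ol @ [(q, rl @ [r])]) = rels (ol @ [(q, rl)]) @ [(r, q)]"
  by (auto simp: rels_def)

text \<open>The output for a list of elements with the minima related to them. It is extended first by an
  element without relations, and then by one relation at a time.\<close>

definition has_output :: "nat \<Rightarrow> (point \<times> point list) list \<Rightarrow> state \<Rightarrow> bool" where
  "has_output d ol s \<longleftrightarrow> (\<forall>(q, rl) \<in> set ol. length q = d \<and> (\<forall>r \<in> set rl. length r = d)) \<and>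
     reg s 2 = length ol \<and> array_holds s 2 (concat (map fst ol)) \<and>
     reg s 3 = length (rels ol) \<and> array_holds s 3 (concat (map (\<lambda>(m, p). m @ p) (rels ol)))"

definition has_input :: "point list \<Rightarrow> point list \<Rightarrow> state \<Rightarrow> bool" where
  "has_input xs ys s \<longleftrightarrow> reg s 0 = length xs \<and> reg s 1 = length ys \<and>
     arr s 0 = cells (concat xs) \<and> arr s 1 = cells (concat ys)"

definition has_point :: "nat \<Rightarrow> point \<Rightarrow> state \<Rightarrow> bool" where
  "has_point d q s \<longleftrightarrow> length q = d \<and> (\<forall>k < d. arr s aQ k = q ! k)"

definition coord :: "nat \<Rightarrow> nat \<Rightarrow> exp \<Rightarrow> nat \<Rightarrow> exp" where
  "coord d a e k = Read a (Add (mul d e) (Lit k))"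

lemma has_output_cong:
  assumes "has_output d ol s" "reg s' 2 = reg s 2" "reg s' 3 = reg s 3" "arr s' 2 = arr s 2" "arr s' 3 = arr s 3"
  shows "has_output d ol s'"
  using assms by (simp add: has_output_def array_holds_def)

lemma has_input_cong:
  assumes "has_input xs ys s" "reg s' 0 = reg s 0" "reg s' 1 = reg s 1" "arr s' 0 = arr s 0" "arr s' 1 = arr s 1"
  shows "has_input xs ys s'"
  using assms by (simp add: has_input_def)

lemma length_concat_points:
  assumes "\<forall>x \<in> set xs. length x = d"
  shows "length (concat xs) = d * length xs"
  using assms by (induction xs) auto

lemma nth_concat_points:
  assumes "\<forall>x \<in> set xs. length x = d" "i < length xs" "k < d"
  shows "d * i + k < length (concat xs)" "concat xs ! (d * i + k) = xs ! i ! k"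
proof -
  have "d * i + k < d * Suc i"
    using assms(3) by simp
  also have "\<dots> \<le> d * length xs"
    using assms(2) by (intro mult_le_mono2) simp
  finally show "d * i + k < length (concat xs)"
    using length_concat_points[OF assms(1)] by simp
  show "concat xs ! (d * i + k) = xs ! i ! k"
    using assms
  proof (induction xs arbitrary: i)
    case (Cons x xs)
    then show ?case
      by (cases i) (auto simp: nth_append)
  qed simp
qed

lemma cells_concat:
  assumes "\<forall>x \<in> set xs. length x = d" "i < length xs" "k < d"
  shows "cells (concat xs) (d * i + k) = xs ! i ! k"
  using nth_concat_points[OF assms] by (simp add: cells_def)

lemma coord_input:
  assumes "has_input xs ys s" "k < d"
  shows "\<forall>x \<in> set xs. length x = d \<Longrightarrow> exp_val e s < length xs \<Longrightarrow>
      exp_val (coord d 0 e k) s = xs ! exp_val e s ! k"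
    "\<forall>y \<in> set ys. length y = d \<Longrightarrow> exp_val e s < length ys \<Longrightarrow>
      exp_val (coord d 1 e k) s = ys ! exp_val e s ! k"
  using assms cells_concat[of xs d "exp_val e s" k] cells_concat[of ys d "exp_val e s" k]
  by (auto simp: coord_def has_input_def)

text \<open>The expressions must not read the array \<open>a\<close>: when the later cells of the block are computed, the
  earlier ones have been changed.\<close>

definition write_block :: "nat \<Rightarrow> nat \<Rightarrow> exp \<Rightarrow> (nat \<Rightarrow> exp) \<Rightarrow> com" where
  "write_block d a p f = seqs (map (\<lambda>k. Write a (Add p (Lit k)) (f k)) [0..<d])"

lemma write_block_simps [simp]:
  "regs_of (write_block d a p f) = {}"
  "loop_free (write_block d a p f)"
  by (auto simp: write_block_def)

lemma arrs_of_write_block [simp]: "b \<noteq> a \<Longrightarrow> b \<notin> arrs_of (write_block d a p f)"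
  by (auto simp: write_block_def)

lemma effect_write_block:
  assumes "\<And>s'. frame {} {a} s s' \<Longrightarrow> exp_val p s' = P"
    "\<And>k s'. k < d \<Longrightarrow> frame {} {a} s s' \<Longrightarrow> exp_val (f k) s' = v k"
  shows "frame {} {a} s (effect (write_block d a p f) s)"
    "arr (effect (write_block d a p f) s) a i = (if P \<le> i \<and> i < P + d then v (i - P) else arr s a i)"
proof -
  define P' where "P' = (\<lambda>k s'. frame {} {a} s s' \<and>
    (\<forall>i. arr s' a i = (if P \<le> i \<and> i < P + k then v (i - P) else arr s a i)))"
  have "P' d (fold effect (map (\<lambda>k. Write a (Add p (Lit k)) (f k)) [0..<d]) s)"
  proof (rule fold_effect_upt[of P'])
    fix k s' assume k: "k < d" "P' k s'"
    then have fr: "frame {} {a} s s'"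
      by (simp add: P'_def)
    have "effect (Write a (Add p (Lit k)) (f k)) s' = set_cell a (P + k) (v k) s'"
      using assms(1)[OF fr] assms(2)[OF k(1) fr] by simp
    then show "P' (Suc k) (effect (Write a (Add p (Lit k)) (f k)) s')"
      using k by (auto simp: P'_def frame_def)
  qed (simp add: P'_def)
  then show "frame {} {a} s (effect (write_block d a p f) s)"
    "arr (effect (write_block d a p f) s) a i = (if P \<le> i \<and> i < P + d then v (i - P) else arr s a i)"
    by (auto simp: write_block_def P'_def)
qed

lemma array_holds_append:
  assumes "array_holds s a l" "\<And>i. i < length l \<Longrightarrow> arr s' a i = arr s a i"
    "\<And>k. k < length l' \<Longrightarrow> arr s' a (length l + k) = l' ! k"
  shows "array_holds s' a (l @ l')"
proof -
  have "arr s' a i = (l @ l') ! i" if "i < length (l @ l')" for i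
  proof (cases "i < length l")
    case True
    then show ?thesis using assms(1,2) by (simp add: array_holds_def nth_append)
  next
    case False
    then show ?thesis using assms(3)[of "i - length l"] that by (simp add: nth_append)
  qed
  then show ?thesis by (simp add: array_holds_def)
qed

definition emit_point :: "nat \<Rightarrow> com" where
  "emit_point d = Seq (write_block d 2 (mul d (Reg 2)) (\<lambda>k. Read aQ (Lit k)))
     (SetReg 2 (Add (Reg 2) (Lit 1)))"

definition emit_relation :: "nat \<Rightarrow> exp \<Rightarrow> com" where
  "emit_relation d e = Seq (write_block d 3 (mul (2 * d) (Reg 3)) (coord d 0 e))
     (Seq (write_block d 3 (Add (mul (2 * d) (Reg 3)) (Lit d)) (\<lambda>k. Read aQ (Lit k)))
       (SetReg 3 (Add (Reg 3) (Lit 1))))"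

lemma emit_simps [simp]:
  "regs_of (emit_point d) = {2}" "loop_free (emit_point d)"
  "regs_of (emit_relation d e) = {3}" "loop_free (emit_relation d e)"
  "a \<noteq> 2 \<Longrightarrow> a \<notin> arrs_of (emit_point d)" "a \<noteq> 3 \<Longrightarrow> a \<notin> arrs_of (emit_relation d e)"
  by (auto simp: emit_point_def emit_relation_def)

lemma effect_emit_point:
  assumes out: "has_output d ol s" and q: "has_point d q s"
  shows "has_output d (ol @ [(q, [])]) (effect (emit_point d) s)"
proof -
  let ?s = "effect (write_block d 2 (mul d (Reg 2)) (\<lambda>k. Read aQ (Lit k))) s"
  have w: "frame {} {2} s ?s"
    "arr ?s 2 i = (if d * length ol \<le> i \<and> i < d * length ol + d then q ! (i - d * length ol) else arr s 2 i)" for i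
    by (rule effect_write_block; use out q in \<open>auto simp: frame_def has_output_def has_point_def\<close>)+
  have len: "length (concat (map fst ol)) = d * length ol"
    using out by (subst length_concat_points) (auto simp: has_output_def)
  have "array_holds ?s 2 (concat (map fst ol) @ q)"
    by (rule array_holds_append[of s]) (use out q w len in \<open>auto simp: has_output_def has_point_def\<close>)
  moreover have "arr ?s 3 = arr s 3" "reg ?s 2 = reg s 2" "reg ?s 3 = reg s 3"
    using w(1) by (auto simp: frame_def)
  ultimately show ?thesis
    using out q by (auto simp: has_output_def has_point_def emit_point_def array_holds_def)
qed

lemma effect_emit_relation:
  assumes out: "has_output d (ol @ [(q, rl)]) s" and q: "has_point d q s" and inp: "has_input xs ys s"
    and xs: "\<forall>x \<in> set xs. length x = d"
    and e: "\<And>s'. frame {} {3} s s' \<Longrightarrow> exp_val e s' = i" "i < length xs"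
  shows "has_output d (ol @ [(q, rl @ [xs ! i])]) (effect (emit_relation d e) s)"
proof -
  let ?ol = "ol @ [(q, rl)]"
  let ?s1 = "effect (write_block d 3 (mul (2 * d) (Reg 3)) (coord d 0 e)) s"
  let ?s2 = "effect (write_block d 3 (Add (mul (2 * d) (Reg 3)) (Lit d)) (\<lambda>k. Read aQ (Lit k))) ?s1"
  let ?n = "2 * d * length (rels ?ol)"
  have x: "exp_val (coord d 0 e k) s' = xs ! i ! k" if "k < d" "frame {} {3} s s'" for k s'
  proof -
    have "has_input xs ys s'"
      using has_input_cong[OF inp] that(2) by (auto simp: frame_def)
    then show ?thesis
      using coord_input(1)[of xs ys s' k d e] that xs e by simp
  qed
  have w1: "frame {} {3} s ?s1"
    "arr ?s1 3 j = (if ?n \<le> j \<and> j < ?n + d then xs ! i ! (j - ?n) else arr s 3 j)" for j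
    by (rule effect_write_block; use out x in \<open>auto simp: frame_def has_output_def\<close>)+
  have w2: "frame {} {3} ?s1 ?s2"
    "arr ?s2 3 j = (if ?n + d \<le> j \<and> j < ?n + d + d then q ! (j - (?n + d)) else arr ?s1 3 j)" for j
    by (rule effect_write_block; use out q w1(1) in \<open>auto simp: frame_def has_output_def has_point_def\<close>)+
  have len: "length (concat (map (\<lambda>(m, p). m @ p) (rels ?ol))) = ?n"
  proof -
    have "\<forall>(m, p) \<in> set (rels ?ol). length m = d \<and> length p = d"
      using out by (fastforce simp: has_output_def rels_def)
    then show ?thesis
      by (subst length_concat_points[of _ "2 * d"]) auto
  qed
  have lx: "length (xs ! i) = d" "length q = d"
    using xs e(2) q by (auto simp: has_point_def)
  have "array_holds ?s2 3 (concat (map (\<lambda>(m, p). m @ p) (rels ?ol)) @ (xs ! i @ q))"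
    by (rule array_holds_append[of s])
       (use out w1(2) w2(2) len lx in \<open>auto simp: has_output_def nth_append\<close>)
  moreover have "arr ?s2 2 = arr s 2" "reg ?s2 2 = reg s 2" "reg ?s2 3 = reg s 3"
    using w1(1) w2(1) by (auto simp: frame_def)
  ultimately show ?thesis
    using out lx by (auto simp: has_output_def emit_relation_def array_holds_def)
qed

definition (in nat_interval) scaffold_list :: "(point \<times> point list) list \<Rightarrow> bool" where
  "scaffold_list ol \<longleftrightarrow> distinct (map fst ol) \<and> (\<forall>(q, rl) \<in> set ol. represents d Q q rl)"

lemma (in nat_interval) computes_initial_scaffoldI:
  assumes "runs c (input_state xs ys) b
    (\<lambda>s. \<exists>ol. has_output d ol s \<and> scaffold_list ol \<and> set (map fst ol) = initial_points Q)"
  shows "computes_initial_scaffold c xs ys Q b"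
proof -
  from assms obtain t s ol where "exec c (input_state xs ys) t s" "t \<le> b"
    and out: "has_output d ol s" and ol: "scaffold_list ol" "set (map fst ol) = initial_points Q"
    unfolding runs_def by blast
  moreover have "initial_scaffold Q (scaffold_of ol)"
    using ol by (intro initial_scaffold_scaffold_of) (auto simp: scaffold_list_def)
  moreover have "outputs_poset s (scaffold_of ol)"
    unfolding outputs_poset_def
  proof (intro exI conjI)
    show "lists_set (map fst ol) (fst (scaffold_of ol))"
      using ol by (simp add: lists_set_def scaffold_of_def scaffold_list_def)
    show "lists_set (rels ol) (snd (scaffold_of ol) - Id)"
      unfolding rels_def using ol by (intro scaffold_of_relations) (auto simp: scaffold_list_def)
  qed (use out in \<open>auto simp: has_output_def\<close>)
  ultimately show ?thesis
    unfolding computes_initial_scaffold_def by blast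
qed

lemma has_input_input_state: "has_input xs ys (input_state xs ys)"
  by (simp add: has_input_def input_state_def)

lemma has_output_input_state: "has_output d [] (input_state xs ys)"
  by (simp add: has_output_def input_state_def array_holds_def rels_def)


section \<open>Labelling coordinates\<close>

text \<open>A labelling of the coordinates whose level sets are the classes of the equivalence generated by
  \<open>E\<close>.\<close>

definition labels :: "nat \<Rightarrow> nat rel \<Rightarrow> (nat \<Rightarrow> nat) \<Rightarrow> bool" where
  "labels d E L \<longleftrightarrow> (\<forall>a < d. L a < d) \<and> (\<forall>a < d. \<forall>b < d. L a = L b \<longleftrightarrow> (a, b) \<in> (E \<union> E\<inverse>)\<^sup>*)"

text \<open>Adding a pair to \<open>E\<close> fuses two classes, one of which takes over the label of the other.\<close>

lemma labels_union:
  assumes L: "labels d E L" and E: "E \<subseteq> {..<d} \<times> {..<d}" and c: "c < d" "c' < d"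
    and L': "\<And>k. k < d \<Longrightarrow> L' k = (if L k = L c' then L c else L k)"
  shows "labels d (insert (c, c') E) L'"
proof -
  define R where "R = (E \<union> E\<inverse>)\<^sup>*"
  define R' where "R' = (insert (c, c') E \<union> (insert (c, c') E)\<inverse>)\<^sup>*"
  have LR: "L a = L b \<longleftrightarrow> (a, b) \<in> R" if "a < d" "b < d" for a b
    using L that by (simp add: labels_def R_def)
  have RR': "R \<subseteq> R'"
    unfolding R_def R'_def by (rule rtrancl_mono) auto
  have cc: "(c, c') \<in> R'" "(c', c) \<in> R'"
    unfolding R'_def by auto
  have trans: "(a, b) \<in> R' \<Longrightarrow> (b, e) \<in> R' \<Longrightarrow> (a, e) \<in> R'" for a b e
    by (simp add: R'_def)
  have "L' a = L' b \<longleftrightarrow> (a, b) \<in> R'" if ab: "a < d" "b < d" for a b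
  proof
    assume "L' a = L' b"
    then consider "L a = L b" | "L a = L c'" "L c = L b" | "L b = L c'" "L a = L c"
      using L' ab by (auto split: if_splits)
    then show "(a, b) \<in> R'"
    proof cases
      case 1
      then show ?thesis using LR ab RR' by blast
    next
      case 2
      then have "(a, c') \<in> R'" "(c, b) \<in> R'"
        using LR ab c RR' by blast+
      then show ?thesis using cc trans by blast
    next
      case 3
      then have "(a, c) \<in> R'" "(c', b) \<in> R'"
        using LR[of a c] LR[of c' b] ab c RR' by auto
      then show ?thesis using cc trans by blast
    qed
  next
    assume "(a, b) \<in> R'"
    then show "L' a = L' b"
      using ab unfolding R'_def
    proof (induction rule: rtrancl_induct)
      case (step y z)
      have y: "y < d"
        using step.hyps(2) E c by auto
      have "L' y = L' z"
      proof (cases "(y, z) \<in> E \<union> E\<inverse>")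
        case True
        then have "L y = L z"
          using LR[OF y step.prems(2)] by (auto simp: R_def)
        then show ?thesis
          using L' y step.prems by simp
      next
        case False
        then show ?thesis
          using step.hyps(2) L' c by auto
      qed
      then show ?case
        using step y by simp
    qed simp
  qed
  moreover have "L' a < d" if "a < d" for a
    using that L c L' by (auto simp: labels_def)
  ultimately show ?thesis
    by (simp add: labels_def R'_def)
qed

context nat_interval
begin

lemma sym_link: "(link d Q q) \<union> (link d Q q)\<inverse> = link d Q q"
  by (auto simp: link_def)

lemma below_ne': "q \<in> Q \<Longrightarrow> m \<in> minima_below Q q \<Longrightarrow> below d q m \<noteq> {}"
  using below_ne minima_below_dn by blast

text \<open>All coordinates in which a minimum differs from \<open>q\<close> carry the same label, so one of them is enough
  to compare two minima.\<close>

lemma linked_iff_label: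
  assumes "labels d (link d Q q) L" "m \<in> minima_below Q q" "m' \<in> minima_below Q q"
    "a \<in> below d q m" "b \<in> below d q m'"
  shows "linked d Q q m m' \<longleftrightarrow> L a = L b"
proof -
  have lab: "L a = L b \<longleftrightarrow> (a, b) \<in> (link d Q q)\<^sup>*" if "a < d" "b < d" for a b
    using assms(1) that unfolding labels_def sym_link by blast
  have same: "(a, a') \<in> link d Q q" if "m \<in> minima_below Q q" "a \<in> below d q m" "a' \<in> below d q m" for a a' m
    using that by (auto simp: link_def)
  have d: "a < d" "b < d"
    using assms by (auto simp: below_def)
  show ?thesis
  proof
    assume "linked d Q q m m'"
    then obtain a' b' where "a' \<in> below d q m" "b' \<in> below d q m'" "(a', b') \<in> (link d Q q)\<^sup>*"
      by (auto simp: linked_def)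
    then have "(a, b) \<in> (link d Q q)\<^sup>*"
      using same[OF assms(2,4)] same[OF assms(3) _ assms(5)]
      by (meson converse_rtrancl_into_rtrancl rtrancl_into_rtrancl)
    then show "L a = L b"
      using lab d by blast
  qed (use assms lab d in \<open>auto simp: linked_def\<close>)
qed

text \<open>No representative means that \<open>dn(q)\<close> is empty, and two or more mean that it has several
  components.\<close>

lemma initial_iff_representatives:
  assumes q: "q \<in> Q" and rl: "represents d Q q rl"
  shows "q \<in> initial_points Q \<longleftrightarrow> length rl \<noteq> 1"
proof
  assume I: "q \<in> initial_points Q"
  show "length rl \<noteq> 1"
  proof
    assume "length rl = 1"
    then obtain r where r: "rl = [r]"
      by (auto simp: length_Suc_conv)
    have rb: "r \<in> minima_below Q q"
      using rl r by (auto simp: represents_def)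
    then have "q \<notin> minima Q"
      by (auto simp: minima_below_def minima_def)
    then obtain m m' where m: "m \<in> minima_below Q q" "m' \<in> minima_below Q q" "\<not> linked d Q q m m'"
      using I initial_points_iff by blast
    have "linked d Q q m r" "linked d Q q m' r"
      using m rl r by (auto simp: represents_def)
    then have "(m, r) \<in> conn (dn Q q)" "(m', r) \<in> conn (dn Q q)"
      using conn_iff_linked q m rb minima_below_dn by blast+
    then have "(m, m') \<in> conn (dn Q q)"
      using sym_conn conn_trans by (metis symD)
    then show False
      using conn_iff_linked q m minima_below_dn by blast
  qed
next
  assume ne: "length rl \<noteq> 1"
  show "q \<in> initial_points Q"
  proof (cases rl)
    case Nil
    have "minima_below Q q = {}"
      using rl Nil by (auto simp: represents_def)
    then have "q \<in> minima Q"
      using linked_minimum_below[OF q] dn_minimum[OF q] by blast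
    then show ?thesis
      using initial_points_iff by blast
  next
    case (Cons r rl')
    then obtain r' where r: "r \<in> set rl" "r' \<in> set rl" "r \<noteq> r'"
      using ne rl by (cases rl') (auto simp: represents_def)
    then have rb: "r \<in> minima_below Q q" "r' \<in> minima_below Q q"
      using rl by (auto simp: represents_def)
    have "linked d Q q r r"
      using conn_iff_linked q rb minima_below_dn by (metis conn_refl)
    then have "\<not> linked d Q q r r'"
      using rl rb r unfolding represents_def by blast
    then show ?thesis
      using initial_points_iff q rb by blast
  qed
qed

text \<open>In each coordinate, one of two unlinked minima agrees with \<open>q\<close>, since otherwise this coordinate
  would link them.\<close>

lemma initial_point_join:
  assumes "q \<in> initial_points Q"
  shows "\<exists>m \<in> minima Q. \<exists>m' \<in> minima Q. q = join m m'"
proof (cases "q \<in> minima Q")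
  case True
  have "q = join q q"
    by (auto intro: nth_equalityI)
  then show ?thesis using True by blast
next
  case False
  then have q: "q \<in> Q" using assms by (auto simp: initial_points_def)
  obtain m m' where m: "m \<in> minima_below Q q" "m' \<in> minima_below Q q" "\<not> linked d Q q m m'"
    using assms False initial_points_iff by blast
  then have len: "length m = d" "length m' = d" "length q = d"
    using q length_eq by (auto simp: minima_below_def minima_def)
  have "q ! k = join m m' ! k" if k: "k < d" for k
  proof (rule ccontr)
    assume ne: "q ! k \<noteq> join m m' ! k"
    have "m ! k \<le> q ! k" "m' ! k \<le> q ! k"
      using m(1,2) k len by (auto simp: minima_below_def pt_le_iff)
    then have "m ! k < q ! k" "m' ! k < q ! k"
      using ne k len by (auto simp: max_def split: if_splits)
    then show False
      using m(3) k by (auto simp: linked_def below_def)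
  qed
  then have "q = join m m'"
    using len by (auto intro: nth_equalityI)
  then show ?thesis
    using m by (auto simp: minima_below_def)
qed

end


section \<open>Examining all joins of two minima\<close>

abbreviation (input) "aLab \<equiv> 11 :: nat"
abbreviation (input) "aSeen \<equiv> 12 :: nat"
abbreviation (input) "aRep \<equiv> 13 :: nat"
abbreviation (input) "rA \<equiv> 20 :: nat"
abbreviation (input) "rB \<equiv> 21 :: nat"
abbreviation (input) "rY \<equiv> 22 :: nat"
abbreviation (input) "rOk \<equiv> 23 :: nat"
abbreviation (input) "rDup \<equiv> 24 :: nat"
abbreviation (input) "rCnt \<equiv> 25 :: nat"
abbreviation (input) "rT1 \<equiv> 26 :: nat"
abbreviation (input) "rT2 \<equiv> 27 :: nat"
abbreviation (input) "rC \<equiv> 28 :: nat"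

locale specified_interval = nat_interval +
  fixes xs ys :: "point list" and upset :: bool
  assumes xs: "distinct xs" "set xs = minima Q"
    and ys: "\<forall>y \<in> set ys. length y = d"
    and member: "m \<in> Q \<Longrightarrow> m \<preceq> q \<Longrightarrow> q \<in> Q \<longleftrightarrow> member_by upset (set ys) q"
begin

lemma xs_length: "\<forall>x \<in> set xs. length x = d"
  using xs minima_in length_eq by auto

end

lemma runs_SetReg:
  assumes "Q (set_reg x (exp_val e s) s)" "1 + exp_cost e \<le> b"
  shows "runs (SetReg x e) s b Q"
  using runs_mono[OF runs_effect[of "SetReg x e" Q s]] assms by simp

definition eqE :: "exp \<Rightarrow> exp \<Rightarrow> test" where
  "eqE e e' = Conj (Neg (Less e e')) (Neg (Less e' e))"

lemma test_val_eqE [simp]: "test_val (eqE e e') s \<longleftrightarrow> exp_val e s = exp_val e' s"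
  by (auto simp: eqE_def)

definition write_join :: "nat \<Rightarrow> com" where
  "write_join d = write_block d aQ (Lit 0) (\<lambda>k. maxE (coord d 0 (Reg rA) k) (coord d 0 (Reg rB) k))"

text \<open>Deciding membership in \<open>Q\<close> and looking for a repetition in the output are both of this form.\<close>

definition search :: "nat \<Rightarrow> nat \<Rightarrow> nat \<Rightarrow> nat \<Rightarrow> test \<Rightarrow> com" where
  "search f v v' l b = Seq (SetReg f (Lit v)) (For rY (Reg l) (Cond b (SetReg f (Lit v')) Skip))"

definition member_test :: "nat \<Rightarrow> bool \<Rightarrow> test" where
  "member_test d upset = all_below d (\<lambda>k. Neg (if upset
     then Less (Read aQ (Lit k)) (coord d 1 (Reg rY) k) else Less (coord d 1 (Reg rY) k) (Read aQ (Lit k))))"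

definition check_member :: "nat \<Rightarrow> bool \<Rightarrow> com" where
  "check_member d upset =
     search rOk (if upset then 1 else 0) (if upset then 0 else 1) 1 (member_test d upset)"

definition check_new :: "nat \<Rightarrow> com" where
  "check_new d = search rDup 0 1 2 (all_below d (\<lambda>k. eqE (Read aQ (Lit k)) (coord d 2 (Reg rY) k)))"

definition differs :: "nat \<Rightarrow> nat \<Rightarrow> test" where
  "differs d k = Less (coord d 0 (Reg rY) k) (Read aQ (Lit k))"

definition lies_below :: "nat \<Rightarrow> test" where
  "lies_below d = all_below d (\<lambda>k. Neg (Less (Read aQ (Lit k)) (coord d 0 (Reg rY) k)))"

definition unite :: "nat \<Rightarrow> nat \<Rightarrow> nat \<Rightarrow> com" where
  "unite d c c' = Seq (SetReg rT1 (Read aLab (Lit c))) (Seq (SetReg rT2 (Read aLab (Lit c')))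
     (seqs (map (\<lambda>k. Cond (eqE (Read aLab (Lit k)) (Reg rT2)) (Write aLab (Lit k) (Reg rT1)) Skip) [0..<d])))"

definition unite_all :: "nat \<Rightarrow> com" where
  "unite_all d = seqs (map (\<lambda>c. seqs (map (\<lambda>c'.
     Cond (Conj (differs d c) (differs d c')) (unite d c c') Skip) [0..<d])) [0..<d])"

definition label_coordinates :: "nat \<Rightarrow> com" where
  "label_coordinates d = Seq (write_block d aLab (Lit 0) Lit)
     (For rY (Reg 0) (Cond (lies_below d) (unite_all d) Skip))"

definition find_difference :: "nat \<Rightarrow> com" where
  "find_difference d = Seq (SetReg rC (Lit d))
     (seqs (map (\<lambda>k. Cond (differs d k) (SetReg rC (Lit k)) Skip) [0..<d]))"

definition new_representative :: com where
  "new_representative = Cond (eqE (Read aSeen (Read aLab (Reg rC))) (Lit 0))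
     (seqs [Write aSeen (Read aLab (Reg rC)) (Lit 1), Write aRep (Reg rCnt) (Reg rY),
       SetReg rCnt (Add (Reg rCnt) (Lit 1))]) Skip"

definition find_representatives :: "nat \<Rightarrow> com" where
  "find_representatives d = Seq (write_block d aSeen (Lit 0) (\<lambda>k. Lit 0)) (Seq (SetReg rCnt (Lit 0))
     (For rY (Reg 0) (Cond (lies_below d)
        (Seq (find_difference d) (Cond (Less (Reg rC) (Lit d)) new_representative Skip)) Skip)))"

definition emit_all :: "nat \<Rightarrow> com" where
  "emit_all d = Seq (emit_point d) (For rY (Reg rCnt) (emit_relation d (Read aRep (Reg rY))))"

definition examine_join :: "nat \<Rightarrow> bool \<Rightarrow> com" where
  "examine_join d upset = Seq (write_join d) (Seq (check_member d upset) (Seq (check_new d)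
     (Cond (Conj (eqE (Reg rOk) (Lit 1)) (eqE (Reg rDup) (Lit 0)))
       (Seq (label_coordinates d) (Seq (find_representatives d)
         (Cond (eqE (Reg rCnt) (Lit 1)) Skip (emit_all d)))) Skip)))"

definition all_joins :: "nat \<Rightarrow> bool \<Rightarrow> com" where
  "all_joins d upset = For rA (Reg 0) (For rB (Reg 0) (examine_join d upset))"

lemma search_simps [simp]:
  "regs_of (search f v v' l b) = {f, rY}" "arrs_of (search f v v' l b) = {}"
  by (auto simp: search_def)

lemma regs_of_examine [simp]:
  "regs_of (write_join d) = {}"
  "regs_of (check_member d upset) = {rOk, rY}"
  "regs_of (check_new d) = {rDup, rY}"
  "r \<noteq> rT1 \<Longrightarrow> r \<noteq> rT2 \<Longrightarrow> r \<notin> regs_of (unite d c c')"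
  "r \<noteq> rT1 \<Longrightarrow> r \<noteq> rT2 \<Longrightarrow> r \<notin> regs_of (unite_all d)"
  "r \<noteq> rT1 \<Longrightarrow> r \<noteq> rT2 \<Longrightarrow> r \<noteq> rY \<Longrightarrow> r \<notin> regs_of (label_coordinates d)"
  "regs_of (find_difference d) = {rC}"
  "regs_of new_representative = {rCnt}"
  "regs_of (find_representatives d) = {rC, rCnt, rY}"
  "regs_of (emit_all d) = {2, 3, rY}"
  by (auto simp: write_join_def check_member_def check_new_def unite_def unite_all_def
      label_coordinates_def find_difference_def new_representative_def find_representatives_def emit_all_def)

lemma arrs_of_examine [simp]:
  "a \<noteq> aQ \<Longrightarrow> a \<notin> arrs_of (write_join d)"
  "arrs_of (check_member d upset) = {}"
  "arrs_of (check_new d) = {}"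
  "a \<noteq> aLab \<Longrightarrow> a \<notin> arrs_of (unite d c c')"
  "a \<noteq> aLab \<Longrightarrow> a \<notin> arrs_of (unite_all d)"
  "a \<noteq> aLab \<Longrightarrow> a \<notin> arrs_of (label_coordinates d)"
  "arrs_of (find_difference d) = {}"
  "arrs_of new_representative = {aSeen, aRep}"
  "a \<noteq> aSeen \<Longrightarrow> a \<noteq> aRep \<Longrightarrow> a \<notin> arrs_of (find_representatives d)"
  "a \<noteq> 2 \<Longrightarrow> a \<noteq> 3 \<Longrightarrow> a \<notin> arrs_of (emit_all d)"
  by (auto simp: write_join_def check_member_def check_new_def unite_def unite_all_def
      label_coordinates_def find_difference_def new_representative_def find_representatives_def emit_all_def)

lemma loop_free_examine [simp]:
  "loop_free (write_join d)" "loop_free (unite d c c')" "loop_free (unite_all d)"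
  "loop_free (find_difference d)" "loop_free new_representative"
  by (auto simp: write_join_def unite_def unite_all_def find_difference_def new_representative_def)

lemma has_point_cong: "has_point d q s \<Longrightarrow> arr s' aQ = arr s aQ \<Longrightarrow> has_point d q s'"
  by (simp add: has_point_def)

definition body_cost :: "nat \<Rightarrow> com \<Rightarrow> nat" where
  "body_cost N c = (N + 1) * (max_cost c + 10)"

lemma runs_For_loop_free:
  assumes "loop_free c" "\<And>s'. s' = set_reg i 0 s \<Longrightarrow> I 0 s'"
    and "\<And>k s'. k < N \<Longrightarrow> I k s' \<Longrightarrow> reg s' i = k \<Longrightarrow> frame (insert i (regs_of c)) (arrs_of c) s s' \<Longrightarrow>
      I (Suc k) (set_reg i (Suc k) (effect c s'))"
    and "i \<notin> regs_of c" "r \<noteq> i" "r \<notin> regs_of c" "reg s r = N"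
    and post: "\<And>s'. I N s' \<Longrightarrow> frame (insert i (regs_of c)) (arrs_of c) s s' \<Longrightarrow> P s'"
  shows "runs (For i (Reg r) c) s (body_cost N c) P"
proof -
  have "runs (For i (Reg r) c) s ((N + 1) * (max_cost c + exp_cost (Reg r) + 7)) P"
  proof (rule runs_For[where I = I])
    show "exp_val (Reg r) s' = N" if "frame (insert i (regs_of c)) (arrs_of c) s s'" for s'
      using frame_reg[OF that, of r] assms by simp
  qed (use assms in \<open>auto intro: runs_effect\<close>)
  moreover have "(N + 1) * (max_cost c + exp_cost (Reg r) + 7) \<le> body_cost N c"
    unfolding body_cost_def by (rule mult_le_mono2) simp
  ultimately show ?thesis
    by (rule runs_mono)
qed

lemma effect_write_join:
  assumes inp: "has_input xs ys s" and xs: "\<forall>x \<in> set xs. length x = d"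
    and ab: "reg s rA < length xs" "reg s rB < length xs"
  shows "has_point d (join (xs ! reg s rA) (xs ! reg s rB)) (effect (write_join d) s)"
proof -
  let ?a = "reg s rA" and ?b = "reg s rB"
  have "arr (effect (write_join d) s) aQ i =
      (if 0 \<le> i \<and> i < 0 + d then max (xs ! ?a ! (i - 0)) (xs ! ?b ! (i - 0)) else arr s aQ i)" for i
    unfolding write_join_def
  proof (rule effect_write_block(2))
    fix k s' assume k: "k < d" and fr: "frame {} {aQ} s s'"
    have "has_input xs ys s'"
      using has_input_cong[OF inp] fr by (simp add: frame_def)
    moreover have "reg s' rA = ?a" "reg s' rB = ?b"
      using fr by (auto simp: frame_def)
    ultimately show "exp_val (maxE (coord d 0 (Reg rA) k) (coord d 0 (Reg rB) k)) s' = max (xs ! ?a ! k) (xs ! ?b ! k)"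
      using coord_input(1)[of xs ys s' k d] k xs ab by simp
  qed simp
  then show ?thesis
    using xs ab by (auto simp: has_point_def)
qed

definition search_cost :: "nat \<Rightarrow> nat \<Rightarrow> nat \<Rightarrow> test \<Rightarrow> nat" where
  "search_cost n f v' b = 2 + body_cost n (Cond b (SetReg f (Lit v')) Skip)"

lemma runs_search:
  assumes N: "reg s l = N" and ne: "f \<noteq> rY" "l \<noteq> f" "l \<noteq> rY"
    and test: "\<And>k s'. k < N \<Longrightarrow> frame {f, rY} {} s s' \<Longrightarrow> reg s' rY = k \<Longrightarrow> test_val b s' \<longleftrightarrow> P k"
  shows "runs (search f v v' l b) s (search_cost N f v' b) (\<lambda>s'. reg s' f = (if \<exists>k<N. P k then v' else v))"
proof -
  let ?c = "Cond b (SetReg f (Lit v')) Skip"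
  have init: "runs (SetReg f (Lit v)) s 2 (\<lambda>s'. s' = set_reg f v s)"
    by (rule runs_SetReg) auto
  have loop: "runs (For rY (Reg l) ?c) s1 (body_cost N ?c) (\<lambda>s'. reg s' f = (if \<exists>k<N. P k then v' else v))"
    if s1: "s1 = set_reg f v s" for s1
  proof (rule runs_For_loop_free[where I = "\<lambda>t s'. reg s' f = (if \<exists>k<t. P k then v' else v)"])
    fix t s' assume t: "t < N" "reg s' f = (if \<exists>k<t. P k then v' else v)" "reg s' rY = t"
      and fr: "frame (insert rY (regs_of ?c)) (arrs_of ?c) s1 s'"
    have "frame {f, rY} {} s s'"
      using fr s1 by (auto simp: frame_def)
    then have "test_val b s' \<longleftrightarrow> P t"
      using test t by blast
    then show "reg (set_reg rY (Suc t) (effect ?c s')) f = (if \<exists>k<Suc t. P k then v' else v)"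
      using t ne by (auto simp: less_Suc_eq)
  qed (use s1 N ne in auto)
  show ?thesis
    unfolding search_def search_cost_def by (rule runs_Seq[OF init loop])
qed

definition check_cost :: "nat \<Rightarrow> bool \<Rightarrow> nat \<Rightarrow> nat" where
  "check_cost d upset n = search_cost n rOk (if upset then 0 else 1) (member_test d upset)"

lemma runs_check_member:
  assumes inp: "has_input xs ys s" and ys: "\<forall>y \<in> set ys. length y = d" and q: "has_point d q s"
  shows "runs (check_member d upset) s (check_cost d upset (length ys))
    (\<lambda>s'. reg s' rOk = (if member_by upset (set ys) q then 1 else 0))"
proof -
  let ?P = "\<lambda>j. if upset then ys ! j \<preceq> q else q \<preceq> ys ! j"
  have "runs (check_member d upset) s (check_cost d upset (length ys))
    (\<lambda>s'. reg s' rOk = (if \<exists>j<length ys. ?P j then (if upset then 0 else 1) else (if upset then 1 else 0)))"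
    unfolding check_member_def check_cost_def
  proof (rule runs_search)
    fix j s' assume j: "j < length ys" "frame {rOk, rY} {} s s'" "reg s' rY = j"
    have "has_input xs ys s'" "has_point d q s'"
      using has_input_cong[OF inp] has_point_cong[OF q] j(2) by (simp_all add: frame_def)
    moreover have "length (ys ! j) = d"
      using ys j(1) by simp
    ultimately show "test_val (member_test d upset) s' \<longleftrightarrow> ?P j"
      using coord_input(2)[of xs ys s' _ d "Reg rY"] ys j
      by (auto simp: member_test_def pt_le_iff has_point_def not_less)
  qed (use inp in \<open>auto simp: has_input_def\<close>)
  moreover have "(\<exists>j<length ys. ?P j) \<longleftrightarrow> (\<exists>y \<in> set ys. if upset then y \<preceq> q else q \<preceq> y)"
    by (metis in_set_conv_nth)
  then have "(if \<exists>j<length ys. ?P j then (if upset then 0 else 1) else (if upset then 1 else 0)) =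
      (if member_by upset (set ys) q then 1 else 0 :: nat)"
    by (cases upset) (auto simp: member_by_def)
  ultimately show ?thesis
    by (simp only:)
qed

definition new_cost :: "nat \<Rightarrow> nat \<Rightarrow> nat" where
  "new_cost d n = search_cost n rDup 1 (all_below d (\<lambda>k. eqE (Read aQ (Lit k)) (coord d 2 (Reg rY) k)))"

lemma runs_check_new:
  assumes out: "has_output d ol s" and q: "has_point d q s"
  shows "runs (check_new d) s (new_cost d (length ol))
    (\<lambda>s'. reg s' rDup = (if q \<in> set (map fst ol) then 1 else 0))"
proof -
  let ?b = "all_below d (\<lambda>k. eqE (Read aQ (Lit k)) (coord d 2 (Reg rY) k))"
  have len: "\<forall>x \<in> set (map fst ol). length x = d"
    using out by (auto simp: has_output_def)
  have "runs (check_new d) s (new_cost d (length ol))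
    (\<lambda>s'. reg s' rDup = (if \<exists>j<length ol. map fst ol ! j = q then 1 else 0))"
    unfolding check_new_def new_cost_def
  proof (rule runs_search)
    fix j s' assume j: "j < length ol" "frame {rDup, rY} {} s s'" "reg s' rY = j"
    have q': "has_point d q s'" and arr2: "arr s' 2 = arr s 2"
      using has_point_cong[OF q] j(2) by (simp_all add: frame_def)
    have "exp_val (coord d 2 (Reg rY) k) s' = map fst ol ! j ! k" if k: "k < d" for k
      using nth_concat_points[OF len, of j k] out j k arr2
      by (simp add: coord_def has_output_def array_holds_def)
    moreover have "map fst ol ! j = q \<longleftrightarrow> (\<forall>k<d. q ! k = map fst ol ! j ! k)"
      using len j(1) q by (auto simp: list_eq_iff_nth_eq has_point_def)
    ultimately show "test_val ?b s' \<longleftrightarrow> map fst ol ! j = q"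
      using q' by (auto simp: has_point_def)
  qed (use out in \<open>auto simp: has_output_def\<close>)
  moreover have "(\<exists>j<length ol. map fst ol ! j = q) \<longleftrightarrow> q \<in> set (map fst ol)"
    by (simp only: in_set_conv_nth length_map)
  ultimately show ?thesis
    by simp
qed

lemma effect_unite:
  assumes L: "labels d E (arr s aLab)" and E: "E \<subseteq> {..<d} \<times> {..<d}" and c: "c < d" "c' < d"
  shows "labels d (insert (c, c') E) (arr (effect (unite d c c') s) aLab)"
proof -
  let ?L = "arr s aLab"
  let ?s = "set_reg rT2 (?L c') (set_reg rT1 (?L c) s)"
  define P where "P = (\<lambda>t (s' :: state). reg s' rT1 = ?L c \<and> reg s' rT2 = ?L c' \<and>
    (\<forall>k. arr s' aLab k = (if k < t \<and> ?L k = ?L c' then ?L c else ?L k)))"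
  have "P d (fold effect (map (\<lambda>k. Cond (eqE (Read aLab (Lit k)) (Reg rT2)) (Write aLab (Lit k) (Reg rT1)) Skip) [0..<d]) ?s)"
    by (rule fold_effect_upt[of P]) (auto simp: P_def less_Suc_eq)
  then show ?thesis
    by (intro labels_union[OF L E c]) (simp add: unite_def P_def)
qed

lemma test_val_differs:
  assumes "has_input xs ys s" "has_point d q s" "\<forall>x \<in> set xs. length x = d" "reg s rY < length xs" "k < d"
  shows "test_val (differs d k) s \<longleftrightarrow> k \<in> below d q (xs ! reg s rY)"
  using coord_input(1)[OF assms(1,5,3), of "Reg rY"] assms
  by (auto simp: differs_def below_def has_point_def)

lemma test_val_lies_below:
  assumes "has_input xs ys s" "has_point d q s" "\<forall>x \<in> set xs. length x = d" "reg s rY < length xs"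
  shows "test_val (lies_below d) s \<longleftrightarrow> xs ! reg s rY \<preceq> q"
  using coord_input(1)[OF assms(1) _ assms(3), of _ "Reg rY"] assms
  by (auto simp: lies_below_def pt_le_iff has_point_def not_less)

lemma effect_unite_all:
  assumes L: "labels d E (arr s aLab)" and E: "E \<subseteq> {..<d} \<times> {..<d}"
    and inp: "has_input xs ys s" "has_point d q s" "\<forall>x \<in> set xs. length x = d" "reg s rY < length xs"
  defines "T \<equiv> below d q (xs ! reg s rY)"
  shows "labels d (E \<union> T \<times> T) (arr (effect (unite_all d) s) aLab)"
proof -
  define good where "good s' \<longleftrightarrow> has_input xs ys s' \<and> has_point d q s' \<and> reg s' rY = reg s rY" for s' :: state
  have T: "T \<subseteq> {..<d}"
    by (auto simp: T_def below_def)
  \<comment> \<open>All pairs that start below \<open>c\<close> have been united, then also those of \<open>c\<close> with a coordinate below \<open>c'\<close>.\<close>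
  define A where "A c = E \<union> {(a, b) \<in> T \<times> T. a < c}" for c
  define B where "B c c' = A c \<union> {(a, b) \<in> T \<times> T. a = c \<and> b < c'}" for c c'
  have A: "A c \<subseteq> {..<d} \<times> {..<d}" and B: "B c c' \<subseteq> {..<d} \<times> {..<d}" for c c'
    using E T by (auto simp: A_def B_def)
  have test: "test_val (differs d k) s' \<longleftrightarrow> k \<in> T" if "good s'" "k < d" for k s'
    using test_val_differs[of xs ys s' d q k] that inp by (simp add: good_def T_def)
  have good_unite: "good (effect (unite d c c') s')" if "good s'" for c c' s'
    using effect_frame[of "unite d c c'" s'] that has_input_cong[of xs ys s'] has_point_cong[of d q s']
    by (simp add: good_def frame_def)
  define P where "P = (\<lambda>c (s' :: state). good s' \<and> labels d (A c) (arr s' aLab))"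
  define R where "R = (\<lambda>c c' (s' :: state). good s' \<and> labels d (B c c') (arr s' aLab))"
  let ?f = "\<lambda>c c'. Cond (Conj (differs d c) (differs d c')) (unite d c c') Skip"
  have "P d (fold effect (map (\<lambda>c. seqs (map (?f c) [0..<d])) [0..<d]) s)"
  proof (rule fold_effect_upt[of P])
    show "P 0 s"
      using L inp by (simp add: P_def A_def good_def)
  next
    fix c s' assume c: "c < d" and P: "P c s'"
    have "R c d (fold effect (map (?f c) [0..<d]) s')"
    proof (rule fold_effect_upt[of "R c"])
      show "R c 0 s'"
        using P by (simp add: P_def R_def B_def)
    next
      fix c' s'' assume c': "c' < d" and R: "R c c' s''"
      show "R c (Suc c') (effect (?f c c') s'')"
      proof (cases "c \<in> T \<and> c' \<in> T")
        case True
        then have "B c (Suc c') = insert (c, c') (B c c')"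
          by (auto simp: B_def less_Suc_eq)
        then show ?thesis
          using True R test[of s''] c c' good_unite effect_unite[of d "B c c'" s'' c c'] B by (simp add: R_def)
      next
        case False
        then have "B c (Suc c') = B c c'"
          by (auto simp: B_def less_Suc_eq)
        then show ?thesis
          using False R test[of s''] c c' by (auto simp: R_def)
      qed
    qed
    moreover have "B c d = A (Suc c)"
      using T by (auto simp: A_def B_def less_Suc_eq)
    ultimately show "P (Suc c) (effect (seqs (map (?f c) [0..<d])) s')"
      by (simp add: P_def R_def)
  qed
  moreover have "A d = E \<union> T \<times> T"
    using T by (auto simp: A_def)
  ultimately show ?thesis
    by (simp add: P_def unite_all_def)
qed

definition label_cost :: "nat \<Rightarrow> nat \<Rightarrow> nat" where
  "label_cost d n = max_cost (write_block d aLab (Lit 0) Lit) + body_cost n (Cond (lies_below d) (unite_all d) Skip)"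

lemma (in specified_interval) runs_label_coordinates:
  assumes inp: "has_input xs ys s" "has_point d q s" and q: "q \<in> Q"
  shows "runs (label_coordinates d) s (label_cost d (length xs)) (\<lambda>s'. labels d (link d Q q) (arr s' aLab))"
proof -
  let ?init = "write_block d aLab (Lit 0) Lit" and ?c = "Cond (lies_below d) (unite_all d) Skip"
  define E where "E t = {(a, b). \<exists>i<t. xs ! i \<preceq> q \<and> a \<in> below d q (xs ! i) \<and> b \<in> below d q (xs ! i)}" for t
  have E: "E t \<subseteq> {..<d} \<times> {..<d}" for t
    by (auto simp: E_def below_def)
  have En: "E (length xs) = link d Q q"
  proof -
    have "minima_below Q q = {m \<in> set xs. m \<preceq> q \<and> m \<noteq> q}"
      using xs by (simp add: minima_below_def)
    moreover have "below d q q = {}"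
      by (simp add: below_def)
    ultimately show ?thesis
      by (fastforce simp: E_def link_def in_set_conv_nth)
  qed
  have init: "runs ?init s (max_cost ?init) (\<lambda>s'. labels d {} (arr s' aLab))"
  proof (rule runs_effect)
    have "arr (effect ?init s) aLab i = (if 0 \<le> i \<and> i < 0 + d then i - 0 else arr s aLab i)" for i
      by (rule effect_write_block(2)) auto
    then show "labels d {} (arr (effect ?init s) aLab)"
      by (auto simp: labels_def)
  qed simp
  have loop: "runs (For rY (Reg 0) ?c) s1 (body_cost (length xs) ?c) (\<lambda>s'. labels d (link d Q q) (arr s' aLab))"
    if s1: "labels d {} (arr s1 aLab)" "frame (regs_of ?init) (arrs_of ?init) s s1" for s1
  proof (rule runs_For_loop_free[where I = "\<lambda>t s'. labels d (E t) (arr s' aLab)"])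
    fix t s' assume t: "t < length xs" "labels d (E t) (arr s' aLab)" "reg s' rY = t"
      and fr: "frame (insert rY (regs_of ?c)) (arrs_of ?c) s1 s'"
    have inp': "has_input xs ys s'" "has_point d q s'"
      using inp has_input_cong[of xs ys s s'] has_point_cong[of d q s s'] frame_reg[OF fr] frame_arr[OF fr]
        frame_reg[OF s1(2)] frame_arr[OF s1(2)] by simp_all
    have test: "test_val (lies_below d) s' \<longleftrightarrow> xs ! t \<preceq> q"
      using test_val_lies_below[OF inp' xs_length] t by simp
    show "labels d (E (Suc t)) (arr (set_reg rY (Suc t) (effect ?c s')) aLab)"
    proof (cases "xs ! t \<preceq> q")
      case True
      then have "E (Suc t) = E t \<union> below d q (xs ! t) \<times> below d q (xs ! t)"
        by (auto simp: E_def less_Suc_eq)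
      then show ?thesis
        using True test effect_unite_all[OF t(2) E inp' xs_length] t by simp
    next
      case False
      then have "E (Suc t) = E t"
        by (auto simp: E_def less_Suc_eq)
      then show ?thesis
        using False test t by simp
    qed
  next
    show "reg s1 0 = length xs"
      using inp frame_reg[OF s1(2)] by (simp add: has_input_def)
  qed (use s1 En in \<open>auto simp: E_def\<close>)
  show ?thesis
    using runs_Seq[OF init loop] by (simp add: label_coordinates_def label_cost_def)
qed

text \<open>The choice of the coordinate does not matter, by \<open>label_of_eq\<close>.\<close>

definition label_of :: "nat \<Rightarrow> (nat \<Rightarrow> nat) \<Rightarrow> point \<Rightarrow> point \<Rightarrow> nat" where
  "label_of d L q m = L (SOME a. a \<in> below d q m)"

lemma label_of_eq:
  assumes "labels d (link d Q q) L" "m \<in> minima_below Q q" "a \<in> below d q m"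
  shows "label_of d L q m = L a"
proof -
  have "(SOME a. a \<in> below d q m) \<in> below d q m"
    using assms(3) by (rule someI)
  moreover from this have "((SOME a. a \<in> below d q m), a) \<in> link d Q q"
    using assms by (auto simp: link_def)
  ultimately show ?thesis
    using assms unfolding labels_def label_of_def below_def by blast
qed

definition representatives_cost :: "nat \<Rightarrow> nat \<Rightarrow> nat" where
  "representatives_cost d n = max_cost (write_block d aSeen (Lit 0) (\<lambda>k. Lit 0)) + (2 + body_cost n
     (Cond (lies_below d) (Seq (find_difference d) (Cond (Less (Reg rC) (Lit d)) new_representative Skip)) Skip))"

lemma effect_find_difference:
  assumes inp: "has_input xs ys s" "has_point d q s" "\<forall>x \<in> set xs. length x = d" "reg s rY < length xs"
  defines "T \<equiv> below d q (xs ! reg s rY)"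
  shows "if T = {} then reg (effect (find_difference d) s) rC = d else reg (effect (find_difference d) s) rC \<in> T"
proof -
  define P where "P = (\<lambda>k s'. frame {rC} {} s s' \<and>
    (if T \<inter> {..<k} = {} then reg s' rC = d else reg s' rC \<in> T))"
  have "P d (fold effect (map (\<lambda>k. Cond (differs d k) (SetReg rC (Lit k)) Skip) [0..<d]) (set_reg rC d s))"
  proof (rule fold_effect_upt[of P])
    show "P 0 (set_reg rC d s)"
      by (simp add: P_def frame_def)
  next
    fix k s' assume k: "k < d" and P: "P k s'"
    have "has_input xs ys s'" "has_point d q s'" "reg s' rY = reg s rY"
      using P inp has_input_cong[of xs ys s s'] has_point_cong[of d q s s'] by (auto simp: P_def frame_def)
    then have "test_val (differs d k) s' \<longleftrightarrow> k \<in> T"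
      using test_val_differs[of xs ys s' d q k] inp k by (simp add: T_def)
    moreover have "T \<inter> {..<Suc k} = (if k \<in> T then insert k (T \<inter> {..<k}) else T \<inter> {..<k})"
      by (auto simp: less_Suc_eq)
    ultimately show "P (Suc k) (effect (Cond (differs d k) (SetReg rC (Lit k)) Skip) s')"
      using P by (auto simp: P_def frame_def)
  qed
  moreover have "T \<inter> {..<d} = T"
    by (auto simp: T_def below_def)
  ultimately show ?thesis
    by (simp add: P_def find_difference_def)
qed

definition emit_cost :: "nat \<Rightarrow> nat \<Rightarrow> nat" where
  "emit_cost d n = max_cost (emit_point d) + body_cost n (emit_relation d (Read aRep (Reg rY)))"

definition join_cost :: "nat \<Rightarrow> bool \<Rightarrow> nat \<Rightarrow> nat \<Rightarrow> nat \<Rightarrow> nat" where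
  "join_cost d upset n ny k = max_cost (write_join d) + (check_cost d upset ny + (new_cost d k +
     (10 + test_cost (Conj (eqE (Reg rOk) (Lit 1)) (eqE (Reg rDup) (Lit 0))) +
       (label_cost d n + (representatives_cost d n +
         (10 + test_cost (eqE (Reg rCnt) (Lit 1)) + emit_cost d n))))))"

text \<open>Each loop contributes a time that is linear in the number of its iterations.\<close>

lemma join_cost_le: "join_cost d upset n ny k \<le> (n + ny + k + 1) * join_cost d upset 0 0 0"
proof -
  let ?M = "n + ny + k + 1"
  have le: "c \<le> ?M * c" for c
    by simp
  have body: "body_cost n c \<le> ?M * body_cost 0 c" "body_cost ny c \<le> ?M * body_cost 0 c"
    "body_cost k c \<le> ?M * body_cost 0 c" for c
    by (auto simp: body_cost_def intro!: mult_le_mono1)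
  show ?thesis
    unfolding join_cost_def check_cost_def new_cost_def search_cost_def label_cost_def representatives_cost_def
      emit_cost_def distrib_left[of ?M]
    by (intro add_le_mono le body)
qed

context specified_interval
begin

text \<open>After \<open>t\<close> minima, the list \<open>js\<close> contains one index for each label that has occurred, and \<open>aSeen\<close> marks
  these labels.\<close>

definition representatives_state :: "point \<Rightarrow> (nat \<Rightarrow> nat) \<Rightarrow> nat \<Rightarrow> nat list \<Rightarrow> state \<Rightarrow> bool" where
  "representatives_state q L t js s \<longleftrightarrow> reg s rCnt = length js \<and> (\<forall>u < length js. arr s aRep u = js ! u) \<and>
     (\<forall>j \<in> set js. j < t \<and> xs ! j \<in> minima_below Q q) \<and>
     distinct (map (\<lambda>j. label_of d L q (xs ! j)) js) \<and>
     (\<forall>l < d. arr s aSeen l = (if l \<in> (\<lambda>j. label_of d L q (xs ! j)) ` set js then 1 else 0)) \<and>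
     (\<forall>j < t. xs ! j \<in> minima_below Q q \<longrightarrow>
        label_of d L q (xs ! j) \<in> (\<lambda>j. label_of d L q (xs ! j)) ` set js)"

lemma representatives_state_final:
  assumes q: "q \<in> Q" and L: "labels d (link d Q q) L" and s: "representatives_state q L (length xs) js s"
  shows "represents d Q q (map ((!) xs) js)"
proof -
  let ?lab = "label_of d L q"
  have linked: "linked d Q q m m' \<longleftrightarrow> ?lab m = ?lab m'"
    if m: "m \<in> minima_below Q q" "m' \<in> minima_below Q q" for m m'
  proof -
    obtain a b where ab: "a \<in> below d q m" "b \<in> below d q m'"
      using below_ne'[OF q] m by blast
    then show ?thesis
      using linked_iff_label[OF L m ab] label_of_eq[OF L m(1) ab(1)] label_of_eq[OF L m(2) ab(2)] by simp
  qed
  have sub: "set (map ((!) xs) js) \<subseteq> minima_below Q q"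
    using s by (auto simp: representatives_state_def)
  have dist: "distinct (map ?lab (map ((!) xs) js))"
    using s by (simp add: representatives_state_def comp_def)
  have ex: "\<exists>r \<in> set (map ((!) xs) js). ?lab m = ?lab r" if m: "m \<in> minima_below Q q" for m
  proof -
    obtain j where "j < length xs" "xs ! j = m"
      using m xs by (metis (no_types, lifting) in_set_conv_nth mem_Collect_eq minima_below_def)
    then show ?thesis
      using s m by (auto simp: representatives_state_def)
  qed
  have inj: "inj_on ?lab (set (map ((!) xs) js))"
    using dist by (simp only: distinct_map)
  have "\<exists>!r. r \<in> set (map ((!) xs) js) \<and> linked d Q q m r" if m: "m \<in> minima_below Q q" for m
  proof -
    obtain r where r: "r \<in> set (map ((!) xs) js)" "?lab m = ?lab r"
      using ex[OF m] by blast
    show ?thesis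
    proof (rule ex1I[of _ r])
      show "r \<in> set (map ((!) xs) js) \<and> linked d Q q m r"
        using r sub linked[OF m] by blast
    next
      fix r' assume r': "r' \<in> set (map ((!) xs) js) \<and> linked d Q q m r'"
      then have "?lab m = ?lab r'"
        using sub linked[OF m] by blast
      then have "?lab r' = ?lab r"
        using r(2) by (rule subst)
      then show "r' = r"
        by (rule inj_onD[OF inj _ conjunct1[OF r'] r(1)])
    qed
  qed
  moreover have "distinct (map ((!) xs) js)"
    using dist by (simp only: distinct_map[of ?lab])
  ultimately show ?thesis
    using sub by (simp add: represents_def)
qed

lemma effect_new_representative:
  assumes L: "labels d (link d Q q) (arr s aLab)" and s: "representatives_state q (arr s aLab) t js s"
    and t: "reg s rY = t" and m: "xs ! t \<in> minima_below Q q" and c: "reg s rC \<in> below d q (xs ! t)"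
  shows "\<exists>js. representatives_state q (arr s aLab) (Suc t) js (effect new_representative s)"
proof -
  let ?L = "arr s aLab"
  let ?lab = "\<lambda>j. label_of d ?L q (xs ! j)"
  have l: "?L (reg s rC) = ?lab t"
    using label_of_eq[OF L m c] by simp
  have ld: "?lab t < d"
    using l L c by (simp add: labels_def below_def) (metis)
  show ?thesis
  proof (cases "?lab t \<in> ?lab ` set js")
    case True
    then have "effect new_representative s = s"
      using s ld by (simp add: new_representative_def l representatives_state_def)
    then show ?thesis
      using s m True by (intro exI[of _ js]) (auto simp: representatives_state_def less_Suc_eq)
  next
    case False
    then have "representatives_state q ?L (Suc t) (js @ [t]) (effect new_representative s)"
      using s m t ld by (auto simp: new_representative_def l representatives_state_def less_Suc_eq nth_append)
    then show ?thesis ..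
  qed
qed

lemma runs_find_representatives:
  assumes inp: "has_input xs ys s" "has_point d q s" and q: "q \<in> Q" and L: "labels d (link d Q q) (arr s aLab)"
  shows "runs (find_representatives d) s (representatives_cost d (length xs))
    (\<lambda>s'. \<exists>js. set js \<subseteq> {..<length xs} \<and> represents d Q q (map ((!) xs) js) \<and>
       reg s' rCnt = length js \<and> (\<forall>u < length js. arr s' aRep u = js ! u))"
proof -
  let ?L = "arr s aLab"
  let ?init = "write_block d aSeen (Lit 0) (\<lambda>k. Lit 0)"
  let ?step = "Seq (find_difference d) (Cond (Less (Reg rC) (Lit d)) new_representative Skip)"
  let ?c = "Cond (lies_below d) ?step Skip"
  have init: "runs ?init s (max_cost ?init) (\<lambda>s'. \<forall>l<d. arr s' aSeen l = 0)"
  proof (rule runs_effect)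
    have "arr (effect ?init s) aSeen i = (if 0 \<le> i \<and> i < 0 + d then 0 else arr s aSeen i)" for i
      by (rule effect_write_block(2)) auto
    then show "\<forall>l<d. arr (effect ?init s) aSeen l = 0"
      by auto
  qed simp
  have start: "runs (SetReg rCnt (Lit 0)) s1 2 (\<lambda>s'. representatives_state q ?L 0 [] s')"
    if "\<forall>l<d. arr s1 aSeen l = 0" for s1
    using that by (intro runs_SetReg) (auto simp: representatives_state_def)
  have loop: "runs (For rY (Reg 0) ?c) s2 (body_cost (length xs) ?c)
    (\<lambda>s'. \<exists>js. set js \<subseteq> {..<length xs} \<and> represents d Q q (map ((!) xs) js) \<and>
       reg s' rCnt = length js \<and> (\<forall>u < length js. arr s' aRep u = js ! u))"
    if s2: "representatives_state q ?L 0 [] s2" and fr2: "frame {rCnt} {aSeen} s s2" for s2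
  proof (rule runs_For_loop_free[where I = "\<lambda>t s'. \<exists>js. representatives_state q ?L t js s'"])
    fix t s' assume t: "t < length xs" "\<exists>js. representatives_state q ?L t js s'" "reg s' rY = t"
      and fr: "frame (insert rY (regs_of ?c)) (arrs_of ?c) s2 s'"
    obtain js where js: "representatives_state q ?L t js s'"
      using t by blast
    have inp': "has_input xs ys s'" "has_point d q s'" and L': "arr s' aLab = ?L"
      using inp has_input_cong[of xs ys s s'] has_point_cong[of d q s s'] frame_reg[OF fr] frame_arr[OF fr]
        frame_reg[OF fr2] frame_arr[OF fr2] by simp_all
    have test: "test_val (lies_below d) s' \<longleftrightarrow> xs ! t \<preceq> q"
      using test_val_lies_below[OF inp' xs_length] t by simp
    let ?s = "effect (find_difference d) s'"
    have fr3: "frame {rC} {} s' ?s"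
      using effect_frame[of "find_difference d" s'] by simp
    have js': "representatives_state q ?L t js ?s"
      using js fr3 by (simp add: representatives_state_def frame_def)
    have diff: "if below d q (xs ! t) = {} then reg ?s rC = d else reg ?s rC \<in> below d q (xs ! t)"
      using effect_find_difference[OF inp' xs_length, unfolded t(3), OF t(1)] .
    have xt: "xs ! t \<in> minima Q"
      using nth_mem[OF t(1)] xs(2) by simp
    show "\<exists>js. representatives_state q ?L (Suc t) js (set_reg rY (Suc t) (effect ?c s'))"
    proof (cases "xs ! t \<in> minima_below Q q")
      case True
      then have le: "xs ! t \<preceq> q" and ne: "below d q (xs ! t) \<noteq> {}"
        using below_ne'[OF q True] by (auto simp: minima_below_def)
      then have c: "reg ?s rC \<in> below d q (xs ! t)"
        using diff by simp
      then have cd: "reg ?s rC < d"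
        by (simp add: below_def)
      obtain js'' where "representatives_state q ?L (Suc t) js'' (effect new_representative ?s)"
        using effect_new_representative[of q ?s t js] fr3 L js' t(3) True c L' by (auto simp: frame_def)
      then show ?thesis
        using test le cd by (auto simp: representatives_state_def)
    next
      case False
      then have "xs ! t \<preceq> q \<Longrightarrow> xs ! t = q"
        using xt by (auto simp: minima_below_def)
      then have "xs ! t \<preceq> q \<Longrightarrow> reg ?s rC = d"
        using diff by (auto simp: below_def)
      then have "effect ?c s' = (if xs ! t \<preceq> q then ?s else s')"
        using test by simp
      then show ?thesis
        using False js js' by (intro exI[of _ js]) (auto simp: representatives_state_def less_Suc_eq)
    qed
  next
    show "reg s2 0 = length xs"
      using inp fr2 by (simp add: has_input_def frame_def)
  next
    fix s' assume "\<exists>js. representatives_state q ?L (length xs) js s'"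
    then obtain js where js: "representatives_state q ?L (length xs) js s'" by blast
    show "\<exists>js. set js \<subseteq> {..<length xs} \<and> represents d Q q (map ((!) xs) js) \<and>
       reg s' rCnt = length js \<and> (\<forall>u < length js. arr s' aRep u = js ! u)"
      using js representatives_state_final[OF q L js]
      by (intro exI[of _ js]) (auto simp: representatives_state_def)
  next
    fix s' assume "s' = set_reg rY 0 s2"
    then show "\<exists>js. representatives_state q ?L 0 js s'"
      using s2 by (intro exI[of _ "[]"]) (auto simp: representatives_state_def)
  qed auto
  show ?thesis
    unfolding find_representatives_def representatives_cost_def
  proof (rule runs_Seq[OF init runs_Seq[OF start]])
    fix s1 s2 assume "frame (regs_of ?init) (arrs_of ?init) s s1"
      "frame (regs_of (SetReg rCnt (Lit 0))) (arrs_of (SetReg rCnt (Lit 0))) s1 s2"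
      "representatives_state q ?L 0 [] s2"
    then show "runs (For rY (Reg 0) ?c) s2 (body_cost (length xs) ?c)
      (\<lambda>s'. \<exists>js. set js \<subseteq> {..<length xs} \<and> represents d Q q (map ((!) xs) js) \<and>
         reg s' rCnt = length js \<and> (\<forall>u < length js. arr s' aRep u = js ! u))"
      by (intro loop) (auto simp: frame_def)
  qed
qed

lemma runs_emit_all:
  assumes inp: "has_input xs ys s" "has_point d q s" and out: "has_output d ol s"
    and js: "set js \<subseteq> {..<length xs}" "reg s rCnt = length js" "\<forall>u < length js. arr s aRep u = js ! u"
  shows "runs (emit_all d) s (emit_cost d (length js)) (has_output d (ol @ [(q, map ((!) xs) js)]))"
proof -
  let ?c = "emit_relation d (Read aRep (Reg rY))"
  have init: "runs (emit_point d) s (max_cost (emit_point d)) (has_output d (ol @ [(q, [])]))"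
    using effect_emit_point[OF out inp(2)] by (intro runs_effect) auto
  have loop: "runs (For rY (Reg rCnt) ?c) s1 (body_cost (length js) ?c) (has_output d (ol @ [(q, map ((!) xs) js)]))"
    if s1: "has_output d (ol @ [(q, [])]) s1" and fr1: "frame (regs_of (emit_point d)) (arrs_of (emit_point d)) s s1" for s1
  proof (rule runs_For_loop_free[where I = "\<lambda>u. has_output d (ol @ [(q, map ((!) xs) (take u js))])"])
    fix u s' assume u: "u < length js" "has_output d (ol @ [(q, map ((!) xs) (take u js))]) s'" "reg s' rY = u"
      and fr: "frame (insert rY (regs_of ?c)) (arrs_of ?c) s1 s'"
    have inp': "has_input xs ys s'" "has_point d q s'"
      using inp has_input_cong[of xs ys s s'] has_point_cong[of d q s s'] frame_reg[OF fr] frame_arr[OF fr]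
        frame_reg[OF fr1] frame_arr[OF fr1] by simp_all
    have ju: "js ! u < length xs"
      using js(1) nth_mem[OF u(1)] by auto
    have rep: "arr s' aRep u = js ! u"
      using js(3) u(1) frame_arr[OF fr] frame_arr[OF fr1] by simp
    have "has_output d (ol @ [(q, map ((!) xs) (take u js) @ [xs ! (js ! u)])]) (effect ?c s')"
      using effect_emit_relation[OF u(2) inp'(2,1) xs_length, of "Read aRep (Reg rY)" "js ! u", OF _ ju] u rep
      by (auto simp: frame_def)
    then show "has_output d (ol @ [(q, map ((!) xs) (take (Suc u) js))]) (set_reg rY (Suc u) (effect ?c s'))"
      using u(1) has_output_cong[of d _ "effect ?c s'"] by (simp add: take_Suc_conv_app_nth)
  next
    show "has_output d (ol @ [(q, map ((!) xs) (take 0 js))]) s'" if "s' = set_reg rY 0 s1" for s'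
      using s1 that has_output_cong[of d _ s1 s'] by simp
    show "reg s1 rCnt = length js"
      using js(2) frame_reg[OF fr1] by simp
  qed auto
  show ?thesis
    unfolding emit_all_def emit_cost_def by (rule runs_Seq[OF init loop])
qed

text \<open>The representatives are computed only for points of \<open>Q\<close> that are not in the output yet; their number
  decides whether the point is written.\<close>

lemma runs_examine_join:
  assumes inp: "has_input xs ys s" and out: "has_output d ol s" and ol: "scaffold_list ol"
    and ab: "reg s rA < length xs" "reg s rB < length xs"
  defines "q \<equiv> join (xs ! reg s rA) (xs ! reg s rB)"
  shows "runs (examine_join d upset) s (join_cost d upset (length xs) (length ys) (length ol))
    (\<lambda>s'. \<exists>ol'. has_output d ol' s' \<and> scaffold_list ol' \<and>
       set (map fst ol') = set (map fst ol) \<union> ({q} \<inter> initial_points Q))"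
    (is "runs _ _ _ ?P")
proof -
  have len: "length (xs ! reg s rA) = d" "length (xs ! reg s rB) = d"
    using ab xs_length by auto
  have mem: "q \<in> Q \<longleftrightarrow> member_by upset (set ys) q"
    using member[of "xs ! reg s rA" q] ab xs minima_in len nth_mem[OF ab(1)]
    by (auto simp: q_def pt_le_iff)
  have 1: "runs (write_join d) s (max_cost (write_join d)) (has_point d q)"
    using effect_write_join[OF inp xs_length ab] by (intro runs_effect) (auto simp: q_def)
  show ?thesis
    unfolding examine_join_def join_cost_def
  proof (rule runs_Seq[OF 1])
    fix s1 assume q1: "has_point d q s1" and fr: "frame (regs_of (write_join d)) (arrs_of (write_join d)) s s1"
    have inp1: "has_input xs ys s1" and out1: "has_output d ol s1"
      using has_input_cong[OF inp] has_output_cong[OF out] frame_reg[OF fr] frame_arr[OF fr] by simp_all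
    let ?rest = "Cond (Conj (eqE (Reg rOk) (Lit 1)) (eqE (Reg rDup) (Lit 0)))
       (Seq (label_coordinates d) (Seq (find_representatives d)
         (Cond (eqE (Reg rCnt) (Lit 1)) Skip (emit_all d)))) Skip"
    let ?cost = "10 + test_cost (Conj (eqE (Reg rOk) (Lit 1)) (eqE (Reg rDup) (Lit 0))) +
       (label_cost d (length xs) + (representatives_cost d (length xs) +
         (10 + test_cost (eqE (Reg rCnt) (Lit 1)) + emit_cost d (length xs))))"
    show "runs (Seq (check_member d upset) (Seq (check_new d) ?rest)) s1
      (check_cost d upset (length ys) + (new_cost d (length ol) + ?cost)) ?P"
    proof (rule runs_Seq[OF runs_check_member[OF inp1 ys q1]])
      fix s2 assume ok: "reg s2 rOk = (if member_by upset (set ys) q then 1 else 0)"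
        and fr2: "frame (regs_of (check_member d upset)) (arrs_of (check_member d upset)) s1 s2"
      have inp2: "has_input xs ys s2" "has_point d q s2" and out2: "has_output d ol s2"
        using has_input_cong[OF inp1] has_point_cong[OF q1] has_output_cong[OF out1]
          frame_reg[OF fr2] frame_arr[OF fr2] by simp_all
      show "runs (Seq (check_new d) ?rest) s2 (new_cost d (length ol) + ?cost) ?P"
      proof (rule runs_Seq[OF runs_check_new[OF out2 inp2(2)]])
        fix s3 assume new: "reg s3 rDup = (if q \<in> set (map fst ol) then 1 else 0)"
          and fr3: "frame (regs_of (check_new d)) (arrs_of (check_new d)) s2 s3"
        have inp3: "has_input xs ys s3" "has_point d q s3" and out3: "has_output d ol s3"
          and ok3: "reg s3 rOk = (if member_by upset (set ys) q then 1 else 0)"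
          using has_input_cong[OF inp2(1)] has_point_cong[OF inp2(2)] has_output_cong[OF out2] ok
            frame_reg[OF fr3] frame_arr[OF fr3] by simp_all
        have "runs ?rest s3 (1 + test_cost (Conj (eqE (Reg rOk) (Lit 1)) (eqE (Reg rDup) (Lit 0))) +
           (label_cost d (length xs) + (representatives_cost d (length xs) +
             (1 + test_cost (eqE (Reg rCnt) (Lit 1)) + 1 + emit_cost d (length xs)))) + 1) ?P"
        proof (rule runs_Cond)
          assume "test_val (Conj (eqE (Reg rOk) (Lit 1)) (eqE (Reg rDup) (Lit 0))) s3"
          then have "reg s3 rOk = 1" "reg s3 rDup = 0"
            by simp_all
          then have "member_by upset (set ys) q" and notin: "q \<notin> set (map fst ol)"
            using ok3 new by (metis zero_neq_one)+
          then have q: "q \<in> Q"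
            using mem by blast
          show "runs (Seq (label_coordinates d) (Seq (find_representatives d) (Cond (eqE (Reg rCnt) (Lit 1)) Skip (emit_all d)))) s3
            (label_cost d (length xs) + (representatives_cost d (length xs) +
               (1 + test_cost (eqE (Reg rCnt) (Lit 1)) + 1 + emit_cost d (length xs)))) ?P"
          proof (rule runs_Seq[OF runs_label_coordinates[OF inp3 q]])
            fix s4 assume L: "labels d (link d Q q) (arr s4 aLab)"
              and fr4: "frame (regs_of (label_coordinates d)) (arrs_of (label_coordinates d)) s3 s4"
            have inp4: "has_input xs ys s4" "has_point d q s4" and out4: "has_output d ol s4"
              using has_input_cong[OF inp3(1)] has_point_cong[OF inp3(2)] has_output_cong[OF out3]
                frame_reg[OF fr4] frame_arr[OF fr4] by simp_all
            show "runs (Seq (find_representatives d) (Cond (eqE (Reg rCnt) (Lit 1)) Skip (emit_all d))) s4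
              (representatives_cost d (length xs) + (1 + test_cost (eqE (Reg rCnt) (Lit 1)) + 1 + emit_cost d (length xs))) ?P"
            proof (rule runs_Seq[OF runs_find_representatives[OF inp4 q L]])
              fix s5 assume "\<exists>js. set js \<subseteq> {..<length xs} \<and> represents d Q q (map ((!) xs) js) \<and>
                 reg s5 rCnt = length js \<and> (\<forall>u < length js. arr s5 aRep u = js ! u)"
                and fr5: "frame (regs_of (find_representatives d)) (arrs_of (find_representatives d)) s4 s5"
              then obtain js where js: "set js \<subseteq> {..<length xs}" "represents d Q q (map ((!) xs) js)"
                 "reg s5 rCnt = length js" "\<forall>u < length js. arr s5 aRep u = js ! u"
                by blast
              have inp5: "has_input xs ys s5" "has_point d q s5" and out5: "has_output d ol s5"
                using has_input_cong[OF inp4(1)] has_point_cong[OF inp4(2)] has_output_cong[OF out4]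
                  frame_reg[OF fr5] frame_arr[OF fr5] by simp_all
              have init: "q \<in> initial_points Q \<longleftrightarrow> length js \<noteq> 1"
                using initial_iff_representatives[OF q js(2)] by simp
              show "runs (Cond (eqE (Reg rCnt) (Lit 1)) Skip (emit_all d)) s5
                (1 + test_cost (eqE (Reg rCnt) (Lit 1)) + 1 + emit_cost d (length xs)) ?P"
              proof (rule runs_Cond)
                assume "test_val (eqE (Reg rCnt) (Lit 1)) s5"
                then have "set (map fst ol) = set (map fst ol) \<union> ({q} \<inter> initial_points Q)"
                  using init js(3) by auto
                then show "runs Skip s5 1 ?P"
                  using runs_effect[of Skip ?P s5] out5 ol by (auto intro!: exI[of _ ol])
              next
                assume "\<not> test_val (eqE (Reg rCnt) (Lit 1)) s5"
                then have I: "q \<in> initial_points Q"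
                  using init js(3) by auto
                have "distinct js"
                  using js(2) by (auto simp: represents_def distinct_map)
                then have "length js \<le> length xs"
                  using js(1) card_mono[of "{..<length xs}" "set js"] distinct_card[of js] by simp
                then have "emit_cost d (length js) \<le> emit_cost d (length xs)"
                  by (simp add: emit_cost_def body_cost_def)
                moreover have "scaffold_list (ol @ [(q, map ((!) xs) js)])"
                  using ol notin js(2) by (auto simp: scaffold_list_def)
                ultimately show "runs (emit_all d) s5 (emit_cost d (length xs)) ?P"
                  using I by (intro runs_mono[OF runs_emit_all[OF inp5 out5 js(1,3,4)]])
                    (auto intro!: exI[of _ "ol @ [(q, map ((!) xs) js)]"])
              qed
            qed
          qed
        next
          assume "\<not> test_val (Conj (eqE (Reg rOk) (Lit 1)) (eqE (Reg rDup) (Lit 0))) s3"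
          then have "reg s3 rOk \<noteq> 1 \<or> reg s3 rDup \<noteq> 0"
            by simp
          then have "\<not> member_by upset (set ys) q \<or> q \<in> set (map fst ol)"
            using ok3 new by metis
          then have "q \<in> Q \<Longrightarrow> q \<in> set (map fst ol)"
            using mem by blast
          then have "set (map fst ol) = set (map fst ol) \<union> ({q} \<inter> initial_points Q)"
            by (auto simp: initial_points_def)
          then show "runs Skip s3 1 ?P"
            using runs_effect[of Skip ?P s3] out3 ol by (auto intro!: exI[of _ ol])
        qed
        then show "runs ?rest s3 ?cost ?P"
          by (rule runs_mono) auto
      qed
    qed
  qed
qed

definition progress :: "(nat \<times> nat) set \<Rightarrow> state \<Rightarrow> bool" where
  "progress I s \<longleftrightarrow> has_input xs ys s \<and> (\<exists>ol. has_output d ol s \<and> scaffold_list ol \<and>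
     set (map fst ol) = (\<lambda>(a, b). join (xs ! a) (xs ! b)) ` I \<inter> initial_points Q)"

lemma progress_cong:
  assumes "progress I s" "\<And>r. r < 4 \<Longrightarrow> reg s' r = reg s r" "\<And>a. a < 4 \<Longrightarrow> arr s' a = arr s a"
  shows "progress I s'"
proof -
  have "has_input xs ys s'"
    using assms has_input_cong[of xs ys s s'] by (simp add: progress_def)
  moreover have "has_output d ol s'" if "has_output d ol s" for ol
    using has_output_cong[OF that] assms(2,3) by simp
  ultimately show ?thesis
    using assms(1) unfolding progress_def by blast
qed

text \<open>The output contains each join at most once, so it has at most \<open>n\<^sup>2\<close> elements and searching it for
  a repetition takes quadratic time.\<close>

lemma runs_all_joins:
  "runs (all_joins d upset) (input_state xs ys)
     ((length xs + length ys + 1) ^ 4 * (join_cost d upset 0 0 0 + 16))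
     (\<lambda>s. \<exists>ol. has_output d ol s \<and> scaffold_list ol \<and> set (map fst ol) = initial_points Q)"
proof -
  let ?n = "length xs" and ?ny = "length ys" and ?c = "examine_join d upset"
  let ?s0 = "input_state xs ys"
  define m where "m = ?n + ?ny + 1"
  define J where "J = join_cost d upset 0 0 0"
  have body: "runs ?c s (m ^ 2 * J) (progress (insert (a, b) I))"
    if s: "progress I s" and ab: "reg s rA = a" "reg s rB = b" "a < ?n" "b < ?n"
      and I: "I \<subseteq> {..<?n} \<times> {..<?n}" for s a b I
  proof -
    from s obtain ol where inp: "has_input xs ys s" and out: "has_output d ol s" "scaffold_list ol"
      and set: "set (map fst ol) = (\<lambda>(a, b). join (xs ! a) (xs ! b)) ` I \<inter> initial_points Q"
      unfolding progress_def by blast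
    have "length ol = card (set (map fst ol))"
      using out(2) distinct_card[of "map fst ol"] by (simp add: scaffold_list_def)
    also have "\<dots> \<le> card ((\<lambda>(a, b). join (xs ! a) (xs ! b)) ` ({..<?n} \<times> {..<?n}))"
      unfolding set using I by (intro card_mono) auto
    also have "\<dots> \<le> card ({..<?n} \<times> {..<?n})"
      by (rule card_image_le) auto
    also have "\<dots> = ?n ^ 2"
      by (simp add: card_cartesian_product power2_eq_square)
    finally have "?n + ?ny + length ol + 1 \<le> m ^ 2"
      by (auto simp: m_def power2_eq_square algebra_simps)
    then have cost: "join_cost d upset ?n ?ny (length ol) \<le> m ^ 2 * J"
      using join_cost_le[of d upset ?n ?ny "length ol"] unfolding J_def
      by (meson le_trans mult_le_mono1)
    have "runs ?c s (join_cost d upset ?n ?ny (length ol)) (progress (insert (a, b) I))"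
    proof (rule runs_frame[OF runs_examine_join[OF inp out(1,2), unfolded ab, OF ab(3,4)]])
      fix s' assume fr: "frame (regs_of ?c) (arrs_of ?c) s s'"
        and "\<exists>ol'. has_output d ol' s' \<and> scaffold_list ol' \<and>
          set (map fst ol') = set (map fst ol) \<union> ({join (xs ! a) (xs ! b)} \<inter> initial_points Q)"
      then obtain ol' where ol': "has_output d ol' s'" "scaffold_list ol'"
        "set (map fst ol') = set (map fst ol) \<union> ({join (xs ! a) (xs ! b)} \<inter> initial_points Q)"
        by blast
      have "has_input xs ys s'"
        using has_input_cong[OF inp] frame_reg[OF fr] frame_arr[OF fr] by (simp add: examine_join_def)
      moreover have "set (map fst ol') = (\<lambda>(a, b). join (xs ! a) (xs ! b)) ` insert (a, b) I \<inter> initial_points Q"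
        unfolding ol'(3) set by auto
      ultimately show "progress (insert (a, b) I) s'"
        unfolding progress_def using ol'(1,2) by blast
    qed
    then show ?thesis
      using cost by (rule runs_mono)
  qed
  have set_r: "progress I (set_reg r v s)" if "progress I s" "r \<ge> 4" for I r v s
    using that by (intro progress_cong[OF that(1)]) auto
  have inner: "runs (For rB (Reg 0) ?c) s ((?n + 1) * (m ^ 2 * J + exp_cost (Reg 0) + 7))
      (progress ({..<Suc a} \<times> {..<?n}))"
    if s: "progress ({..<a} \<times> {..<?n}) s" and a: "reg s rA = a" "a < ?n" for s a
  proof (rule runs_For[where I = "\<lambda>b. progress ({..<a} \<times> {..<?n} \<union> {a} \<times> {..<b})"])
    fix b s' assume b: "b < ?n" "progress ({..<a} \<times> {..<?n} \<union> {a} \<times> {..<b}) s'" "reg s' rB = b"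
      and fr: "frame (insert rB (regs_of ?c)) (arrs_of ?c) s s'"
    have "reg s' rA = a"
      using a frame_reg[OF fr] by (simp add: examine_join_def)
    then have "runs ?c s' (m ^ 2 * J) (progress (insert (a, b) ({..<a} \<times> {..<?n} \<union> {a} \<times> {..<b})))"
      using a b by (intro body) auto
    moreover have "insert (a, b) ({..<a} \<times> {..<?n} \<union> {a} \<times> {..<b}) = {..<a} \<times> {..<?n} \<union> {a} \<times> {..<Suc b}"
      by auto
    ultimately show "runs ?c s' (m ^ 2 * J)
      (\<lambda>s''. progress ({..<a} \<times> {..<?n} \<union> {a} \<times> {..<Suc b}) (set_reg rB (Suc b) s''))"
      using set_r by (auto intro: runs_mono)
  next
    have "reg s 0 = ?n"
      using s by (simp add: progress_def has_input_def)
    then show "exp_val (Reg 0) s' = ?n" if "frame (insert rB (regs_of ?c)) (arrs_of ?c) s s'" for s'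
      using frame_reg[OF that, of 0] by (simp add: examine_join_def)
  next
    fix s' assume "progress ({..<a} \<times> {..<?n} \<union> {a} \<times> {..<?n}) s'"
    moreover have "{..<a} \<times> {..<?n} \<union> {a} \<times> {..<?n} = {..<Suc a} \<times> {..<?n}"
      by auto
    ultimately show "progress ({..<Suc a} \<times> {..<?n}) s'"
      by simp
  qed (use s set_r in \<open>auto simp: examine_join_def\<close>)
  have "runs (all_joins d upset) ?s0
    ((?n + 1) * ((?n + 1) * (m ^ 2 * J + exp_cost (Reg 0) + 7) + exp_cost (Reg 0) + 7))
    (\<lambda>s. \<exists>ol. has_output d ol s \<and> scaffold_list ol \<and> set (map fst ol) = initial_points Q)"
    unfolding all_joins_def
  proof (rule runs_For[where I = "\<lambda>a. progress ({..<a} \<times> {..<?n})"])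
    fix a s' assume "a < ?n" "progress ({..<a} \<times> {..<?n}) s'" "reg s' rA = a"
    then show "runs (For rB (Reg 0) ?c) s' ((?n + 1) * (m ^ 2 * J + exp_cost (Reg 0) + 7))
      (\<lambda>s''. progress ({..<Suc a} \<times> {..<?n}) (set_reg rA (Suc a) s''))"
      using set_r by (intro runs_mono[OF inner]) auto
  next
    show "exp_val (Reg 0) s' = ?n"
      if "frame (insert rA (regs_of (For rB (Reg 0) ?c))) (arrs_of (For rB (Reg 0) ?c)) ?s0 s'" for s'
      using frame_reg[OF that, of 0] by (simp add: examine_join_def input_state_def)
  next
    have "progress ({..<0} \<times> {..<?n}) ?s0"
      unfolding progress_def using has_input_input_state has_output_input_state
      by (intro conjI exI[of _ "[]"]) (auto simp: scaffold_list_def)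
    then show "progress ({..<0} \<times> {..<?n}) s'" if "s' = set_reg rA 0 ?s0" for s'
      using set_r that by simp
  next
    fix s' assume "progress ({..<?n} \<times> {..<?n}) s'"
    moreover have "initial_points Q \<subseteq> (\<lambda>(a, b). join (xs ! a) (xs ! b)) ` ({..<?n} \<times> {..<?n})"
    proof
      fix q assume "q \<in> initial_points Q"
      then obtain p p' where p: "p \<in> set xs" "p' \<in> set xs" "q = join p p'"
        using initial_point_join xs(2) by blast
      then obtain a b where "a < ?n" "b < ?n" "p = xs ! a" "p' = xs ! b"
        by (metis in_set_conv_nth)
      then show "q \<in> (\<lambda>(a, b). join (xs ! a) (xs ! b)) ` ({..<?n} \<times> {..<?n})"
        using p(3) by force
    qed
    ultimately show "\<exists>ol. has_output d ol s' \<and> scaffold_list ol \<and> set (map fst ol) = initial_points Q"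
      unfolding progress_def by blast
  qed (auto simp: examine_join_def)
  moreover have "(?n + 1) * ((?n + 1) * (m ^ 2 * J + exp_cost (Reg 0) + 7) + exp_cost (Reg 0) + 7) \<le> m ^ 4 * (J + 16)"
  proof -
    have "?n + 1 \<le> m"
      by (simp add: m_def)
    note nm = this
    define X where "X = (?n + 1) * (m ^ 2 * J + exp_cost (Reg 0) + 7)"
    have "X \<le> m * (m ^ 2 * J + 8)"
      unfolding X_def by (rule mult_le_mono[OF nm]) simp
    then have "(?n + 1) * (X + exp_cost (Reg 0) + 7) \<le> m * (m * (m ^ 2 * J + 8) + 8)"
      by (intro mult_le_mono[OF nm]) simp
    also have "\<dots> = m ^ 4 * J + 8 * m ^ 2 + 8 * m"
      by (simp add: power2_eq_square power4_eq_xxxx algebra_simps)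
    also have "\<dots> \<le> m ^ 4 * J + 8 * m ^ 4 + 8 * m ^ 4"
      using power_increasing[of 2 4 m] power_increasing[of 1 4 m] by (simp add: m_def)
    finally show ?thesis
      unfolding X_def by (simp only: distrib_left)
  qed
  ultimately show ?thesis
    unfolding m_def[symmetric] J_def[symmetric] by (rule runs_mono)
qed

end


section \<open>The scaffold in at most three dimensions\<close>

text \<open>Points with two coordinates are treated as points with three, the last of which is zero.\<close>

definition co :: "point \<Rightarrow> nat \<Rightarrow> nat" where
  "co p k = (if k < length p then p ! k else 0)"

locale small_interval = nat_interval +
  assumes dim: "d \<le> 3"
begin

lemma pt_le_co:
  assumes "length p = d" "length q = d"
  shows "p \<preceq> q \<longleftrightarrow> (\<forall>k<3. co p k \<le> co q k)"
  using assms dim by (auto simp: pt_le_iff co_def)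

lemma pt_eq_co:
  assumes "length p = d" "length q = d"
  shows "p = q \<longleftrightarrow> (\<forall>k<3. co p k = co q k)"
  using assms dim by (auto simp: list_eq_iff_nth_eq co_def)

lemma below_co:
  assumes "length p = d" "length q = d"
  shows "below d q p = {k. k < 3 \<and> co p k < co q k}"
  using assms dim by (auto simp: below_def co_def)

text \<open>The direction \<open>c\<close> forms a component of \<open>dn(q)\<close> by itself.\<close>

definition single :: "nat \<Rightarrow> point \<Rightarrow> bool" where
  "single c q \<longleftrightarrow> (\<exists>m \<in> minima_below Q q. below d q m = {c}) \<and>
     (\<forall>m \<in> minima_below Q q. c \<in> below d q m \<longrightarrow> below d q m = {c}) \<and>
     (\<exists>m \<in> minima_below Q q. c \<notin> below d q m)"

text \<open>If several directions are components by themselves, the least one is responsible for \<open>q\<close>; this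
  avoids repetitions in the output.\<close>

definition owns :: "nat \<Rightarrow> point \<Rightarrow> point \<Rightarrow> bool" where
  "owns c x q \<longleftrightarrow> q \<in> Q \<and> x \<in> minima_below Q q \<and> below d q x = {c} \<and> single c q \<and> (\<forall>c' < c. \<not> single c' q)"

definition good_entries :: "nat \<Rightarrow> point \<Rightarrow> (point \<times> point list) list \<Rightarrow> bool" where
  "good_entries c x es \<longleftrightarrow> distinct (map fst es) \<and> set (map fst es) = {q. owns c x q} \<and>
     (\<forall>(q, rl) \<in> set es. represents d Q q rl)"

text \<open>The classes of two unlinked minima are disjoint subsets of a set of at most three coordinates, so
  one of them has a single element.\<close>

lemma single_exists:
  assumes "m \<in> minima_below Q q" "m' \<in> minima_below Q q" "\<not> linked d Q q m m'" "q \<in> Q"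
  shows "\<exists>c < 3. single c q"
proof -
  define C where "C m = {b. \<exists>a \<in> below d q m. (a, b) \<in> (link d Q q)\<^sup>*}" for m
  have sub3: "C m \<subseteq> {..<3}" for m
  proof
    fix b assume "b \<in> C m"
    then obtain a where a: "a \<in> below d q m" "(a, b) \<in> (link d Q q)\<^sup>*"
      by (auto simp: C_def)
    from a(2) have "b = a \<or> b < d"
      by (cases rule: rtranclE) (auto simp: link_def below_def)
    then show "b \<in> {..<3}"
      using a(1) dim by (auto simp: below_def)
  qed
  have T: "below d q m \<subseteq> C m" for m
    by (auto simp: C_def)
  have closed: "below d q m' \<subseteq> C m" if "m' \<in> minima_below Q q" "c \<in> C m" "c \<in> below d q m'" for m m' c
  proof
    fix b assume b: "b \<in> below d q m'"
    then have "(c, b) \<in> link d Q q"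
      using that by (auto simp: link_def)
    then show "b \<in> C m"
      using that(2) by (auto simp: C_def intro: rtrancl_into_rtrancl)
  qed
  have sym: "sym ((link d Q q)\<^sup>*)"
    by (rule sym_rtrancl) (auto simp: sym_def link_def)
  have disj: "C m \<inter> C m' = {}"
  proof (rule ccontr)
    assume "C m \<inter> C m' \<noteq> {}"
    then obtain a a' b where "a \<in> below d q m" "(a, b) \<in> (link d Q q)\<^sup>*" "a' \<in> below d q m'" "(a', b) \<in> (link d Q q)\<^sup>*"
      by (auto simp: C_def)
    then have "linked d Q q m m'"
      using symD[OF sym] unfolding linked_def by (meson rtrancl_trans)
    then show False using assms by blast
  qed
  have ne: "C m \<noteq> {}" "C m' \<noteq> {}"
    using T below_ne' assms by blast+
  have fin: "finite (C m)" "finite (C m')"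
    using sub3 finite_subset by blast+
  have "card (C m) + card (C m') = card (C m \<union> C m')"
    using disj fin by (simp add: card_Un_disjoint)
  also have "\<dots> \<le> 3"
    using sub3 card_mono[of "{..<3}" "C m \<union> C m'"] by simp
  finally have card: "card (C m) = 1 \<or> card (C m') = 1"
    using ne fin card_0_eq[of "C m"] card_0_eq[of "C m'"] by linarith
  have single: "\<exists>c < 3. single c q"
    if p: "p \<in> minima_below Q q" "p' \<in> minima_below Q q" "C p \<inter> C p' = {}" "card (C p) = 1" for p p'
  proof -
    obtain c where c: "C p = {c}"
      using p(4) by (auto simp: card_1_singleton_iff)
    have "below d q p = {c}"
      using T[of p] below_ne'[OF assms(4) p(1)] c by auto
    moreover have "c \<notin> below d q p'"
      using T[of p'] p(3) c by auto
    moreover have "below d q m = {c}" if "m \<in> minima_below Q q" "c \<in> below d q m" for m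
    proof -
      have "below d q m \<subseteq> {c}"
        using closed[of m c p] that c by simp
      then show ?thesis
        using that(2) by blast
    qed
    ultimately have "single c q"
      unfolding single_def using p(1,2) by blast
    moreover have "c < 3"
      using sub3[of p] c by auto
    ultimately show ?thesis by blast
  qed
  show ?thesis
    using card single[of m m'] single[of m' m] assms disj by blast
qed

lemma owner_exists:
  assumes "q \<in> initial_points Q" "q \<notin> minima Q"
  shows "\<exists>c < 3. \<exists>x \<in> minima Q. owns c x q"
proof -
  have q: "q \<in> Q" using assms by (simp add: initial_points_def)
  then have "\<exists>c. c < 3 \<and> single c q"
    using single_exists assms initial_points_iff by blast
  then obtain c where c: "c < 3 \<and> single c q" "\<forall>c' < c. \<not> (c' < 3 \<and> single c' q)"
    using exists_least_iff[of "\<lambda>c. c < 3 \<and> single c q"] by blast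
  then obtain x where "x \<in> minima_below Q q" "below d q x = {c}"
    by (auto simp: single_def)
  then show ?thesis
    using c q by (intro exI[of _ c] conjI bexI[of _ x]) (auto simp: owns_def minima_below_def)
qed

lemma single_closed:
  assumes "single c q" "(k, l) \<in> (link d Q q)\<^sup>*"
  shows "k = c \<longleftrightarrow> l = c"
  using assms(2)
proof (induction rule: rtrancl_induct)
  case (step y z)
  then show ?case
    using assms(1) by (auto simp: link_def single_def)
qed simp

lemma owns_initial: "owns c x q \<Longrightarrow> q \<in> initial_points Q \<and> q \<notin> minima Q"
proof -
  assume o: "owns c x q"
  then obtain m where m: "m \<in> minima_below Q q" "c \<notin> below d q m"
    by (auto simp: owns_def single_def)
  have x: "x \<in> minima_below Q q" "below d q x = {c}"
    using o by (auto simp: owns_def)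
  have "\<not> linked d Q q x m"
  proof
    assume "linked d Q q x m"
    then obtain b where b: "b \<in> below d q m" "(c, b) \<in> (link d Q q)\<^sup>*"
      using x by (auto simp: linked_def)
    from b(2) have "b = c"
    proof (induction rule: rtrancl_induct)
      case (step y z)
      then show ?case
        using o by (auto simp: link_def owns_def single_def)
    qed simp
    then show False using b m by simp
  qed
  then have "q \<in> initial_points Q"
    using initial_points_iff x m o by (auto simp: owns_def)
  moreover have "q \<notin> minima Q"
    using x(1) by (auto simp: minima_below_def minima_def)
  ultimately show ?thesis by blast
qed

text \<open>Two minima that differ from \<open>q\<close> in the same single coordinate are comparable, hence equal.\<close>

lemma owner_unique:
  assumes "owns c x q" "owns c' x' q" "c < 3" "c' < 3"
  shows "c = c'" "x = x'"
proof -
  show c: "c = c'"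
    using assms by (metis linorder_neqE_nat owns_def)
  have x: "x \<in> minima Q" "x' \<in> minima Q"
    using assms by (auto simp: owns_def minima_below_def)
  then have len: "length x = d" "length x' = d" "length q = d"
    using minima_in length_eq assms by (auto simp: owns_def)
  have le: "x \<preceq> q" "x' \<preceq> q"
    using assms by (auto simp: owns_def minima_below_def)
  have eq: "x ! k = x' ! k" if "k < d" "k \<noteq> c" for k
  proof -
    have "k \<notin> below d q x" "k \<notin> below d q x'"
      using assms c that by (auto simp: owns_def)
    then show ?thesis
      using le that len by (auto simp: below_def pt_le_iff) (metis le_antisym not_less)
  qed
  have "x \<preceq> x' \<or> x' \<preceq> x"
  proof (cases "x ! c \<le> x' ! c")
    case True
    then have "x \<preceq> x'"
      using eq len by (auto simp: pt_le_iff) (metis order_refl)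
    then show ?thesis ..
  next
    case False
    then have "x' \<preceq> x"
      using eq len by (auto simp: pt_le_iff) (metis order_refl nat_le_linear)
    then show ?thesis ..
  qed
  then show "x = x'"
    using minima_antichain x minima_in by blast
qed

text \<open>Each element of the scaffold that is not minimal has exactly one owner in exactly one direction, so
  the entries cover these elements without repetition.\<close>

lemma scaffold_list_entries:
  assumes xs: "distinct xs" "set xs = minima Q"
    and good: "\<And>c i. c < 3 \<Longrightarrow> i < length xs \<Longrightarrow> good_entries c (xs ! i) (e c i)"
  defines "ol \<equiv> map (\<lambda>x. (x, [])) xs @ concat (map (\<lambda>c. concat (map (e c) [0..<length xs])) [0..<3])"
  shows "scaffold_list ol" "set (map fst ol) = initial_points Q"
proof -
  let ?n = "length xs"
  have owns: "q \<in> set (map fst (e c i)) \<longleftrightarrow> owns c (xs ! i) q" if "c < 3" "i < ?n" for c i q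
    using good[OF that] by (auto simp: good_entries_def)
  have dist_e: "distinct (map fst (e c i))" if "c < 3" "i < ?n" for c i
    using good[OF that] by (auto simp: good_entries_def)
  have dist_c: "distinct (map fst (concat (map (e c) [0..<m])))" if c: "c < 3" and "m \<le> ?n" for c m
    using that(2)
  proof (induction m)
    case (Suc m)
    have "q \<notin> set (map fst (e c m))" if "i < m" "q \<in> set (map fst (e c i))" for i q
    proof
      assume "q \<in> set (map fst (e c m))"
      then have "owns c (xs ! m) q" "owns c (xs ! i) q"
        using owns c that Suc.prems by auto
      then have "xs ! m = xs ! i"
        using owner_unique c by blast
      then show False
        using xs(1) that Suc.prems by (simp add: nth_eq_iff_index_eq)
    qed
    then show ?case
      using Suc dist_e[OF c, of m] by (auto simp: image_iff) (metis fst_conv image_eqI list.set_map)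
  qed simp
  have in_c: "q \<in> set (map fst (concat (map (e c) [0..<?n]))) \<longleftrightarrow> (\<exists>i<?n. owns c (xs ! i) q)" if "c < 3" for c q
  proof -
    have "q \<in> set (map fst (concat (map (e c) [0..<?n]))) \<longleftrightarrow> (\<exists>i<?n. q \<in> set (map fst (e c i)))"
      by (auto simp: image_iff)
    also have "\<dots> \<longleftrightarrow> (\<exists>i<?n. owns c (xs ! i) q)"
      using owns[OF that] by blast
    finally show ?thesis .
  qed
  have dist_all: "distinct (map fst (concat (map (\<lambda>c. concat (map (e c) [0..<?n])) [0..<m])))" if "m \<le> 3" for m
    using that
  proof (induction m)
    case (Suc m)
    let ?E = "\<lambda>c. concat (map (e c) [0..<?n])"
    have "q \<notin> set (map fst (?E m))" if cm: "c < m" and qc: "q \<in> set (map fst (?E c))" for c q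
    proof
      assume "q \<in> set (map fst (?E m))"
      moreover have "m < 3" "c < 3"
        using Suc.prems cm by auto
      ultimately obtain i j where "owns m (xs ! i) q" "owns c (xs ! j) q"
        using in_c[of m q] in_c[of c q] qc by blast
      then have "m = c"
        using owner_unique(1) \<open>m < 3\<close> \<open>c < 3\<close> by blast
      then show False
        using cm by simp
    qed
    moreover have "set (concat (map ?E [0..<m])) = (\<Union>c<m. set (?E c))"
      by auto
    then have "set (map fst (concat (map ?E [0..<m]))) = (\<Union>c<m. set (map fst (?E c)))"
      by (simp only: set_map image_UN)
    ultimately have "set (map fst (concat (map ?E [0..<m]))) \<inter> set (map fst (?E m)) = {}"
      by auto
    moreover have "concat (map ?E [0..<Suc m]) = concat (map ?E [0..<m]) @ ?E m"
      by simp
    ultimately show ?case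
      using Suc dist_c[of m ?n] by (simp only: map_append distinct_append)
  qed simp
  have in_all: "q \<in> set (map fst (concat (map (\<lambda>c. concat (map (e c) [0..<?n])) [0..<3]))) \<longleftrightarrow>
    (\<exists>c<3. \<exists>i<?n. owns c (xs ! i) q)" for q
  proof -
    have "q \<in> set (map fst (concat (map (\<lambda>c. concat (map (e c) [0..<?n])) [0..<3]))) \<longleftrightarrow>
      (\<exists>c<3. q \<in> set (map fst (concat (map (e c) [0..<?n]))))"
    proof -
      have "set (concat (map (\<lambda>c. concat (map (e c) [0..<?n])) [0..<3])) =
          (\<Union>c<3. set (concat (map (e c) [0..<?n])))"
        by auto
      then show ?thesis
        unfolding set_map by blast
    qed
    then show ?thesis using in_c by blast
  qed
  have xs': "map fst (map (\<lambda>x. (x, [])) xs) = xs"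
    by (simp add: comp_def)
  have "set xs \<inter> set (map fst (concat (map (\<lambda>c. concat (map (e c) [0..<?n])) [0..<3]))) = {}"
    using in_all owns_initial xs by blast
  then have dist: "distinct (map fst ol)"
    unfolding ol_def map_append xs' distinct_append using xs(1) dist_all[of 3] by blast
  have "represents d Q q rl" if "(q, rl) \<in> set ol" for q rl
  proof -
    consider "q \<in> minima Q" "rl = []" | c i where "c < 3" "i < ?n" "(q, rl) \<in> set (e c i)"
      using \<open>(q, rl) \<in> set ol\<close> xs by (auto simp: ol_def)
    then show ?thesis
    proof cases
      case 1
      then have "minima_below Q q = {}"
        using minima_antichain minima_in by (auto simp: minima_below_def)
      then show ?thesis
        using 1 by (simp add: represents_def)
    next
      case 2
      then show ?thesis
        using good[OF 2(1,2)] by (auto simp: good_entries_def)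
    qed
  qed
  then show "scaffold_list ol"
    using dist by (auto simp: scaffold_list_def)
  have "set (map fst ol) = set xs \<union> {q. \<exists>c<3. \<exists>i<?n. owns c (xs ! i) q}"
    unfolding ol_def map_append xs' set_append using in_all by blast
  also have "\<dots> = initial_points Q"
  proof -
    have "q \<in> initial_points Q" if "q \<in> set xs" for q
      using that xs minima_initial by blast
    moreover have "\<exists>c<3. \<exists>i<?n. owns c (xs ! i) q" if "q \<in> initial_points Q" "q \<notin> set xs" for q
      using owner_exists[OF that(1)] that(2) xs(2) by (metis in_set_conv_nth)
    ultimately show ?thesis
      using owns_initial by blast
  qed
  finally show "set (map fst ol) = initial_points Q" .
qed

text \<open>The tie-break in direction \<open>b\<close> reveals whether some minimum at the lowest level is smaller in both
  directions: if there is one, then \<open>r\<close> is such.\<close>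

definition nearest :: "nat \<Rightarrow> nat \<Rightarrow> nat \<Rightarrow> nat \<Rightarrow> point \<Rightarrow> point \<Rightarrow> nat \<Rightarrow> bool" where
  "nearest cap a b c x r z \<longleftrightarrow>
     (let S = {y \<in> minima Q. co y a < co x a \<and> co y b \<le> co x b} in
       (S = {} \<and> z = cap) \<or>
       (r \<in> S \<and> z = co r c \<and> z < cap \<and>
         (\<forall>y \<in> S. co r c < co y c \<or> co r c = co y c \<and> co r b \<le> co y b)))"

definition raised :: "nat \<Rightarrow> point \<Rightarrow> nat \<Rightarrow> point" where
  "raised c x z = map (\<lambda>k. if k = c then z else x ! k) [0..<d]"

end

text \<open>A minimum \<open>x\<close>, the direction \<open>c\<close> in which it is raised, and the answers to two queries, one for each
  of the other directions. The number \<open>cap\<close> is larger than all coordinates and signals that nothing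
  was found.\<close>

locale direction = small_interval +
  fixes cap a b c :: nat and x r1 r2 :: point and z1 z2 :: nat
  assumes abc: "{a, b, c} = {0, 1, 2}"
    and x: "x \<in> minima Q"
    and near1: "nearest cap a b c x r1 z1"
    and near2: "nearest cap b a c x r2 z2"
begin

definition "z = min z1 z2"

definition "q = raised c x z"

lemma abc_distinct: "a \<noteq> b" "a \<noteq> c" "b \<noteq> c"
proof -
  have "card {a, b, c} = 3"
    unfolding abc by simp
  then show "a \<noteq> b" "a \<noteq> c" "b \<noteq> c"
    by (auto simp: card_insert_if split: if_splits)
qed

lemma less3: "k < 3 \<longleftrightarrow> k = a \<or> k = b \<or> k = c"
proof -
  have "k < 3 \<longleftrightarrow> k \<in> {0, 1, 2}"
    by auto
  then show ?thesis
    unfolding abc[symmetric] by auto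
qed

lemma len: "y \<in> minima Q \<Longrightarrow> length y = d"
  using minima_in length_eq by blast

text \<open>The minima form an antichain, so what is not larger than \<open>x\<close> in two directions is higher in the
  third one.\<close>

lemma higher:
  assumes "y \<in> minima Q" "co y a \<le> co x a" "co y b \<le> co x b" "y \<noteq> x"
  shows "co x c < co y c" "co y a < co x a \<or> co y b < co x b"
proof -
  have "\<not> y \<preceq> x" "\<not> x \<preceq> y"
    using minima_antichain assms x minima_in by blast+
  then show "co x c < co y c" "co y a < co x a \<or> co y b < co x b"
    using assms len[OF assms(1)] len[OF x] by (auto simp: pt_le_co less3)
qed

lemma z_le1: "y \<in> minima Q \<Longrightarrow> co y a < co x a \<Longrightarrow> co y b \<le> co x b \<Longrightarrow> z1 \<le> co y c"
  using near1 by (fastforce simp: nearest_def Let_def)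

lemma z_le2: "y \<in> minima Q \<Longrightarrow> co y b < co x b \<Longrightarrow> co y a \<le> co x a \<Longrightarrow> z2 \<le> co y c"
  using near2 by (fastforce simp: nearest_def Let_def)

lemma r1: "z1 < cap \<Longrightarrow> r1 \<in> minima Q \<and> co r1 a < co x a \<and> co r1 b \<le> co x b \<and> co r1 c = z1"
  using near1 by (auto simp: nearest_def Let_def)

lemma r2: "z2 < cap \<Longrightarrow> r2 \<in> minima Q \<and> co r2 b < co x b \<and> co r2 a \<le> co x a \<and> co r2 c = z2"
  using near2 by (auto simp: nearest_def Let_def)

lemma r1_least: "z1 < cap \<Longrightarrow> y \<in> minima Q \<Longrightarrow> co y a < co x a \<Longrightarrow> co y b \<le> co x b \<Longrightarrow> co y c = z1 \<Longrightarrow>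
    co r1 b \<le> co y b"
  using near1 by (fastforce simp: nearest_def Let_def)

lemma r2_least: "z2 < cap \<Longrightarrow> y \<in> minima Q \<Longrightarrow> co y b < co x b \<Longrightarrow> co y a \<le> co x a \<Longrightarrow> co y c = z2 \<Longrightarrow>
    co r2 a \<le> co y a"
  using near2 by (fastforce simp: nearest_def Let_def)

lemma z_le: "y \<in> minima Q \<Longrightarrow> co y a \<le> co x a \<Longrightarrow> co y b \<le> co x b \<Longrightarrow> y \<noteq> x \<Longrightarrow> z \<le> co y c"
  using higher(2)[of y] z_le1[of y] z_le2[of y] unfolding z_def by linarith

definition r :: point where
  "r = (if z1 \<le> z2 then r1 else r2)"

lemma r:
  assumes "z < cap"
  shows "r \<in> minima Q" "co r a \<le> co x a" "co r b \<le> co x b" "co r c = z" "r \<noteq> x" "co x c < z"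
proof -
  have *: "r \<in> minima Q \<and> co r a \<le> co x a \<and> co r b \<le> co x b \<and> co r c = z \<and> r \<noteq> x"
    using assms r1 r2 by (auto simp: r_def z_def min_def split: if_splits)
  then show "r \<in> minima Q" "co r a \<le> co x a" "co r b \<le> co x b" "co r c = z" "r \<noteq> x"
    by auto
  then show "co x c < z"
    using higher(1)[of r] by simp
qed

lemma length_q: "length q = d"
  by (simp add: q_def raised_def)

lemma co_q:
  assumes "z < cap" "k < 3"
  shows "co q k = (if k = c then z else co x k)"
proof -
  have "c < d"
    using r[OF assms(1)] len[of r] by (auto simp: co_def split: if_splits)
  then show ?thesis
    using len[OF x] by (auto simp: q_def raised_def co_def)
qed

text \<open>The level \<open>z\<close> is the first one at which a minimum is met, so all minima below \<open>q\<close> other than \<open>x\<close> have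
  the height of \<open>q\<close> in direction \<open>c\<close>.\<close>

lemma minima_below_q:
  assumes "z < cap"
  shows "minima_below Q q = insert x {y \<in> minima Q. co y a \<le> co x a \<and> co y b \<le> co x b \<and> co y c = z}"
proof -
  have q: "co q a = co x a" "co q b = co x b" "co q c = z"
    using co_q[OF assms] abc_distinct less3 by auto
  have le: "y \<preceq> q \<longleftrightarrow> co y a \<le> co x a \<and> co y b \<le> co x b \<and> co y c \<le> z" if "y \<in> minima Q" for y
    using pt_le_co[OF len[OF that] length_q] q by (auto simp: less3)
  have ne: "y \<noteq> q" if "y \<in> minima Q" "co y a \<le> co x a" "co y b \<le> co x b" for y
  proof
    assume y: "y = q"
    then have "co y c = z"
      using q by simp
    then have "y \<noteq> x"
      using r(6)[OF assms] by auto
    then have "co y a < co x a \<or> co y b < co x b"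
      using higher(2) that by blast
    then show False
      using q y by simp
  qed
  have z: "co y c = z" if "y \<in> minima Q" "co y a \<le> co x a" "co y b \<le> co x b" "co y c \<le> z" "y \<noteq> x" for y
    using z_le[of y] that by simp
  have "x \<preceq> q" "x \<noteq> q"
    using le[OF x] ne[OF x] r(6)[OF assms] by simp_all
  then have "y \<in> minima_below Q q \<longleftrightarrow>
      y = x \<or> y \<in> minima Q \<and> co y a \<le> co x a \<and> co y b \<le> co x b \<and> co y c = z" for y
    unfolding minima_below_def mem_Collect_eq using le[of y] ne[of y] z[of y] x by auto
  then show ?thesis
    by blast
qed

lemma below_q:
  assumes "z < cap"
  shows "below d q x = {c}" "y \<in> minima Q \<Longrightarrow> co y c = z \<Longrightarrow> below d q y = {k \<in> {a, b}. co y k < co x k}"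
proof -
  have q: "co q a = co x a" "co q b = co x b" "co q c = z"
    using co_q[OF assms] abc_distinct less3 by auto
  show "below d q x = {c}"
  proof (rule set_eqI)
    fix k
    show "k \<in> below d q x \<longleftrightarrow> k \<in> {c}"
      unfolding below_co[OF len[OF x] length_q] mem_Collect_eq less3
      using q r(6)[OF assms] by (cases "k = c"; cases "k = a"; cases "k = b") simp_all
  qed
  show "below d q y = {k \<in> {a, b}. co y k < co x k}" if "y \<in> minima Q" "co y c = z"
  proof (rule set_eqI)
    fix k
    show "k \<in> below d q y \<longleftrightarrow> k \<in> {k \<in> {a, b}. co y k < co x k}"
      unfolding below_co[OF len[OF that(1)] length_q] mem_Collect_eq less3
      using q that(2) abc_distinct by (cases "k = c"; cases "k = a"; cases "k = b") simp_all
  qed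
qed

lemma others:
  assumes "z < cap" "m \<in> minima_below Q q" "m \<noteq> x"
  shows "m \<in> minima Q" "co m a \<le> co x a" "co m b \<le> co x b" "co m c = z"
    "below d q m = {k \<in> {a, b}. co m k < co x k}"
    "co m a < co x a \<or> co m b < co x b"
  using assms minima_below_q[OF assms(1)] below_q(2)[OF assms(1)] higher(2)[of m] by auto

lemma single_c:
  assumes z: "z < cap"
  shows "single c q"
proof -
  have c: "c \<notin> below d q m" if "m \<in> minima_below Q q" "m \<noteq> x" for m
    using others(5)[OF z that] abc_distinct by auto
  have "x \<in> minima_below Q q" "below d q x = {c}" "r \<in> minima_below Q q" "r \<noteq> x"
    using minima_below_q[OF z] below_q(1)[OF z] r[OF z] by blast+
  with c show ?thesis
    unfolding single_def by metis
qed

text \<open>At its level, \<open>r1\<close> is smallest in direction \<open>b\<close> among the minima that differ from \<open>q\<close> in direction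
  \<open>a\<close>; so if it agrees with \<open>q\<close> in direction \<open>b\<close>, then so do the others.\<close>

lemma single_a:
  assumes z: "z < cap"
  shows "single a q \<longleftrightarrow> z1 = z \<and> co r1 b = co x b"
proof
  assume a: "single a q"
  then obtain m where m: "m \<in> minima_below Q q" "below d q m = {a}"
    by (auto simp: single_def)
  then have "m \<noteq> x"
    using below_q(1)[OF z] abc_distinct by auto
  note o = others[OF z m(1) this]
  have "co m a < co x a"
    using m(2) o(5) by auto
  then have z1: "z1 = z"
    using z_le1[OF o(1)] o z_def by simp
  then have r1': "r1 \<in> minima Q" "co r1 a < co x a" "co r1 b \<le> co x b" "co r1 c = z"
    using r1 z by auto
  then have "r1 \<in> minima_below Q q"
    using minima_below_q[OF z] by simp
  moreover have b: "below d q r1 = {k \<in> {a, b}. co r1 k < co x k}"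
    using below_q(2)[OF z] r1' by blast
  ultimately have "below d q r1 = {a}"
    using a r1'(2) by (auto simp: single_def)
  then show "z1 = z \<and> co r1 b = co x b"
    using z1 b r1'(3) abc_distinct by auto
next
  assume e: "z1 = z \<and> co r1 b = co x b"
  then have r1': "r1 \<in> minima Q" "co r1 a < co x a" "co r1 b = co x b" "co r1 c = z"
    using r1 z by auto
  then have in1: "r1 \<in> minima_below Q q"
    using minima_below_q[OF z] by simp
  have b1: "below d q r1 = {a}"
    using below_q(2)[OF z r1'(1,4)] r1' by auto
  have "below d q m = {a}" if m: "m \<in> minima_below Q q" "a \<in> below d q m" for m
  proof -
    have "m \<noteq> x"
      using m(2) below_q(1)[OF z] abc_distinct by auto
    note o = others[OF z m(1) this]
    have "co r1 b \<le> co m b"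
      using r1_least[of m] o m(2) z e by auto
    then show ?thesis
      using o(5) m(2) e by auto
  qed
  moreover have "x \<in> minima_below Q q" "a \<notin> below d q x"
    using minima_below_q[OF z] below_q(1)[OF z] abc_distinct by auto
  ultimately show "single a q"
    using in1 b1 unfolding single_def by blast
qed

lemma swap: "direction d Q cap b a c x r2 r1 z2 z1"
proof
  show "{b, a, c} = {0, 1, 2}"
    using abc by (simp add: insert_commute)
qed (fact x near2 near1)+

lemma single_b:
  assumes "z < cap"
  shows "single b q \<longleftrightarrow> z2 = z \<and> co r2 a = co x a"
proof -
  have "direction.z z2 z1 = z" "direction.q d c x z2 z1 = q"
    using direction.z_def[OF swap] direction.q_def[OF swap]
    by (simp_all add: z_def q_def min.commute)
  then show ?thesis
    using direction.single_a[OF swap] assms by simp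
qed

lemma owns_iff:
  assumes z: "z < cap"
  shows "owns c x q \<longleftrightarrow> q \<in> Q \<and> \<not> (a < c \<and> z1 = z \<and> co r1 b = co x b) \<and> \<not> (b < c \<and> z2 = z \<and> co r2 a = co x a)"
proof -
  have "c < 3"
    using less3 by blast
  then have "(\<forall>c'<c. \<not> single c' q) \<longleftrightarrow> \<not> (a < c \<and> single a q) \<and> \<not> (b < c \<and> single b q)"
    using less3 by (metis less_trans nat_neq_iff)
  moreover have "x \<in> minima_below Q q"
    using minima_below_q[OF z] by simp
  ultimately show ?thesis
    using single_c[OF z] below_q(1)[OF z] single_a[OF z] single_b[OF z] by (simp add: owns_def)
qed

text \<open>Raising \<open>x\<close> in direction \<open>c\<close> beyond \<open>z\<close> would put a minimum below the point that differs from it in \<open>c\<close>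
  and in another direction, so \<open>c\<close> would no longer be a component by itself.\<close>

lemma owns_imp:
  assumes o: "owns c x q'"
  shows "z < cap \<and> q' = q"
proof -
  have q': "q' \<in> Q" "x \<in> minima_below Q q'" "below d q' x = {c}" "single c q'"
    using o by (auto simp: owns_def)
  then obtain m where m: "m \<in> minima_below Q q'" "c \<notin> below d q' m"
    unfolding single_def by blast
  have lq: "length q' = d"
    using q' length_eq by blast
  have le: "co y k \<le> co q' k" if "y \<in> minima_below Q q'" "k < 3" for y k
    using that len[of y] pt_le_co[of y q'] lq by (auto simp: minima_below_def)
  have b: "below d q' y = {k. k < 3 \<and> co y k < co q' k}" if "y \<in> minima_below Q q'" for y
    using that len[of y] below_co[of y q'] lq by (auto simp: minima_below_def)
  have xq: "co q' a = co x a" "co q' b = co x b" "co x c < co q' c"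
  proof -
    have "a \<notin> below d q' x" "b \<notin> below d q' x" "c \<in> below d q' x"
      using q'(3) abc_distinct by auto
    then show "co q' a = co x a" "co q' b = co x b" "co x c < co q' c"
      using b[OF q'(2)] le[OF q'(2)] less3 by (auto simp: not_less intro: antisym)
  qed
  have m': "m \<in> minima Q" "co m a \<le> co x a" "co m b \<le> co x b" "co m c = co q' c" "m \<noteq> x"
  proof -
    have abc3: "a < 3" "b < 3" "c < 3"
      using less3 by blast+
    show "m \<in> minima Q"
      using m(1) by (simp add: minima_below_def)
    show "co m a \<le> co x a" "co m b \<le> co x b"
      using le[OF m(1) abc3(1)] le[OF m(1) abc3(2)] xq by simp_all
    show "co m c = co q' c"
      using le[OF m(1) abc3(3)] m(2) b[OF m(1)] abc3 by simp
    then show "m \<noteq> x"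
      using xq(3) by auto
  qed
  have z: "z < cap"
  proof -
    have "co m a < co x a \<or> co m b < co x b"
      using higher(2) m' by blast
    then have "z1 < cap \<or> z2 < cap"
      using near1 near2 m' by (auto simp: nearest_def Let_def)
    then show ?thesis by (auto simp: z_def)
  qed
  have zle: "z \<le> co q' c"
    using z_le[of m] m' by simp
  have "z = co q' c"
  proof (rule ccontr)
    assume "z \<noteq> co q' c"
    then have zl: "co r c < co q' c"
      using zle r(4)[OF z] by simp
    have "r \<preceq> q'"
      using r[OF z] zl xq len lq by (auto simp: pt_le_co less3)
    then have rb: "r \<in> minima_below Q q'"
      using r[OF z] zl by (auto simp: minima_below_def)
    then have "c \<in> below d q' r"
      using b zl less3 by auto
    then have "below d q' r = {c}"
      using q'(4) rb by (auto simp: single_def)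
    then have "\<not> co r a < co q' a" "\<not> co r b < co q' b"
      using b[OF rb] less3 abc_distinct by auto
    then show False
      using higher(2)[of r] r[OF z] xq by auto
  qed
  then have "q' = q"
    using co_q[OF z] xq abc_distinct lq length_q by (auto simp: pt_eq_co less3)
  then show ?thesis using z by blast
qed

text \<open>The nearest minimum in the respective direction has the height of \<open>q\<close>.\<close>

definition "near_a \<longleftrightarrow> z1 = z"

definition "near_b \<longleftrightarrow> z2 = z"

definition reps :: "point list" where
  "reps = [x] @ (if near_a then [r1] else []) @ (if near_b \<and> co r2 a = co x a then [r2] else [])"

lemma in_reps: "p \<in> set reps \<longleftrightarrow> p = x \<or> near_a \<and> p = r1 \<or> near_b \<and> co r2 a = co x a \<and> p = r2"
  unfolding reps_def by (cases near_a; cases near_b; cases "co r2 a = co x a"; simp)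

text \<open>Suppose that the nearest minimum in direction \<open>a\<close> has the height of \<open>q\<close> and differs from \<open>q\<close> in
  direction \<open>b\<close> as well; then these two directions form one component, which contains all minima
  other than \<open>x\<close>. Otherwise no minimum differs from \<open>q\<close> in both, since ties were broken in favour of
  small coordinates in direction \<open>b\<close>; then the directions are separate, and in each of them the
  nearest minimum represents a component if it has the height of \<open>q\<close>.\<close>

lemma represents_reps:
  assumes z: "z < cap" and q: "q \<in> Q"
  shows "represents d Q q reps"
proof -
  have xin: "x \<in> minima_below Q q" and bx: "below d q x = {c}"
    using minima_below_q[OF z] below_q(1)[OF z] by auto
  have r1': "r1 \<in> minima_below Q q \<and> r1 \<noteq> x \<and> co r1 a < co x a" if "near_a"
    using r1 z that minima_below_q[OF z] by (auto simp: near_a_def)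
  have r2': "r2 \<in> minima_below Q q \<and> r2 \<noteq> x \<and> co r2 b < co x b" if "near_b"
    using r2 z that minima_below_q[OF z] by (auto simp: near_b_def)
  have dist: "distinct reps"
  proof -
    have 1: "near_a \<Longrightarrow> co r2 a = co x a \<Longrightarrow> r1 \<noteq> r2"
      using r1' by fastforce
    have 2: "near_a \<Longrightarrow> x \<noteq> r1"
      using r1' by fastforce
    have 3: "near_b \<Longrightarrow> x \<noteq> r2"
      using r2' by fastforce
    show ?thesis
      unfolding reps_def using 1 2 3 by (cases near_a; cases near_b; cases "co r2 a = co x a"; simp)
  qed
  have sub: "set reps \<subseteq> minima_below Q q"
  proof
    fix p assume "p \<in> set reps"
    then consider "p = x" | "near_a" "p = r1" | "near_b" "p = r2"
      unfolding in_reps by blast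
    then show "p \<in> minima_below Q q"
    proof cases
      case 1
      then show ?thesis using xin by simp
    next
      case 2
      then show ?thesis using conjunct1[OF r1'] by simp
    next
      case 3
      then show ?thesis using conjunct1[OF r2'] by simp
    qed
  qed
  have xx: "linked d Q q x x"
    using bx by (auto simp: linked_def)
  have xo: "\<not> linked d Q q x m \<and> \<not> linked d Q q m x" if "m \<in> minima_below Q q" "m \<noteq> x" for m
  proof -
    have "c \<notin> below d q m"
      using others(5)[OF z that] abc_distinct by auto
    then show ?thesis
      using bx single_closed[OF single_c[OF z]] unfolding linked_def by (metis singletonD)
  qed
  have "\<exists>!p. p \<in> set reps \<and> linked d Q q m p" if m: "m \<in> minima_below Q q" for m
  proof (cases "m = x")
    case True
    then show ?thesis
      using xx xo[of r1] xo[of r2] r1' r2' unfolding in_reps by metis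
  next
    case False
    note o = others[OF z m False]
    show ?thesis
    proof (cases "near_a \<and> co r1 b < co x b")
      case True
      then have "near_b \<Longrightarrow> co r2 a \<le> co r1 a"
        using r2_least[of r1] r1 z by (auto simp: near_a_def near_b_def)
      then have reps: "reps = [x, r1]"
        using True r1' by (auto simp: reps_def)
      have "r1 \<in> minima_below Q q" "r1 \<noteq> x"
        using r1' True by auto
      then have "below d q r1 = {a, b}"
        using others(5)[OF z] True r1' by auto
      then have "linked d Q q m r1"
        using o(5,6) unfolding linked_def by fastforce
      then show ?thesis
        using xo[OF m False] unfolding reps by (intro ex1I[of _ r1]) auto
    next
      case nonstrict: False
      have single: "\<not> (co y a < co x a \<and> co y b < co x b)" if "y \<in> minima_below Q q" "y \<noteq> x" for y
      proof
        assume y: "co y a < co x a \<and> co y b < co x b"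
        note oy = others[OF z that]
        have "near_a"
          using z_le1[OF oy(1)] y oy by (simp add: z_def near_a_def)
        moreover from this have "co r1 b \<le> co y b"
          using r1_least[of y] y oy z by (auto simp: near_a_def)
        ultimately show False
          using nonstrict y by auto
      qed
      have lid: "link d Q q \<subseteq> Id"
      proof
        fix kl assume "kl \<in> link d Q q"
        then obtain k l y where kl: "kl = (k, l)" "y \<in> minima_below Q q" "k \<in> below d q y" "l \<in> below d q y"
          by (auto simp: link_def)
        then show "kl \<in> Id"
          using bx others(5)[OF z kl(2)] single[OF kl(2)] by (cases "y = x") auto
      qed
      have id: "k = l" if "(k, l) \<in> (link d Q q)\<^sup>*" for k l
        using that lid by (induction rule: rtrancl_induct) auto
      have linked: "linked d Q q m p \<longleftrightarrow> below d q m \<inter> below d q p \<noteq> {}" for p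
        unfolding linked_def using id by blast
      have b1: "below d q r1 = {a}" if "near_a"
        using that others(5)[OF z, of r1] r1' single[of r1] by auto
      have b2: "below d q r2 = {b}" if "near_b"
        using that others(5)[OF z, of r2] r2' single[of r2] by auto
      have r2a: "co r2 a = co x a" if "near_b"
        using that others[OF z, of r2] r2' single[of r2] by auto
      have reps: "reps = [x] @ (if near_a then [r1] else []) @ (if near_b then [r2] else [])"
        using r2a by (simp add: reps_def)
      show ?thesis
      proof (cases "co m a < co x a")
        case True
        then have bm: "below d q m = {a}"
          using o single[OF m False] by auto
        have z1: "near_a"
          using z_le1[OF o(1) True o(3)] o(4) by (simp add: z_def near_a_def near_b_def)
        show ?thesis
          by (rule ex1I[of _ r1])
             (use linked bm bx b1[OF z1] b2 abc_distinct z1 in \<open>auto simp: reps split: if_splits\<close>)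
      next
        case False
        then have less: "co m b < co x b"
          using o(6) by blast
        then have bm: "below d q m = {b}"
          using o False by auto
        have z2: "near_b"
          using z_le2[OF o(1) less o(2)] o(4) by (simp add: z_def near_a_def near_b_def)
        show ?thesis
          by (rule ex1I[of _ r2])
             (use linked bm bx b1 b2[OF z2] abc_distinct z2 in \<open>auto simp: reps split: if_splits\<close>)
      qed
    qed
  qed
  then show ?thesis
    using dist sub by (simp add: represents_def)
qed

lemma good_entries_direction:
  "good_entries c x
    (if z < cap \<and> q \<in> Q \<and> \<not> (a < c \<and> z1 = z \<and> co r1 b = co x b) \<and> \<not> (b < c \<and> z2 = z \<and> co r2 a = co x a)
     then [(q, reps)] else [])"
  using owns_iff owns_imp represents_reps by (auto simp: good_entries_def)

end


section \<open>Dominance queries\<close>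

abbreviation (input) "rSum \<equiv> 14 :: nat"
abbreviation (input) "rBig \<equiv> 15 :: nat"
abbreviation (input) "rT \<equiv> 16 :: nat"
abbreviation (input) "rZ \<equiv> 17 :: nat"
abbreviation (input) "aK1 \<equiv> 4 :: nat"
abbreviation (input) "aK2 \<equiv> 5 :: nat"

definition load :: "exp \<Rightarrow> nat \<Rightarrow> exp \<Rightarrow> exp \<Rightarrow> exp \<Rightarrow> com" where
  "load off l f1 f2 fv = For rT (Reg l) (seqs
     [Write aK1 (Add off (Reg rT)) f1, Write aK2 (Add off (Reg rT)) f2, Write aV (Add off (Reg rT)) fv,
      Write aA (Add off (Reg rT)) (Add off (Reg rT))])"

text \<open>The first sort arranges the items by the first key and, for equal keys, by position. The second
  one sorts by the second key, and its answers refer to the arrangement before it. The item after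
  the last one serves as the dummy.\<close>

definition dominance :: "nat \<Rightarrow> nat \<Rightarrow> exp \<Rightarrow> exp \<Rightarrow> exp \<Rightarrow> exp \<Rightarrow> exp \<Rightarrow> exp \<Rightarrow> nat \<Rightarrow> nat \<Rightarrow> com" where
  "dominance l l' f1 f2 fv g1 g2 gv \<rho> \<zeta> =
     Seq (load (Lit 0) l f1 f2 fv) (Seq (load (Reg l) l' g1 g2 gv)
      (Seq (seqs [SetReg rN (Add (Reg l) (Reg l')), Write aV (Reg rN) (Reg rBig), Write aK2 (Reg rN) (Lit 0)])
       (Seq (msort aK1 \<rho>) (Seq (msort aK2 \<rho>)
         (For rT (Reg rN) (Write \<zeta> (Reg rT) (Read aV (Read \<rho> (Reg rT)))))))))"

lemma regs_of_load [simp]: "regs_of (load off l f1 f2 fv) = {rT}"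
  by (simp add: load_def)

lemma arrs_of_load [simp]: "arrs_of (load off l f1 f2 fv) = {aK1, aK2, aV, aA}"
  by (auto simp: load_def)

lemma regs_of_dominance [simp]:
  "regs_of (dominance l l' f1 f2 fv g1 g2 gv \<rho> \<zeta>) = {rI, rMid, rJ, rHi, rBest, rX, rK, rW, rN, rT}"
  by (auto simp: dominance_def)

lemma arrs_of_dominance [simp]:
  "arrs_of (dominance l l' f1 f2 fv g1 g2 gv \<rho> \<zeta>) = {aK1, aK2, aV, aA, aB, \<rho>, \<zeta>}"
  by (auto simp: dominance_def)

text \<open>An expression whose value, as a function of the register \<open>rT\<close>, is not affected by the
  memory used for answering queries.\<close>

definition stable :: "state \<Rightarrow> nat \<Rightarrow> exp \<Rightarrow> (nat \<Rightarrow> nat) \<Rightarrow> bool" where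
  "stable s n e F \<longleftrightarrow> (\<forall>s'. (\<forall>r. r < 4 \<or> r = rSum \<or> r = rBig \<longrightarrow> reg s' r = reg s r) \<and>
     (\<forall>a < 4. arr s' a = arr s a) \<and> reg s' rT < n \<longrightarrow> exp_val e s' = F (reg s' rT))"

definition load_const :: "exp \<Rightarrow> exp \<Rightarrow> exp \<Rightarrow> exp \<Rightarrow> nat" where
  "load_const off f1 f2 fv = body_cost 0 (seqs
     [Write aK1 (Add off (Reg rT)) f1, Write aK2 (Add off (Reg rT)) f2, Write aV (Add off (Reg rT)) fv,
      Write aA (Add off (Reg rT)) (Add off (Reg rT))])"

lemma body_cost_eq: "body_cost n c = (n + 1) * body_cost 0 c"
  by (simp add: body_cost_def)

lemma runs_load:
  assumes st: "stable s n f1 F1" "stable s n f2 F2" "stable s n fv FV"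
    and l: "l < 4" "reg s l = n" and off: "off = Lit u \<or> (off = Reg v \<and> v < 4 \<and> reg s v = u)"
  shows "runs (load off l f1 f2 fv) s ((n + 1) * load_const off f1 f2 fv) (\<lambda>s'.
    \<forall>j. arr s' aK1 j = (if u \<le> j \<and> j < u + n then F1 (j - u) else arr s aK1 j) \<and>
        arr s' aK2 j = (if u \<le> j \<and> j < u + n then F2 (j - u) else arr s aK2 j) \<and>
        arr s' aV j = (if u \<le> j \<and> j < u + n then FV (j - u) else arr s aV j) \<and>
        arr s' aA j = (if u \<le> j \<and> j < u + n then j else arr s aA j))"
proof -
  let ?c = "seqs [Write aK1 (Add off (Reg rT)) f1, Write aK2 (Add off (Reg rT)) f2, Write aV (Add off (Reg rT)) fv,
      Write aA (Add off (Reg rT)) (Add off (Reg rT))]"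
  define I where "I = (\<lambda>k (s' :: state). \<forall>j. arr s' aK1 j = (if u \<le> j \<and> j < u + k then F1 (j - u) else arr s aK1 j) \<and>
        arr s' aK2 j = (if u \<le> j \<and> j < u + k then F2 (j - u) else arr s aK2 j) \<and>
        arr s' aV j = (if u \<le> j \<and> j < u + k then FV (j - u) else arr s aV j) \<and>
        arr s' aA j = (if u \<le> j \<and> j < u + k then j else arr s aA j))"
  have "runs (load off l f1 f2 fv) s (body_cost n ?c) (I n)"
    unfolding load_def
  proof (rule runs_For_loop_free[where I = I])
    show "I 0 s'" if "s' = set_reg rT 0 s" for s'
      using that by (simp add: I_def)
  next
    fix k s' assume k: "k < n" "I k s'" "reg s' rT = k"
      and fr: "frame (insert rT (regs_of ?c)) (arrs_of ?c) s s'"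
    define g where "g s'' \<longleftrightarrow> frame {} {aK1, aK2, aV, aA} s' s''" for s''
    have val: "exp_val f1 s'' = F1 k" "exp_val f2 s'' = F2 k" "exp_val fv s'' = FV k" "exp_val off s'' = u" if "g s''" for s''
    proof -
      have 1: "reg s'' r = reg s r" if "r < 4 \<or> r = rSum \<or> r = rBig" for r
        using that \<open>g s''\<close> frame_reg[OF fr, of r] by (auto simp: g_def frame_def)
      have 2: "arr s'' a = arr s a" if "a < 4" for a
        using that \<open>g s''\<close> frame_arr[OF fr, of a] by (auto simp: g_def frame_def)
      have 3: "reg s'' rT = k"
        using \<open>g s''\<close> k by (auto simp: g_def frame_def)
      show "exp_val f1 s'' = F1 k" "exp_val f2 s'' = F2 k" "exp_val fv s'' = FV k"
        using st 1 2 3 k(1) unfolding stable_def by metis+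
      show "exp_val off s'' = u"
        using off 1 by auto
    qed
    have "g s'" "g (set_cell aK1 i w s')" "g (set_cell aK2 i2 w2 (set_cell aK1 i w s'))"
      "g (set_cell aV i3 w3 (set_cell aK2 i2 w2 (set_cell aK1 i w s')))" for i w i2 w2 i3 w3
      by (auto simp: g_def frame_def)
    then have "effect ?c s' = set_cell aA (u + k) (u + k) (set_cell aV (u + k) (FV k)
        (set_cell aK2 (u + k) (F2 k) (set_cell aK1 (u + k) (F1 k) s')))"
      using k val by simp
    then show "I (Suc k) (set_reg rT (Suc k) (effect ?c s'))"
      using k(2) by (auto simp: I_def)
  qed (use l in auto)
  then show ?thesis
    by (simp only: body_cost_eq[of n] load_const_def I_def)
qed

definition dominance_const :: "nat \<Rightarrow> exp \<Rightarrow> exp \<Rightarrow> exp \<Rightarrow> exp \<Rightarrow> exp \<Rightarrow> exp \<Rightarrow> nat \<Rightarrow> nat \<Rightarrow> nat" where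
  "dominance_const l f1 f2 fv g1 g2 gv \<rho> \<zeta> =
     load_const (Lit 0) f1 f2 fv + (load_const (Reg l) g1 g2 gv + (20 +
       (3 * pass_const aK1 \<rho> + (3 * pass_const aK2 \<rho> +
         body_cost 0 (Write \<zeta> (Reg rT) (Read aV (Read \<rho> (Reg rT))))))))"

text \<open>What comes before \<open>p\<close> after the first sort, restricted to second keys that are at most as large.\<close>

definition dominated :: "nat \<Rightarrow> (nat \<Rightarrow> nat) \<Rightarrow> (nat \<Rightarrow> nat) \<Rightarrow> nat \<Rightarrow> nat set" where
  "dominated N k1 k2 p = {y. y < N \<and> (k1 y < k1 p \<or> k1 y = k1 p \<and> y < p) \<and> k2 y \<le> k2 p}"

lemma by_key_asym: "by_key k (<) x y \<Longrightarrow> \<not> by_key k (<) y x"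
  by (auto simp: by_key_def)

lemma runs_dominance:
  assumes st: "stable s na f1 F1" "stable s na f2 F2" "stable s na fv FV"
    "stable s nb g1 G1" "stable s nb g2 G2" "stable s nb gv GV"
    and l: "l < 4" "reg s l = na" "l' < 4" "reg s l' = nb"
    and M: "na + nb + 1 \<le> M" "M \<le> 2 ^ L"
    and ne: "\<rho> \<notin> {aK1, aK2, aV, aA, aB}" "\<zeta> \<notin> {aK1, aK2, aV, aA, aB, \<rho>}"
  defines "N \<equiv> na + nb"
  defines "k1 \<equiv> \<lambda>p. if p < na then F1 p else G1 (p - na)"
  defines "k2 \<equiv> \<lambda>p. if p < na then F2 p else if p < N then G2 (p - na) else 0"
  defines "v \<equiv> \<lambda>p. if p < na then FV p else if p < N then GV (p - na) else reg s rBig"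
  shows "runs (dominance l l' f1 f2 fv g1 g2 gv \<rho> \<zeta>) s
    ((L + 2) * (M * dominance_const l f1 f2 fv g1 g2 gv \<rho> \<zeta>))
    (\<lambda>s'. \<forall>p < N. best_in (\<lambda>y. (v y, k2 y)) (insert N (dominated N k1 k2 p)) (arr s' \<rho> p) \<and>
        arr s' \<zeta> p = v (arr s' \<rho> p))"
    (is "runs _ _ _ ?P")
proof -
  let ?load1 = "load (Lit 0) l f1 f2 fv" and ?load2 = "load (Reg l) l' g1 g2 gv"
  let ?set = "seqs [SetReg rN (Add (Reg l) (Reg l')), Write aV (Reg rN) (Reg rBig), Write aK2 (Reg rN) (Lit 0)]"
  let ?read = "Write \<zeta> (Reg rT) (Read aV (Read \<rho> (Reg rT)))"
  have stable: "stable s1 n e F" if "stable s n e F" "frame {rT} {aK1, aK2, aV, aA} s s1" for n e F s1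
    using that by (simp add: stable_def frame_def)
  \<comment> \<open>The memory with the first part loaded, with both parts loaded, and with the dummy in place.\<close>
  define Q1 where "Q1 s1 \<longleftrightarrow> (\<forall>j < na. arr s1 aK1 j = F1 j \<and> arr s1 aK2 j = F2 j \<and> arr s1 aV j = FV j \<and> arr s1 aA j = j)" for s1 :: state
  define Q2 where "Q2 s1 \<longleftrightarrow> (\<forall>j < N. arr s1 aK1 j = k1 j \<and> arr s1 aK2 j = k2 j \<and> arr s1 aV j = v j \<and> arr s1 aA j = j)" for s1 :: state
  define Q3 where "Q3 s1 \<longleftrightarrow> reg s1 rN = N \<and> (\<forall>j < N. arr s1 aK1 j = k1 j) \<and>
    (\<forall>j \<le> N. arr s1 aK2 j = k2 j \<and> arr s1 aV j = v j)" for s1 :: state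
  have 1: "runs ?load1 s ((na + 1) * load_const (Lit 0) f1 f2 fv) Q1"
    by (rule runs_mono[OF runs_load[OF st(1,2,3) l(1,2), of "Lit 0" 0]]) (auto simp: Q1_def)
  have 2: "runs ?load2 s1 ((nb + 1) * load_const (Reg l) g1 g2 gv) Q2"
    if Q: "Q1 s1" and fr: "frame (regs_of ?load1) (arrs_of ?load1) s s1" for s1
  proof (rule runs_mono[OF runs_load[of s1 nb g1 G1 g2 G2 gv GV l' "Reg l" na l]])
    show "stable s1 nb g1 G1" "stable s1 nb g2 G2" "stable s1 nb gv GV"
      using stable st fr by auto
    show "reg s1 l' = nb" "Reg l = Lit na \<or> Reg l = Reg l \<and> l < 4 \<and> reg s1 l = na"
      using l fr by (auto simp: frame_def)
    fix s2 :: state assume "\<forall>j. arr s2 aK1 j = (if na \<le> j \<and> j < na + nb then G1 (j - na) else arr s1 aK1 j) \<and>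
      arr s2 aK2 j = (if na \<le> j \<and> j < na + nb then G2 (j - na) else arr s1 aK2 j) \<and>
      arr s2 aV j = (if na \<le> j \<and> j < na + nb then GV (j - na) else arr s1 aV j) \<and>
      arr s2 aA j = (if na \<le> j \<and> j < na + nb then j else arr s1 aA j)"
    then show "Q2 s2"
      using Q by (auto simp: Q1_def Q2_def N_def k1_def k2_def v_def)
  qed (use l in auto)
  have 3: "runs ?set s2 20 (\<lambda>s3. Q3 s3 \<and> seg (arr s3 aA) 0 N = [0..<N])"
    if Q: "Q2 s2" and "frame (regs_of ?load1) (arrs_of ?load1) s s1"
      "frame (regs_of ?load2) (arrs_of ?load2) s1 s2" for s1 s2
  proof (rule runs_mono[OF runs_effect[OF _ refl]])
    have r: "reg s2 l = na" "reg s2 l' = nb" "reg s2 rBig = reg s rBig"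
      using that(2,3) l by (auto simp: frame_def)
    have "seg (arr s2 aA) 0 N = seg (\<lambda>j. j) 0 N"
      using Q by (intro seg_cong) (auto simp: Q2_def)
    then have A: "seg (arr s2 aA) 0 N = [0..<N]"
      by (simp add: seg_def)
    fix s3 assume "s3 = effect ?set s2"
    then show "Q3 s3 \<and> seg (arr s3 aA) 0 N = [0..<N]"
      using Q r A by (auto simp: Q3_def Q2_def N_def k1_def k2_def v_def)
  qed (use l in auto)
  have N: "N \<le> 2 ^ L"
    using M by (simp add: N_def)
  have 4: "runs (msort aK1 \<rho>) s3 ((L + 2) * ((N + 1) * (3 * pass_const aK1 \<rho>)))
      (sorted_state aK1 \<rho> (<) N [0..<N])"
    if "Q3 s3 \<and> seg (arr s3 aA) 0 N = [0..<N]" for s3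
  proof -
    have rN: "reg s3 rN = N" using that by (simp add: Q3_def)
    have "set [0..<N] \<subseteq> {..<N}"
      by auto
    then show ?thesis
      using runs_msort[of s3 L aK1 \<rho> "[0..<N]" "(<)"] that N ne unfolding rN by auto
  qed
  have 5: "runs (msort aK2 \<rho>) s4 ((L + 2) * ((N + 1) * (3 * pass_const aK2 \<rho>)))
      (\<lambda>s5. Q3 s5 \<and> (\<forall>p < N. best_in (\<lambda>y. (v y, k2 y)) (insert N (dominated N k1 k2 p)) (arr s5 \<rho> p)))"
    if Q: "Q3 s3 \<and> seg (arr s3 aA) 0 N = [0..<N]" and so: "sorted_state aK1 \<rho> (<) N [0..<N] s4"
      and fr: "frame (regs_of (msort aK1 \<rho>)) (arrs_of (msort aK1 \<rho>)) s3 s4" for s3 s4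
  proof -
    have Q4: "Q3 s4"
      using Q fr ne by (simp add: Q3_def frame_def)
    then have rN: "reg s4 rN = N"
      by (simp add: Q3_def)
    define os where "os = seg (arr s4 aA) 0 N"
    have os: "set os = {..<N}" "length os = N" "sorted_wrt (by_key (arr s4 aK1) (<)) os"
      using so by (auto simp: sorted_state_def block_ok_def os_def)
    have dist: "distinct os"
      using os(1,2) by (simp add: card_distinct)
    have "runs (msort aK2 \<rho>) s4 ((L + 2) * ((N + 1) * (3 * pass_const aK2 \<rho>)))
        (sorted_state aK2 \<rho> (by_key (arr s4 aK1) (<)) N os)"
      using runs_msort[of s4 L aK2 \<rho> os "by_key (arr s4 aK1) (<)"] N ne os dist by_key_asym
      unfolding rN by (auto simp: os_def)
    then show ?thesis
    proof (rule runs_frame)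
      fix s5 assume fr5: "frame (regs_of (msort aK2 \<rho>)) (arrs_of (msort aK2 \<rho>)) s4 s5"
        and so5: "sorted_state aK2 \<rho> (by_key (arr s4 aK1) (<)) N os s5"
      have Q5: "Q3 s5"
        using Q4 fr5 ne by (simp add: Q3_def frame_def)
      have K1: "arr s4 aK1 y = k1 y" if "y < N" for y
        using Q4 that by (simp add: Q3_def)
      have K2: "arr s5 aK2 y = k2 y" if "y \<le> N" for y
        using Q5 that by (simp add: Q3_def)
      have V: "arr s5 aV y = v y" if "y \<le> N" for y
        using Q5 that by (simp add: Q3_def)
      have "best_in (\<lambda>y. (v y, k2 y)) (insert N (dominated N k1 k2 p)) (arr s5 \<rho> p)" if p: "p < N" for p
      proof -
        have "p \<in> set os"
          using p os(1) by simp
        then have "best_in (item_value aK2 s5)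
          (insert N {y \<in> set os. by_key (arr s4 aK1) (<) y p \<and> arr s5 aK2 y \<le> arr s5 aK2 p}) (arr s5 \<rho> p)"
          using so5 unfolding sorted_state_def block_ok_def by blast
        also have "{y \<in> set os. by_key (arr s4 aK1) (<) y p \<and> arr s5 aK2 y \<le> arr s5 aK2 p} = dominated N k1 k2 p"
          using p K1 K2 os(1) by (auto simp: by_key_def dominated_def)
        finally have best: "best_in (item_value aK2 s5) (insert N (dominated N k1 k2 p)) (arr s5 \<rho> p)" .
        have le: "y \<le> N" if "y \<in> insert N (dominated N k1 k2 p)" for y
          using that by (auto simp: dominated_def)
        have val: "item_value aK2 s5 y = (v y, k2 y)" if "y \<in> insert N (dominated N k1 k2 p)" for y
          using K2[OF le[OF that]] V[OF le[OF that]] by (simp add: item_value_def)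
        show ?thesis
          using best val unfolding best_in_def by metis
      qed
      then show "Q3 s5 \<and> (\<forall>p < N. best_in (\<lambda>y. (v y, k2 y)) (insert N (dominated N k1 k2 p)) (arr s5 \<rho> p))"
        using Q5 by blast
    qed
  qed
  have 6: "runs (For rT (Reg rN) ?read) s5 ((N + 1) * body_cost 0 ?read) ?P"
    if Q: "Q3 s5 \<and> (\<forall>p < N. best_in (\<lambda>y. (v y, k2 y)) (insert N (dominated N k1 k2 p)) (arr s5 \<rho> p))" for s5
  proof -
    have r: "arr s5 \<rho> p \<le> N" if "p < N" for p
    proof -
      have "arr s5 \<rho> p \<in> insert N (dominated N k1 k2 p)"
        using Q that by (simp add: best_in_def)
      then show ?thesis
        by (auto simp: dominated_def)
    qed
    have "runs (For rT (Reg rN) ?read) s5 (body_cost N ?read) ?P"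
    proof (rule runs_For_loop_free[where I = "\<lambda>k s'. \<forall>p < k. arr s' \<zeta> p = v (arr s5 \<rho> p)"])
      fix k s' assume k: "k < N" "\<forall>p < k. arr s' \<zeta> p = v (arr s5 \<rho> p)" "reg s' rT = k"
        and fr: "frame (insert rT (regs_of ?read)) (arrs_of ?read) s5 s'"
      have "arr s' \<rho> = arr s5 \<rho>" "arr s' aV = arr s5 aV"
        using fr ne by (auto simp: frame_def)
      then have "effect ?read s' = set_cell \<zeta> k (v (arr s5 \<rho> k)) s'"
        using Q r[OF k(1)] k by (simp add: Q3_def)
      then show "\<forall>p < Suc k. arr (set_reg rT (Suc k) (effect ?read s')) \<zeta> p = v (arr s5 \<rho> p)"
        using k by (auto simp: less_Suc_eq)
    next
      fix s' assume "\<forall>p < N. arr s' \<zeta> p = v (arr s5 \<rho> p)"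
        and fr: "frame (insert rT (regs_of ?read)) (arrs_of ?read) s5 s'"
      moreover have "arr s' \<rho> = arr s5 \<rho>"
        using fr ne by (auto simp: frame_def)
      ultimately show "?P s'"
        using Q by simp
    qed (use Q in \<open>auto simp: Q3_def\<close>)
    then show ?thesis
      by (simp only: body_cost_eq[of N])
  qed
  have "runs (dominance l l' f1 f2 fv g1 g2 gv \<rho> \<zeta>) s
    ((na + 1) * load_const (Lit 0) f1 f2 fv + ((nb + 1) * load_const (Reg l) g1 g2 gv + (20 +
     ((L + 2) * ((N + 1) * (3 * pass_const aK1 \<rho>)) + ((L + 2) * ((N + 1) * (3 * pass_const aK2 \<rho>)) +
       (N + 1) * body_cost 0 ?read))))) ?P"
    unfolding dominance_def
    by (rule runs_Seq[OF 1], rule runs_Seq[OF 2], assumption+, rule runs_Seq[OF 3], assumption+,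
      rule runs_Seq[OF 4], assumption, rule runs_Seq[OF 5], assumption+, rule 6)
  then show ?thesis
  proof (rule runs_mono)
    have M1: "na + 1 \<le> M" "nb + 1 \<le> M" "N + 1 \<le> M" "1 \<le> M"
      using M by (auto simp: N_def)
    have one: "c \<le> (L + 2) * c" for c
      by simp
    have a: "k * c \<le> (L + 2) * (M * c)" if "k \<le> M" for k c
      using mult_le_mono1[OF that, of c] one[of "M * c"] by linarith
    have b: "(L + 2) * (k * c) \<le> (L + 2) * (M * c)" if "k \<le> M" for k c
      using that by (intro mult_le_mono2 mult_le_mono1)
    show "(na + 1) * load_const (Lit 0) f1 f2 fv + ((nb + 1) * load_const (Reg l) g1 g2 gv + (20 +
     ((L + 2) * ((N + 1) * (3 * pass_const aK1 \<rho>)) + ((L + 2) * ((N + 1) * (3 * pass_const aK2 \<rho>)) +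
       (N + 1) * body_cost 0 ?read)))) \<le> (L + 2) * (M * dominance_const l f1 f2 fv g1 g2 gv \<rho> \<zeta>)"
      unfolding dominance_const_def distrib_left[of M] distrib_left[of "L + 2"]
      using a[OF M1(4), of 20] by (intro add_mono a b M1) simp
  qed
qed


section \<open>The algorithm for at most three dimensions\<close>

abbreviation (input) "aR1 \<equiv> 9 :: nat"
abbreviation (input) "aR2 \<equiv> 14 :: nat"
abbreviation (input) "aRW \<equiv> 15 :: nat"
abbreviation (input) "aZ1 \<equiv> 16 :: nat"
abbreviation (input) "aZ2 \<equiv> 17 :: nat"
abbreviation (input) "aZW \<equiv> 18 :: nat"

definition coE :: "nat \<Rightarrow> nat \<Rightarrow> exp \<Rightarrow> nat \<Rightarrow> exp" where
  "coE d a e k = (if k < d then coord d a e k else Lit 0)"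

definition sum_up :: "nat \<Rightarrow> com" where
  "sum_up d = Seq (For rT (mul d (Reg 0)) (SetReg rSum (Add (Reg rSum) (Read 0 (Reg rT)))))
     (Seq (For rT (mul d (Reg 1)) (SetReg rSum (Add (Reg rSum) (Read 1 (Reg rT)))))
       (SetReg rBig (Add (Reg rSum) (Lit 1))))"

definition emit_minima :: "nat \<Rightarrow> com" where
  "emit_minima d = For rT (Reg 0) (Seq (write_block d aQ (Lit 0) (coord d 0 (Reg rT))) (emit_point d))"

text \<open>The items are the minima twice, first as queries, with a value that is never better, and then as
  data. As queries come first, data that agree with a query in direction \<open>a\<close> do not count.\<close>

definition queries :: "nat \<Rightarrow> nat \<Rightarrow> nat \<Rightarrow> nat \<Rightarrow> nat \<Rightarrow> nat \<Rightarrow> com" where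
  "queries d a b c \<rho> \<zeta> = dominance 0 0 (coE d 0 (Reg rT) a) (coE d 0 (Reg rT) b) (Reg rBig)
     (coE d 0 (Reg rT) a) (coE d 0 (Reg rT) b) (coE d 0 (Reg rT) c) \<rho> \<zeta>"

text \<open>If the second list consists of maxima, coordinates are subtracted from a large number, which
  turns points above a query into points below it.\<close>

definition dirE :: "bool \<Rightarrow> nat \<Rightarrow> nat \<Rightarrow> nat \<Rightarrow> exp" where
  "dirE upset d l k = (if upset then coE d l (Reg rT) k else Sub (Reg rSum) (coE d l (Reg rT) k))"

text \<open>Here the data come first, so that points that agree with the query in a direction do count.\<close>

definition member_queries :: "nat \<Rightarrow> bool \<Rightarrow> nat \<Rightarrow> nat \<Rightarrow> nat \<Rightarrow> com" where
  "member_queries d upset a b c = dominance 1 0 (dirE upset d 1 a) (dirE upset d 1 b) (dirE upset d 1 c)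
     (dirE upset d 0 a) (dirE upset d 0 b) (Reg rBig) aRW aZW"

text \<open>Item \<open>n + j\<close> of the queries is the minimum with index \<open>j\<close>.\<close>

definition neighbour :: "nat \<Rightarrow> exp" where
  "neighbour \<rho> = Sub (Read \<rho> (Reg rT)) (Reg 0)"

definition level_with :: "nat \<Rightarrow> nat \<Rightarrow> nat \<Rightarrow> nat \<Rightarrow> test" where
  "level_with d \<rho> \<zeta> k = Conj (eqE (Read \<zeta> (Reg rT)) (Reg rZ)) (eqE (coE d 0 (neighbour \<rho>) k) (coE d 0 (Reg rT) k))"

definition entry_test :: "nat \<Rightarrow> bool \<Rightarrow> nat \<Rightarrow> nat \<Rightarrow> nat \<Rightarrow> test" where
  "entry_test d upset a b c = Conj (Less (Reg rZ) (Reg rBig))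
     (Conj (if upset then Less (Reg rZ) (Read aZW (Add (Reg 1) (Reg rT)))
            else Neg (Less (Sub (Reg rSum) (Reg rZ)) (Read aZW (Add (Reg 1) (Reg rT)))))
       (Conj (Neg (Conj (Less (Lit a) (Lit c)) (level_with d aR1 aZ1 b)))
         (Neg (Conj (Less (Lit b) (Lit c)) (level_with d aR2 aZ2 a)))))"

definition emit_entry :: "nat \<Rightarrow> bool \<Rightarrow> nat \<Rightarrow> nat \<Rightarrow> nat \<Rightarrow> com" where
  "emit_entry d upset a b c = Seq (SetReg rZ (minE (Read aZ1 (Reg rT)) (Read aZ2 (Reg rT))))
     (Cond (entry_test d upset a b c)
       (Seq (write_block d aQ (Lit 0) (\<lambda>k. if k = c then Reg rZ else coord d 0 (Reg rT) k))
         (Seq (emit_point d) (Seq (emit_relation d (Reg rT))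
           (Seq (Cond (eqE (Read aZ1 (Reg rT)) (Reg rZ)) (emit_relation d (neighbour aR1)) Skip)
             (Cond (level_with d aR2 aZ2 a) (emit_relation d (neighbour aR2)) Skip)))))
       Skip)"

definition one_direction :: "nat \<Rightarrow> bool \<Rightarrow> nat \<Rightarrow> nat \<Rightarrow> nat \<Rightarrow> com" where
  "one_direction d upset a b c = Seq (queries d a b c aR1 aZ1) (Seq (queries d b a c aR2 aZ2)
     (Seq (member_queries d upset a b c) (For rT (Reg 0) (emit_entry d upset a b c))))"

definition three_directions :: "nat \<Rightarrow> bool \<Rightarrow> com" where
  "three_directions d upset = Seq (sum_up d) (Seq (emit_minima d)
     (Seq (one_direction d upset 1 2 0) (Seq (one_direction d upset 0 2 1) (one_direction d upset 0 1 2))))"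

lemma regs_of_directions [simp]:
  "regs_of (sum_up d) = {rT, rSum, rBig}"
  "regs_of (emit_minima d) = {rT, 2}"
  "regs_of (queries d a b c \<rho> \<zeta>) = {rI, rMid, rJ, rHi, rBest, rX, rK, rW, rN, rT}"
  "regs_of (member_queries d upset a b c) = {rI, rMid, rJ, rHi, rBest, rX, rK, rW, rN, rT}"
  "regs_of (emit_entry d upset a b c) = {rZ, 2, 3}"
  by (auto simp: sum_up_def emit_minima_def queries_def member_queries_def emit_entry_def)

lemma arrs_of_directions [simp]:
  "arrs_of (sum_up d) = {}"
  "i \<noteq> aQ \<Longrightarrow> i \<noteq> 2 \<Longrightarrow> i \<notin> arrs_of (emit_minima d)"
  "arrs_of (queries d a b c \<rho> \<zeta>) = {aK1, aK2, aV, aA, aB, \<rho>, \<zeta>}"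
  "arrs_of (member_queries d upset a b c) = {aK1, aK2, aV, aA, aB, aRW, aZW}"
  "i \<noteq> aQ \<Longrightarrow> i \<noteq> 2 \<Longrightarrow> i \<noteq> 3 \<Longrightarrow> i \<notin> arrs_of (emit_entry d upset a b c)"
  by (auto simp: sum_up_def emit_minima_def queries_def member_queries_def emit_entry_def)

lemma loop_free_emit_entry [simp]: "loop_free (emit_entry d upset a b c)"
  by (simp add: emit_entry_def)

locale small_specified_interval = specified_interval + small_interval
begin

abbreviation "n \<equiv> length xs"
abbreviation "ny \<equiv> length ys"

text \<open>The sum of all coordinates of the input bounds each of them.\<close>

definition total :: nat where
  "total = (\<Sum>i<d * n. cells (concat xs) i) + (\<Sum>i<d * ny. cells (concat ys) i)"

lemma co_le_total:
  "i < n \<Longrightarrow> co (xs ! i) k \<le> total" "j < ny \<Longrightarrow> co (ys ! j) k \<le> total"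
proof -
  have bound: "co (zs ! i) k \<le> (\<Sum>i<d * length zs. cells (concat zs) i)"
    if zs: "\<forall>z \<in> set zs. length z = d" "i < length zs" for zs i
  proof (cases "k < d")
    case True
    have "d * i + k < d * length zs"
      using nth_concat_points(1)[OF zs True] length_concat_points[OF zs(1)] by simp
    then have "cells (concat zs) (d * i + k) \<le> (\<Sum>i<d * length zs. cells (concat zs) i)"
      by (intro member_le_sum) auto
    then show ?thesis
      using cells_concat[OF zs True] zs True by (simp add: co_def)
  qed (use zs in \<open>simp add: co_def\<close>)
  show "i < n \<Longrightarrow> co (xs ! i) k \<le> total" "j < ny \<Longrightarrow> co (ys ! j) k \<le> total"
    using bound[OF xs_length, of i] bound[OF ys, of j] by (auto simp: total_def)
qed

definition ready :: "state \<Rightarrow> bool" where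
  "ready s \<longleftrightarrow> has_input xs ys s \<and> reg s rSum = total \<and> reg s rBig = Suc total"

lemma ready_cong:
  assumes "ready s" "reg s' 0 = reg s 0" "reg s' 1 = reg s 1" "reg s' rSum = reg s rSum"
    "reg s' rBig = reg s rBig" "arr s' 0 = arr s 0" "arr s' 1 = arr s 1"
  shows "ready s'"
  using assms has_input_cong[of xs ys s s'] by (simp add: ready_def)

lemma coE_input:
  assumes "has_input xs ys s"
  shows "exp_val e s < n \<Longrightarrow> exp_val (coE d 0 e k) s = co (xs ! exp_val e s) k"
    "exp_val e s < ny \<Longrightarrow> exp_val (coE d 1 e k) s = co (ys ! exp_val e s) k"
  using coord_input[OF assms, of k d e] xs_length ys by (auto simp: coE_def co_def)

definition dirV :: "nat \<Rightarrow> nat" where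
  "dirV u = (if upset then u else total - u)"

lemma stable_input:
  assumes "ready s"
  shows "stable s n (coE d 0 (Reg rT) k) (\<lambda>i. co (xs ! i) k)"
    "stable s n (Reg rBig) (\<lambda>i. Suc total)"
    "stable s n (dirE upset d 0 k) (\<lambda>i. dirV (co (xs ! i) k))"
    "stable s ny (dirE upset d 1 k) (\<lambda>j. dirV (co (ys ! j) k))"
proof -
  define same where "same s' \<longleftrightarrow> (\<forall>r. r < 4 \<or> r = rSum \<or> r = rBig \<longrightarrow> reg s' r = reg s r) \<and>
     (\<forall>a < 4. arr s' a = arr s a)" for s' :: state
  have r: "ready s'" if "same s'" for s'
    using ready_cong[OF assms, of s'] that by (simp add: same_def)
  have sum: "reg s' rSum = total" "reg s' rBig = Suc total" if "same s'" for s'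
    using r[OF that] by (auto simp: ready_def)
  have x: "exp_val (coE d 0 (Reg rT) k) s' = co (xs ! reg s' rT) k" if "same s'" "reg s' rT < n" for s'
    using r[OF that(1)] coE_input(1)[of s' "Reg rT" k] that(2) by (simp add: ready_def)
  have y: "exp_val (coE d 1 (Reg rT) k) s' = co (ys ! reg s' rT) k" if "same s'" "reg s' rT < ny" for s'
    using r[OF that(1)] coE_input(2)[of s' "Reg rT" k] that(2) by (simp add: ready_def)
  show "stable s n (coE d 0 (Reg rT) k) (\<lambda>i. co (xs ! i) k)"
    unfolding stable_def using x by (simp add: same_def)
  show "stable s n (Reg rBig) (\<lambda>i. Suc total)"
    unfolding stable_def using assms by (simp add: ready_def)
  show "stable s n (dirE upset d 0 k) (\<lambda>i. dirV (co (xs ! i) k))"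
    unfolding stable_def
  proof (intro allI impI, elim conjE)
    fix s' :: state assume "\<forall>r. r < 4 \<or> r = rSum \<or> r = rBig \<longrightarrow> reg s' r = reg s r" "\<forall>a < 4. arr s' a = arr s a"
      and t: "reg s' rT < n"
    then have s': "same s'"
      unfolding same_def by blast
    show "exp_val (dirE upset d 0 k) s' = dirV (co (xs ! reg s' rT) k)"
      unfolding dirE_def dirV_def using x[OF s' t] sum(1)[OF s'] by simp
  qed
  show "stable s ny (dirE upset d 1 k) (\<lambda>j. dirV (co (ys ! j) k))"
    unfolding stable_def
  proof (intro allI impI, elim conjE)
    fix s' :: state assume "\<forall>r. r < 4 \<or> r = rSum \<or> r = rBig \<longrightarrow> reg s' r = reg s r" "\<forall>a < 4. arr s' a = arr s a"
      and t: "reg s' rT < ny"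
    then have s': "same s'"
      unfolding same_def by blast
    show "exp_val (dirE upset d 1 k) s' = dirV (co (ys ! reg s' rT) k)"
      unfolding dirE_def dirV_def using y[OF s' t] sum(1)[OF s'] by simp
  qed
qed

lemma runs_sum_up:
  "runs (sum_up d) (input_state xs ys) ((n + ny + 1) * ((d + 1) * (2 * exp_cost (mul d (Reg 0)) + 30) + 10))
     (\<lambda>s. ready s \<and> has_output d [] s)"
proof -
  let ?s0 = "input_state xs ys"
  let ?B = "exp_cost (mul d (Reg 0)) + 15"
  have cost: "exp_cost (mul k (Reg 1)) = exp_cost (mul k (Reg 0))" for k
    by (induction k) auto
  have loop: "runs (For rT (mul d (Reg l)) (SetReg rSum (Add (Reg rSum) (Read l (Reg rT))))) s ((d * m + 1) * ?B)
    (\<lambda>s'. reg s' rSum = w + (\<Sum>i<d * m. arr s l i))"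
    if "l = 0 \<or> l = 1" "reg s l = m" "reg s rSum = w" for s l m w
  proof -
    let ?c = "SetReg rSum (Add (Reg rSum) (Read l (Reg rT)))"
    have "runs (For rT (mul d (Reg l)) ?c) s ((d * m + 1) * (5 + exp_cost (mul d (Reg l)) + 7))
      (\<lambda>s'. reg s' rSum = w + (\<Sum>i<d * m. arr s l i))"
    proof (rule runs_For[where I = "\<lambda>k s'. reg s' rSum = w + (\<Sum>i<k. arr s l i)"])
      fix k s' assume "k < d * m" "reg s' rSum = w + (\<Sum>i<k. arr s l i)" "reg s' rT = k"
        "frame (insert rT (regs_of ?c)) (arrs_of ?c) s s'"
      then show "runs ?c s' 5 (\<lambda>s''. reg (set_reg rT (Suc k) s'') rSum = w + (\<Sum>i<Suc k. arr s l i))"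
        by (intro runs_SetReg) (auto simp: frame_def)
    next
      show "exp_val (mul d (Reg l)) s' = d * m" if "frame (insert rT (regs_of ?c)) (arrs_of ?c) s s'" for s'
        using that \<open>reg s l = m\<close> \<open>l = 0 \<or> l = 1\<close> by (auto simp: frame_def)
    qed (use that in auto)
    then show ?thesis
    proof (rule runs_mono)
      have "exp_cost (mul d (Reg l)) = exp_cost (mul d (Reg 0))"
        using that(1) cost by auto
      then show "(d * m + 1) * (5 + exp_cost (mul d (Reg l)) + 7) \<le> (d * m + 1) * ?B"
        by (intro mult_le_mono2) simp
    qed
  qed
  have "runs (sum_up d) ?s0 ((d * n + 1) * ?B + ((d * ny + 1) * ?B + 4)) (\<lambda>s. ready s \<and> has_output d [] s)"
    unfolding sum_up_def
  proof (rule runs_Seq[OF loop[of 0 ?s0 n 0]])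
    fix s1 assume s1: "reg s1 rSum = 0 + (\<Sum>i<d * n. arr ?s0 0 i)"
      and fr1: "frame (regs_of (For rT (mul d (Reg 0)) (SetReg rSum (Add (Reg rSum) (Read 0 (Reg rT))))))
        (arrs_of (For rT (mul d (Reg 0)) (SetReg rSum (Add (Reg rSum) (Read 0 (Reg rT)))))) ?s0 s1"
    show "runs (Seq (For rT (mul d (Reg 1)) (SetReg rSum (Add (Reg rSum) (Read 1 (Reg rT)))))
        (SetReg rBig (Add (Reg rSum) (Lit 1)))) s1 ((d * ny + 1) * ?B + 4) (\<lambda>s. ready s \<and> has_output d [] s)"
    proof (rule runs_Seq[OF loop[of 1 s1 ny "reg s1 rSum"]])
      fix s2 assume s2: "reg s2 rSum = reg s1 rSum + (\<Sum>i<d * ny. arr s1 1 i)"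
        and fr2: "frame (regs_of (For rT (mul d (Reg 1)) (SetReg rSum (Add (Reg rSum) (Read 1 (Reg rT))))))
          (arrs_of (For rT (mul d (Reg 1)) (SetReg rSum (Add (Reg rSum) (Read 1 (Reg rT)))))) s1 s2"
      have fr: "frame {rT, rSum} {} ?s0 s2"
        using fr1 fr2 by (simp add: frame_def)
      have sum: "reg s2 rSum = total"
        using s1 s2 fr1 by (simp add: total_def input_state_def frame_def)
      have "has_input xs ys s2" "has_output d [] s2"
        using has_input_cong[OF has_input_input_state] has_output_cong[OF has_output_input_state] fr
        by (auto simp: frame_def)
      then show "runs (SetReg rBig (Add (Reg rSum) (Lit 1))) s2 4 (\<lambda>s. ready s \<and> has_output d [] s)"
        using sum by (intro runs_SetReg) (auto simp: ready_def has_input_def has_output_def array_holds_def)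
    qed (use fr1 in \<open>auto simp: frame_def input_state_def\<close>)
  qed (auto simp: input_state_def)
  then show ?thesis
  proof (rule runs_mono)
    let ?m = "n + ny + 1"
    have "d * n + 1 \<le> ?m * (d + 1)" "d * ny + 1 \<le> ?m * (d + 1)"
      by (auto simp: algebra_simps)
    then have "(d * n + 1) * ?B \<le> (?m * (d + 1)) * ?B" "(d * ny + 1) * ?B \<le> (?m * (d + 1)) * ?B"
      by (auto intro: mult_le_mono1 simp del: mult_Suc mult_Suc_right)
    moreover have "(?m * (d + 1)) * ?B + ((?m * (d + 1)) * ?B + 4) \<le> ?m * ((d + 1) * (2 * exp_cost (mul d (Reg 0)) + 30) + 10)"
      by (simp add: algebra_simps)
    ultimately show "(d * n + 1) * ?B + ((d * ny + 1) * ?B + 4)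
        \<le> ?m * ((d + 1) * (2 * exp_cost (mul d (Reg 0)) + 30) + 10)"
      by linarith
  qed
qed

lemma runs_emit_minima:
  assumes "ready s" "has_output d [] s"
  shows "runs (emit_minima d) s (body_cost n (Seq (write_block d aQ (Lit 0) (coord d 0 (Reg rT))) (emit_point d)))
    (\<lambda>s'. ready s' \<and> has_output d (map (\<lambda>x. (x, [])) xs) s')"
  unfolding emit_minima_def
proof (rule runs_For_loop_free[where I = "\<lambda>k s'. ready s' \<and> has_output d (map (\<lambda>x. (x, [])) (take k xs)) s'"])
  let ?w = "write_block d aQ (Lit 0) (coord d 0 (Reg rT))"
  fix k s' assume k: "k < n" "ready s' \<and> has_output d (map (\<lambda>x. (x, [])) (take k xs)) s'" "reg s' rT = k"
  then have inp: "has_input xs ys s'"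
    by (simp add: ready_def)
  have c: "exp_val (coord d 0 (Reg rT) j) s'' = xs ! k ! j" if "j < d" "frame {} {aQ} s' s''" for j s''
  proof -
    have "has_input xs ys s''" "reg s'' rT = k"
      using has_input_cong[OF inp] that(2) k(3) by (auto simp: frame_def)
    then show ?thesis
      using coord_input(1)[of xs ys s'' j d "Reg rT"] that(1) xs_length k(1) by simp
  qed
  have w: "frame {} {aQ} s' (effect ?w s')"
    "arr (effect ?w s') aQ i = (if 0 \<le> i \<and> i < 0 + d then xs ! k ! (i - 0) else arr s' aQ i)" for i
    by (rule effect_write_block; use c in simp)+
  have p: "has_point d (xs ! k) (effect ?w s')"
    using w(2) xs_length k(1) by (simp add: has_point_def)
  have o: "has_output d (map (\<lambda>x. (x, [])) (take k xs)) (effect ?w s')"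
    using has_output_cong[of d _ s'] k(2) w(1) by (simp add: frame_def)
  have "has_output d (map (\<lambda>x. (x, [])) (take k xs) @ [(xs ! k, [])]) (effect (Seq ?w (emit_point d)) s')"
    using effect_emit_point[OF o p] by simp
  moreover have "ready (effect (Seq ?w (emit_point d)) s')"
  proof -
    have fr: "frame (regs_of (Seq ?w (emit_point d))) (arrs_of (Seq ?w (emit_point d))) s' (effect (Seq ?w (emit_point d)) s')"
      by (rule effect_frame) simp
    show ?thesis
      by (rule ready_cong[of s']) (use k(2) frame_reg[OF fr] frame_arr[OF fr] in simp_all)
  qed
  ultimately show "ready (set_reg rT (Suc k) (effect (Seq ?w (emit_point d)) s')) \<and>
      has_output d (map (\<lambda>x. (x, [])) (take (Suc k) xs)) (set_reg rT (Suc k) (effect (Seq ?w (emit_point d)) s'))"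
    using k(1) by (simp add: take_Suc_conv_app_nth ready_def has_input_def has_output_def array_holds_def)
qed (use assms in \<open>auto simp: ready_def has_input_def has_output_def array_holds_def\<close>)

text \<open>Among the items that the sort offers to a query, only the data have a value below the dummy's, and
  these are the minima of the query.\<close>

lemma best_nearest:
  fixes R Z :: "nat \<Rightarrow> nat" and a b c :: nat
  defines "k1 \<equiv> \<lambda>p. if p < n then co (xs ! p) a else co (xs ! (p - n)) a"
  defines "k2 \<equiv> \<lambda>p. if p < n then co (xs ! p) b else if p < n + n then co (xs ! (p - n)) b else 0"
  defines "v \<equiv> \<lambda>p. if p < n then Suc total else if p < n + n then co (xs ! (p - n)) c else Suc total"
  assumes best: "best_in (\<lambda>y. (v y, k2 y)) (insert (n + n) (dominated (n + n) k1 k2 i)) (R i)" "Z i = v (R i)"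
    and i: "i < n"
  shows "nearest (Suc total) a b c (xs ! i) (xs ! (R i - n)) (Z i)" "Z i < Suc total \<Longrightarrow> R i - n < n"
proof -
  let ?D = "dominated (n + n) k1 k2 i"
  let ?S = "{y \<in> minima Q. co y a < co (xs ! i) a \<and> co y b \<le> co (xs ! i) b}"
  have D: "n + j \<in> ?D \<longleftrightarrow> co (xs ! j) a < co (xs ! i) a \<and> co (xs ! j) b \<le> co (xs ! i) b" if "j < n" for j
    using that i by (auto simp: dominated_def k1_def k2_def)
  have S: "y \<in> ?S \<longleftrightarrow> (\<exists>j<n. y = xs ! j \<and> n + j \<in> ?D)" for y
  proof
    assume y: "y \<in> ?S"
    then have "y \<in> set xs"
      using xs(2) by simp
    then obtain j where "j < n" "y = xs ! j"
      by (metis in_set_conv_nth)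
    then show "\<exists>j<n. y = xs ! j \<and> n + j \<in> ?D"
      using D[of j] y by blast
  next
    assume "\<exists>j<n. y = xs ! j \<and> n + j \<in> ?D"
    then obtain j where "j < n" "y = xs ! j" "n + j \<in> ?D"
      by blast
    then show "y \<in> ?S"
      using D[of j] xs(2) nth_mem[of j xs] by blast
  qed
  have R: "R i \<in> insert (n + n) ?D" and le: "\<And>y. y \<in> insert (n + n) ?D \<Longrightarrow> (v (R i), k2 (R i)) \<le> (v y, k2 y)"
    using best(1) by (auto simp: best_in_def)
  have data: "\<exists>j<n. R i = n + j" if "v (R i) < Suc total"
  proof -
    have "R i \<noteq> n + n" "\<not> R i < n"
      using that by (auto simp: v_def)
    moreover have "R i < n + n"
      using R calculation by (auto simp: dominated_def)
    ultimately show ?thesis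
      by (intro exI[of _ "R i - n"]) auto
  qed
  have v_data: "v (n + j) = co (xs ! j) c" "k2 (n + j) = co (xs ! j) b" if "j < n" for j
    using that by (auto simp: v_def k2_def)
  have "(?S = {} \<and> v (R i) = Suc total) \<or> (xs ! (R i - n) \<in> ?S \<and> v (R i) = co (xs ! (R i - n)) c \<and> v (R i) < Suc total \<and>
      (\<forall>y \<in> ?S. co (xs ! (R i - n)) c < co y c \<or> co (xs ! (R i - n)) c = co y c \<and> co (xs ! (R i - n)) b \<le> co y b))"
  proof (cases "v (R i) < Suc total")
    case True
    then obtain j where j: "j < n" "R i = n + j"
      using data by blast
    have "n + j \<in> ?D"
      using R j by auto
    then have "xs ! (R i - n) \<in> ?S"
      using S j by auto
    moreover have "co (xs ! j) c < co y c \<or> co (xs ! j) c = co y c \<and> co (xs ! j) b \<le> co y b" if yS: "y \<in> ?S" for y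
    proof -
      obtain j' where "j' < n" "y = xs ! j'" "n + j' \<in> ?D"
        using iffD1[OF S yS] by blast
      then show ?thesis
        using le[of "n + j'"] v_data[of j'] v_data[OF j(1)] j(2) by auto
    qed
    ultimately show ?thesis
      using True v_data[OF j(1)] j(2) by simp
  next
    case False
    have "v (R i) \<le> v (n + n)"
      using le[of "n + n"] by auto
    then have eq: "v (R i) = Suc total"
      using False by (simp add: v_def)
    have "?S = {}"
    proof (rule ccontr)
      assume "?S \<noteq> {}"
      then obtain j where "j < n" "n + j \<in> ?D"
        using S by blast
      then have "v (R i) \<le> co (xs ! j) c"
        using le[of "n + j"] v_data[of j] by auto
      then show False
        using eq co_le_total(1)[OF \<open>j < n\<close>, of c] by simp
    qed
    then show ?thesis
      using eq by blast
  qed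
  then show "nearest (Suc total) a b c (xs ! i) (xs ! (R i - n)) (Z i)"
    unfolding nearest_def Let_def best(2) .
  show "Z i < Suc total \<Longrightarrow> R i - n < n"
    using data best(2) by auto
qed

lemma best_member:
  fixes R Z :: "nat \<Rightarrow> nat" and a b c :: nat
  defines "k1 \<equiv> \<lambda>p. if p < ny then dirV (co (ys ! p) a) else dirV (co (xs ! (p - ny)) a)"
  defines "k2 \<equiv> \<lambda>p. if p < ny then dirV (co (ys ! p) b) else if p < ny + n then dirV (co (xs ! (p - ny)) b) else 0"
  defines "v \<equiv> \<lambda>p. if p < ny then dirV (co (ys ! p) c) else if p < ny + n then Suc total else Suc total"
  assumes best: "best_in (\<lambda>y. (v y, k2 y)) (insert (ny + n) (dominated (ny + n) k1 k2 (ny + i))) (R (ny + i))"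
      "Z (ny + i) = v (R (ny + i))"
    and i: "i < n" and abc: "{a, b, c} = {0, 1, 2}"
    and q: "length q = d" "co q a = co (xs ! i) a" "co q b = co (xs ! i) b" "co q c = z" "z \<le> total"
  shows "member_by upset (set ys) q \<longleftrightarrow> (if upset then z < Z (ny + i) else \<not> total - z < Z (ny + i))"
proof -
  let ?D = "dominated (ny + n) k1 k2 (ny + i)" and ?R = "R (ny + i)"
  have less3: "k < 3 \<longleftrightarrow> k = a \<or> k = b \<or> k = c" for k
  proof -
    have "k < 3 \<longleftrightarrow> k \<in> {0, 1, 2}"
      by auto
    then show ?thesis
      unfolding abc[symmetric] by auto
  qed
  have D: "j \<in> ?D \<longleftrightarrow> dirV (co (ys ! j) a) \<le> dirV (co q a) \<and> dirV (co (ys ! j) b) \<le> dirV (co q b)" if "j < ny" for j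
    using that i q by (auto simp: dominated_def k1_def k2_def)
  have R: "?R \<in> insert (ny + n) ?D" and le: "\<And>y. y \<in> insert (ny + n) ?D \<Longrightarrow> v ?R \<le> v y"
    using best(1) by (fastforce simp: best_in_def)+
  have "dirV z < Suc total"
    using q(5) by (auto simp: dirV_def)
  then have some: "Z (ny + i) \<le> dirV z \<longleftrightarrow> (\<exists>j<ny. j \<in> ?D \<and> dirV (co (ys ! j) c) \<le> dirV z)"
  proof -
    assume z: "dirV z < Suc total"
    show ?thesis
    proof
      assume "Z (ny + i) \<le> dirV z"
      then have "v ?R \<le> dirV z" using best(2) by simp
      moreover from this have "?R < ny"
        using z by (auto simp: v_def split: if_splits)
      ultimately show "\<exists>j<ny. j \<in> ?D \<and> dirV (co (ys ! j) c) \<le> dirV z"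
        using R by (intro exI[of _ ?R]) (auto simp: v_def)
    next
      assume "\<exists>j<ny. j \<in> ?D \<and> dirV (co (ys ! j) c) \<le> dirV z"
      then obtain j where "j < ny" "j \<in> ?D" "dirV (co (ys ! j) c) \<le> dirV z"
        by blast
      then show "Z (ny + i) \<le> dirV z"
        using le[of j] best(2) by (simp add: v_def)
    qed
  qed
  have cmp: "dirV u \<le> dirV w \<longleftrightarrow> (if upset then u \<le> w else w \<le> u)" if "u \<le> total" "w \<le> total" for u w
    using that by (auto simp: dirV_def)
  have qt: "co q a \<le> total" "co q b \<le> total"
    using q co_le_total(1)[OF i] by auto
  have point: "j \<in> ?D \<and> dirV (co (ys ! j) c) \<le> dirV z \<longleftrightarrow> (if upset then ys ! j \<preceq> q else q \<preceq> ys ! j)" if "j < ny" for j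
  proof -
    have len: "length (ys ! j) = d"
      using ys that by simp
    show ?thesis
      unfolding D[OF that] cmp[OF co_le_total(2)[OF that] qt(1)] cmp[OF co_le_total(2)[OF that] qt(2)]
        cmp[OF co_le_total(2)[OF that] q(5)] pt_le_co[OF len q(1)] pt_le_co[OF q(1) len] less3
      using q(4) by auto
  qed
  have dz: "dirV z = (if upset then z else total - z)"
    by (simp add: dirV_def)
  have "Z (ny + i) \<le> dirV z \<longleftrightarrow> (\<exists>y \<in> set ys. if upset then y \<preceq> q else q \<preceq> y)"
    unfolding some using point by (metis in_set_conv_nth)
  then show ?thesis
    unfolding dz by (cases upset) (auto simp: member_by_def not_less not_le)
qed

end


definition direction_cost :: "nat \<Rightarrow> bool \<Rightarrow> nat \<Rightarrow> nat \<Rightarrow> nat \<Rightarrow> nat" where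
  "direction_cost d upset a b c =
    dominance_const 0 (coE d 0 (Reg rT) a) (coE d 0 (Reg rT) b) (Reg rBig) (coE d 0 (Reg rT) a) (coE d 0 (Reg rT) b)
      (coE d 0 (Reg rT) c) aR1 aZ1 +
    (dominance_const 0 (coE d 0 (Reg rT) b) (coE d 0 (Reg rT) a) (Reg rBig) (coE d 0 (Reg rT) b) (coE d 0 (Reg rT) a)
      (coE d 0 (Reg rT) c) aR2 aZ2 +
    (dominance_const 1 (dirE upset d 1 a) (dirE upset d 1 b) (dirE upset d 1 c) (dirE upset d 0 a) (dirE upset d 0 b)
      (Reg rBig) aRW aZW +
    body_cost 0 (emit_entry d upset a b c)))"

context small_specified_interval
begin

text \<open>The member queries do not know the level to which a minimum is raised. Their answer is a threshold,
  so the last clause speaks of all levels.\<close>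

definition answered :: "nat \<Rightarrow> nat \<Rightarrow> nat \<Rightarrow> state \<Rightarrow> bool" where
  "answered a b c s \<longleftrightarrow> (\<forall>i < n.
     nearest (Suc total) a b c (xs ! i) (xs ! (arr s aR1 i - n)) (arr s aZ1 i) \<and>
     (arr s aZ1 i < Suc total \<longrightarrow> arr s aR1 i - n < n) \<and>
     nearest (Suc total) b a c (xs ! i) (xs ! (arr s aR2 i - n)) (arr s aZ2 i) \<and>
     (arr s aZ2 i < Suc total \<longrightarrow> arr s aR2 i - n < n) \<and>
     (\<forall>q z. length q = d \<longrightarrow> co q a = co (xs ! i) a \<longrightarrow> co q b = co (xs ! i) b \<longrightarrow> co q c = z \<longrightarrow> z \<le> total \<longrightarrow>
        (member_by upset (set ys) q \<longleftrightarrow> (if upset then z < arr s aZW (ny + i) else \<not> total - z < arr s aZW (ny + i)))))"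

text \<open>What is written for the minimum with index \<open>i\<close> in direction \<open>c\<close>: nothing if there is no level to raise
  it to, if the raised point is outside of \<open>Q\<close>, or if a smaller direction is responsible for it.\<close>

definition entry :: "nat \<Rightarrow> nat \<Rightarrow> nat \<Rightarrow> state \<Rightarrow> nat \<Rightarrow> (point \<times> point list) list" where
  "entry a b c s i =
     (let x = xs ! i; r1 = xs ! (arr s aR1 i - n); r2 = xs ! (arr s aR2 i - n);
          z1 = arr s aZ1 i; z2 = arr s aZ2 i; z = min z1 z2; q = raised c x z
      in if z < Suc total \<and> q \<in> Q \<and> \<not> (a < c \<and> z1 = z \<and> co r1 b = co x b) \<and> \<not> (b < c \<and> z2 = z \<and> co r2 a = co x a)
         then [(q, [x] @ (if z1 = z then [r1] else []) @ (if z2 = z \<and> co r2 a = co x a then [r2] else []))] else [])"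

lemma direction_answered:
  assumes "answered a b c s" "{a, b, c} = {0, 1, 2}" "i < n"
  shows "direction d Q (Suc total) a b c (xs ! i) (xs ! (arr s aR1 i - n)) (xs ! (arr s aR2 i - n))
    (arr s aZ1 i) (arr s aZ2 i)"
proof
  show "xs ! i \<in> minima Q"
    using xs(2) nth_mem[OF assms(3)] by simp
qed (use assms in \<open>simp_all add: answered_def\<close>)

lemma good_entries_entry:
  assumes "answered a b c s" "{a, b, c} = {0, 1, 2}" "i < n"
  shows "good_entries c (xs ! i) (entry a b c s i)"
proof -
  interpret dir: direction d Q "Suc total" a b c "xs ! i" "xs ! (arr s aR1 i - n)" "xs ! (arr s aR2 i - n)"
    "arr s aZ1 i" "arr s aZ2 i"
    by (rule direction_answered[OF assms])
  show ?thesis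
    using dir.good_entries_direction
    unfolding entry_def Let_def dir.q_def dir.reps_def dir.near_a_def dir.near_b_def dir.z_def .
qed

lemma effect_emit_entry:
  assumes ans: "answered a b c s" and abc: "{a, b, c} = {0, 1, 2}" and ready: "ready s"
    and i: "reg s rT = i" "i < n" and out: "has_output d ol s"
  shows "has_output d (ol @ entry a b c s i) (effect (emit_entry d upset a b c) s)"
proof -
  define x r1 r2 z1 z2 where r: "x = xs ! i" "r1 = xs ! (arr s aR1 i - n)" "r2 = xs ! (arr s aR2 i - n)"
    "z1 = arr s aZ1 i" "z2 = arr s aZ2 i"
  define z where "z = min z1 z2"
  define q where "q = raised c x z"
  interpret dir: direction d Q "Suc total" a b c x r1 r2 z1 z2
    unfolding r by (rule direction_answered[OF ans abc i(2)])
  have dz: "dir.z = z" and dq: "dir.q = q"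
    by (simp_all add: dir.z_def z_def dir.q_def q_def)
  define E1 where "E1 \<longleftrightarrow> z1 = z"
  define E2 where "E2 \<longleftrightarrow> z2 = z \<and> co r2 a = co x a"
  define keep where "keep \<longleftrightarrow> q \<in> Q \<and> \<not> (a < c \<and> z1 = z \<and> co r1 b = co x b) \<and> \<not> (b < c \<and> z2 = z \<and> co r2 a = co x a)"
  have entry: "entry a b c s i = (if z < Suc total \<and> keep
      then [(q, [x] @ (if E1 then [r1] else []) @ (if E2 then [r2] else []))] else [])"
    by (simp add: entry_def Let_def r[symmetric] z_def[symmetric] q_def[symmetric] keep_def E1_def E2_def)
  let ?s = "set_reg rZ z s"
  have s: "effect (SetReg rZ (minE (Read aZ1 (Reg rT)) (Read aZ2 (Reg rT)))) s = ?s"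
    using i by (simp add: z_def r)
  have inp: "has_input xs ys ?s" and reg: "reg ?s rSum = total" "reg ?s rBig = Suc total" "reg ?s 0 = n" "reg ?s 1 = ny"
    using ready by (auto simp: ready_def has_input_def)
  have out': "has_output d ol ?s"
    using has_output_cong[OF out] by simp
  \<comment> \<open>A query with a level below the dummy value was answered by a datum, not by the dummy.\<close>
  have index: "z < Suc total \<Longrightarrow> z1 = z \<Longrightarrow> arr s aR1 i - n < n" "z < Suc total \<Longrightarrow> z2 = z \<Longrightarrow> arr s aR2 i - n < n"
    using ans i by (auto simp: answered_def r)
  have nb: "exp_val (neighbour \<rho>) ?s = arr s \<rho> i - n" for \<rho>
    using reg i by (simp add: neighbour_def)
  have xco: "exp_val (coE d 0 (Reg rT) k) ?s = co x k" for k
    using coE_input(1)[OF inp, of "Reg rT" k] i by (simp add: r)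
  have level1: "test_val (level_with d aR1 aZ1 b) ?s \<longleftrightarrow> z1 = z \<and> co r1 b = co x b" if "z < Suc total"
    using coE_input(1)[OF inp, of "neighbour aR1" b] index(1)[OF that] xco nb i
    by (auto simp: level_with_def r)
  have level2: "test_val (level_with d aR2 aZ2 a) ?s \<longleftrightarrow> z2 = z \<and> co r2 a = co x a" if "z < Suc total"
    using coE_input(1)[OF inp, of "neighbour aR2" a] index(2)[OF that] xco nb i
    by (auto simp: level_with_def r)
  have test: "test_val (entry_test d upset a b c) ?s \<longleftrightarrow> z < Suc total \<and> keep"
  proof (cases "z < Suc total")
    case True
    have "x \<in> minima_below Q q"
      using dir.minima_below_q True unfolding dz dq by simp
    then have xq: "x \<in> Q" "x \<preceq> q"
      using minima_in by (auto simp: minima_below_def)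
    have q: "length q = d" "co q a = co x a" "co q b = co x b" "co q c = z"
      using dir.length_q dir.co_q dir.less3 dir.abc_distinct True unfolding dz dq by auto
    have "member_by upset (set ys) q \<longleftrightarrow> (if upset then z < arr s aZW (ny + i) else \<not> total - z < arr s aZW (ny + i))"
      using ans i(2) q True unfolding answered_def r by auto
    then have "q \<in> Q \<longleftrightarrow> (if upset then z < arr s aZW (ny + i) else \<not> total - z < arr s aZW (ny + i))"
      using member[OF xq] by simp
    then show ?thesis
      using True level1[OF True] level2[OF True] reg i by (simp add: entry_test_def keep_def)
  next
    case False
    then show ?thesis
      using reg by (simp add: entry_test_def)
  qed
  show ?thesis
  proof (cases "z < Suc total \<and> keep")
    case False
    then have "\<not> test_val (entry_test d upset a b c) ?s"
      using test by blast
    then have "effect (emit_entry d upset a b c) s = ?s"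
      unfolding emit_entry_def by (simp only: effect.simps(1,4,5) s if_False)
    moreover have "entry a b c s i = []"
      unfolding entry using False by (rule if_not_P)
    ultimately show ?thesis
      using out' by simp
  next
    case True
    let ?w = "write_block d aQ (Lit 0) (\<lambda>k. if k = c then Reg rZ else coord d 0 (Reg rT) k)"
    define s1 where "s1 = effect ?w ?s"
    define s2 where "s2 = effect (emit_point d) s1"
    define s3 where "s3 = effect (emit_relation d (Reg rT)) s2"
    define s4 where "s4 = effect (Cond (eqE (Read aZ1 (Reg rT)) (Reg rZ)) (emit_relation d (neighbour aR1)) Skip) s3"
    define s5 where "s5 = effect (Cond (level_with d aR2 aZ2 a) (emit_relation d (neighbour aR2)) Skip) s4"
    have eff: "effect (emit_entry d upset a b c) s = s5"
    proof -
      have "test_val (entry_test d upset a b c) ?s"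
        using test True by blast
      then show ?thesis
        unfolding emit_entry_def s1_def s2_def s3_def s4_def s5_def
        by (simp only: effect.simps(4,5) s if_True)
    qed
    have w: "frame {} {aQ} ?s s1"
      "arr s1 aQ j = (if 0 \<le> j \<and> j < 0 + d then (if j - 0 = c then z else x ! (j - 0)) else arr ?s aQ j)" for j
    proof -
      have v: "exp_val (if k = c then Reg rZ else coord d 0 (Reg rT) k) s' = (if k = c then z else x ! k)"
        if "k < d" "frame {} {aQ} ?s s'" for k s'
      proof -
        have "has_input xs ys s'" "reg s' rT = i" "reg s' rZ = z"
          using has_input_cong[OF inp] that(2) i by (auto simp: frame_def)
        then show ?thesis
          using coord_input(1)[of xs ys s' k d "Reg rT"] that(1) xs_length i by (simp add: r)
      qed
      show "frame {} {aQ} ?s s1"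
        unfolding s1_def by (rule effect_write_block(1)[where v = "\<lambda>k. if k = c then z else x ! k" and P = 0]) (use v in auto)
      show "arr s1 aQ j = (if 0 \<le> j \<and> j < 0 + d then (if j - 0 = c then z else x ! (j - 0)) else arr ?s aQ j)"
        unfolding s1_def by (rule effect_write_block(2)[where v = "\<lambda>k. if k = c then z else x ! k" and P = 0]) (use v in auto)
    qed
    have p1: "has_point d q s1"
      using w(2) by (simp add: has_point_def q_def raised_def)
    have o1: "has_output d ol s1"
      using has_output_cong[OF out'] w(1) by (simp add: frame_def)
    have f1: "frame {2, 3} {2, 3, aQ} ?s s1"
      using w(1) by (rule frame_mono) auto
    have o2: "has_output d (ol @ [(q, [])]) s2"
      unfolding s2_def by (rule effect_emit_point[OF o1 p1])
    have f2: "frame {2, 3} {2, 3} s1 s2"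
      unfolding s2_def using effect_frame[of "emit_point d" s1] by (simp add: frame_def)
    have f3: "frame {2, 3} {2, 3} s2 s3"
      unfolding s3_def using effect_frame[of "emit_relation d (Reg rT)" s2] by (simp add: frame_def)
    have f4: "frame {2, 3} {2, 3} s3 s4"
      unfolding s4_def using effect_frame[of "emit_relation d (neighbour aR1)" s3] by (simp add: frame_def)
    have g: "has_input xs ys t \<and> has_point d q t \<and> reg t rT = i \<and> reg t 0 = n" if "frame {2, 3} {2, 3} s1 t" for t
    proof -
      have "has_input xs ys t"
        using has_input_cong[OF inp] that f1 by (simp add: frame_def)
      moreover have "has_point d q t"
        using has_point_cong[OF p1] that by (simp add: frame_def)
      moreover have "reg t rT = i" "reg t 0 = n"
        using that f1 i reg by (simp_all add: frame_def)
      ultimately show ?thesis by blast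
    qed
    have mem: "arr t k = arr s k" "reg t rZ = z" if "frame {2, 3} {2, 3} s1 t" "k \<notin> {2, 3, aQ}" for t k
      using that f1 by (simp_all add: frame_def)
    note g2 = g[OF f2] and g3 = g[OF frame_trans[OF f2 f3]] and g4 = g[OF frame_trans[OF frame_trans[OF f2 f3] f4]]
    have o3: "has_output d (ol @ [(q, [x])]) s3"
      unfolding s3_def
      using effect_emit_relation[OF o2 conjunct1[OF conjunct2[OF g2]] conjunct1[OF g2] xs_length, of "Reg rT" i] g2 i
      by (simp add: frame_def r)
    have m3: "arr s3 k = arr s k" if "k \<notin> {2, 3, aQ}" for k
      using mem(1)[OF frame_trans[OF f2 f3] that] .
    have m4: "arr s4 k = arr s k" if "k \<notin> {2, 3, aQ}" for k
      using mem(1)[OF frame_trans[OF frame_trans[OF f2 f3] f4] that] .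
    have z3: "reg s3 rZ = z" and z4: "reg s4 rZ = z"
      using mem(2)[OF frame_trans[OF f2 f3], of aR1] mem(2)[OF frame_trans[OF frame_trans[OF f2 f3] f4], of aR1] by simp_all
    have nbr: "exp_val (neighbour \<rho>) t' = arr s \<rho> i - n"
      if t: "frame {2, 3} {2, 3} s1 t" "frame {} {3} t t'" "\<rho> \<notin> {2, 3, aQ}" for \<rho> t t'
      using g[OF t(1)] mem(1)[OF t(1,3)] t(2,3) by (simp add: neighbour_def frame_def)
    have o4: "has_output d (ol @ [(q, [x] @ (if E1 then [r1] else []))]) s4"
    proof (cases E1)
      case True
      have "effect (Cond (eqE (Read aZ1 (Reg rT)) (Reg rZ)) (emit_relation d (neighbour aR1)) Skip) s3 =
          effect (emit_relation d (neighbour aR1)) s3"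
        using g3 m3[of aZ1] z3 True by (simp add: E1_def r)
      moreover have "has_output d (ol @ [(q, [x] @ [xs ! (arr s aR1 i - n)])]) (effect (emit_relation d (neighbour aR1)) s3)"
        by (rule effect_emit_relation[OF o3 conjunct1[OF conjunct2[OF g3]] conjunct1[OF g3] xs_length])
          (use nbr[OF frame_trans[OF f2 f3], of _ aR1] index(1) \<open>z < Suc total \<and> keep\<close> True in \<open>simp_all add: E1_def\<close>)
      ultimately show ?thesis
        using True by (simp add: s4_def r)
    next
      case False
      then have "s4 = s3"
        using g3 m3[of aZ1] z3 by (simp add: E1_def r s4_def)
      then show ?thesis using o3 False by simp
    qed
    have test4: "test_val (level_with d aR2 aZ2 a) s4 \<longleftrightarrow> E2"
    proof -
      have z: "z < Suc total" using True by simp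
      have "exp_val (neighbour aR2) s4 = arr s aR2 i - n"
        using nbr[OF frame_trans[OF frame_trans[OF f2 f3] f4], of s4 aR2] by simp
      then show ?thesis
        using coE_input(1)[OF conjunct1[OF g4], of "neighbour aR2" a] index(2)[OF z]
          coE_input(1)[OF conjunct1[OF g4], of "Reg rT" a] g4 m4[of aZ2] z4 i
        by (auto simp: level_with_def E2_def r)
    qed
    have "has_output d (ol @ [(q, ([x] @ (if E1 then [r1] else [])) @ (if E2 then [r2] else []))]) s5"
    proof (cases E2)
      case E2: True
      have "has_output d (ol @ [(q, ([x] @ (if E1 then [r1] else [])) @ [xs ! (arr s aR2 i - n)])])
          (effect (emit_relation d (neighbour aR2)) s4)"
        by (rule effect_emit_relation[OF o4 conjunct1[OF conjunct2[OF g4]] conjunct1[OF g4] xs_length])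
          (use nbr[OF frame_trans[OF frame_trans[OF f2 f3] f4], of _ aR2] index(2) True E2 in \<open>simp_all add: E2_def\<close>)
      then show ?thesis
        using E2 test4 by (simp add: s5_def r)
    next
      case False
      then show ?thesis
        using o4 test4 by (simp add: s5_def)
    qed
    moreover have "entry a b c s i = [(q, [x] @ (if E1 then [r1] else []) @ (if E2 then [r2] else []))]"
      unfolding entry using True by (rule if_P)
    ultimately show ?thesis
      unfolding eff by (simp only: append_assoc)
  qed
qed

lemma runs_queries:
  assumes ready: "ready s" and M: "n + n + 1 \<le> M" "M \<le> 2 ^ L"
    and ne: "\<rho> \<notin> {aK1, aK2, aV, aA, aB}" "\<zeta> \<notin> {aK1, aK2, aV, aA, aB, \<rho>}"
  shows "runs (queries d a b c \<rho> \<zeta>) s ((L + 2) * (M * dominance_const 0 (coE d 0 (Reg rT) a) (coE d 0 (Reg rT) b)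
      (Reg rBig) (coE d 0 (Reg rT) a) (coE d 0 (Reg rT) b) (coE d 0 (Reg rT) c) \<rho> \<zeta>))
    (\<lambda>s'. \<forall>i < n. nearest (Suc total) a b c (xs ! i) (xs ! (arr s' \<rho> i - n)) (arr s' \<zeta> i) \<and>
       (arr s' \<zeta> i < Suc total \<longrightarrow> arr s' \<rho> i - n < n))"
proof -
  note st = stable_input[OF ready]
  have reg: "reg s 0 = n" "reg s rBig = Suc total"
    using ready by (auto simp: ready_def has_input_def)
  show ?thesis
    unfolding queries_def
  proof (rule runs_mono[OF runs_dominance[OF st(1)[of a] st(1)[of b] st(2) st(1)[of a] st(1)[of b] st(1)[of c] _ _ _ _ M ne]])
    fix s'
    assume best: "\<forall>p < n + n. best_in
       (\<lambda>y. (if y < n then Suc total else if y < n + n then co (xs ! (y - n)) c else reg s rBig,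
          if y < n then co (xs ! y) b else if y < n + n then co (xs ! (y - n)) b else 0))
       (insert (n + n) (dominated (n + n) (\<lambda>p. if p < n then co (xs ! p) a else co (xs ! (p - n)) a)
          (\<lambda>p. if p < n then co (xs ! p) b else if p < n + n then co (xs ! (p - n)) b else 0) p)) (arr s' \<rho> p) \<and>
       arr s' \<zeta> p = (if arr s' \<rho> p < n then Suc total else if arr s' \<rho> p < n + n then co (xs ! (arr s' \<rho> p - n)) c else reg s rBig)"
    show "\<forall>i < n. nearest (Suc total) a b c (xs ! i) (xs ! (arr s' \<rho> i - n)) (arr s' \<zeta> i) \<and>
       (arr s' \<zeta> i < Suc total \<longrightarrow> arr s' \<rho> i - n < n)"
    proof (intro allI impI)
      fix i assume i: "i < n"
      then have "i < n + n"
        by simp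
      note b = best[rule_format, OF this, unfolded reg]
      show "nearest (Suc total) a b c (xs ! i) (xs ! (arr s' \<rho> i - n)) (arr s' \<zeta> i) \<and>
         (arr s' \<zeta> i < Suc total \<longrightarrow> arr s' \<rho> i - n < n)"
        using best_nearest[where R = "arr s' \<rho>" and Z = "arr s' \<zeta>" and i = i and a = a and b = b and c = c,
            OF conjunct1[OF b] conjunct2[OF b] i] by blast
    qed
  qed (use reg in simp_all)
qed

lemma runs_member_queries:
  assumes ready: "ready s" and M: "ny + n + 1 \<le> M" "M \<le> 2 ^ L" and abc: "{a, b, c} = {0, 1, 2}"
  shows "runs (member_queries d upset a b c) s ((L + 2) * (M * dominance_const 1 (dirE upset d 1 a) (dirE upset d 1 b)
      (dirE upset d 1 c) (dirE upset d 0 a) (dirE upset d 0 b) (Reg rBig) aRW aZW))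
    (\<lambda>s'. \<forall>i < n. \<forall>q z. length q = d \<longrightarrow> co q a = co (xs ! i) a \<longrightarrow> co q b = co (xs ! i) b \<longrightarrow> co q c = z \<longrightarrow> z \<le> total \<longrightarrow>
        (member_by upset (set ys) q \<longleftrightarrow> (if upset then z < arr s' aZW (ny + i) else \<not> total - z < arr s' aZW (ny + i))))"
proof -
  note st = stable_input[OF ready]
  have reg: "reg s 0 = n" "reg s 1 = ny" "reg s rBig = Suc total"
    using ready by (auto simp: ready_def has_input_def)
  have ne: "aRW \<notin> {aK1, aK2, aV, aA, aB}" "aZW \<notin> {aK1, aK2, aV, aA, aB, aRW}"
    by simp_all
  show ?thesis
    unfolding member_queries_def
  proof (rule runs_mono[OF runs_dominance[OF st(4)[of a] st(4)[of b] st(4)[of c] st(3)[of a] st(3)[of b] st(2) _ _ _ _ M ne]])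
    fix s'
    assume best: "\<forall>p < ny + n. best_in
       (\<lambda>y. (if y < ny then dirV (co (ys ! y) c) else if y < ny + n then Suc total else reg s rBig,
          if y < ny then dirV (co (ys ! y) b) else if y < ny + n then dirV (co (xs ! (y - ny)) b) else 0))
       (insert (ny + n) (dominated (ny + n) (\<lambda>p. if p < ny then dirV (co (ys ! p) a) else dirV (co (xs ! (p - ny)) a))
          (\<lambda>p. if p < ny then dirV (co (ys ! p) b) else if p < ny + n then dirV (co (xs ! (p - ny)) b) else 0) p)) (arr s' aRW p) \<and>
       arr s' aZW p = (if arr s' aRW p < ny then dirV (co (ys ! arr s' aRW p) c) else if arr s' aRW p < ny + n then Suc total else reg s rBig)"
    show "\<forall>i < n. \<forall>q z. length q = d \<longrightarrow> co q a = co (xs ! i) a \<longrightarrow> co q b = co (xs ! i) b \<longrightarrow> co q c = z \<longrightarrow> z \<le> total \<longrightarrow>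
        (member_by upset (set ys) q \<longleftrightarrow> (if upset then z < arr s' aZW (ny + i) else \<not> total - z < arr s' aZW (ny + i)))"
    proof (intro allI impI)
      fix i q z assume i: "i < n" and q: "length q = d" "co q a = co (xs ! i) a" "co q b = co (xs ! i) b" "co q c = z" "z \<le> total"
      from i have "ny + i < ny + n"
        by simp
      note b = best[rule_format, OF this, unfolded reg]
      show "member_by upset (set ys) q \<longleftrightarrow> (if upset then z < arr s' aZW (ny + i) else \<not> total - z < arr s' aZW (ny + i))"
        by (rule best_member[where R = "arr s' aRW" and Z = "arr s' aZW" and i = i and a = a and b = b and c = c,
              OF conjunct1[OF b] conjunct2[OF b] i abc q])
    qed
  qed (use reg in simp_all)
qed

lemma runs_one_direction:
  assumes ready: "ready s" and out: "has_output d ol s" and abc: "{a, b, c} = {0, 1, 2}"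
    and M: "2 * (n + ny + 1) \<le> M" "M \<le> 2 ^ L"
  shows "runs (one_direction d upset a b c) s ((L + 2) * (M * direction_cost d upset a b c))
    (\<lambda>s'. ready s' \<and> (\<exists>e. (\<forall>i < n. good_entries c (xs ! i) (e i)) \<and> has_output d (ol @ concat (map e [0..<n])) s'))"
    (is "runs _ _ _ ?P")
proof -
  let ?q1 = "queries d a b c aR1 aZ1" and ?q2 = "queries d b a c aR2 aZ2" and ?qm = "member_queries d upset a b c"
  let ?K1 = "dominance_const 0 (coE d 0 (Reg rT) a) (coE d 0 (Reg rT) b) (Reg rBig) (coE d 0 (Reg rT) a) (coE d 0 (Reg rT) b)
      (coE d 0 (Reg rT) c) aR1 aZ1"
  let ?K2 = "dominance_const 0 (coE d 0 (Reg rT) b) (coE d 0 (Reg rT) a) (Reg rBig) (coE d 0 (Reg rT) b) (coE d 0 (Reg rT) a)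
      (coE d 0 (Reg rT) c) aR2 aZ2"
  let ?K3 = "dominance_const 1 (dirE upset d 1 a) (dirE upset d 1 b) (dirE upset d 1 c) (dirE upset d 0 a) (dirE upset d 0 b)
      (Reg rBig) aRW aZW"
  let ?c = "emit_entry d upset a b c"
  have Mq: "n + n + 1 \<le> M" and Mm: "ny + n + 1 \<le> M"
    using M(1) by auto
  have ne1: "aR1 \<notin> {aK1, aK2, aV, aA, aB}" "aZ1 \<notin> {aK1, aK2, aV, aA, aB, aR1}"
    and ne2: "aR2 \<notin> {aK1, aK2, aV, aA, aB}" "aZ2 \<notin> {aK1, aK2, aV, aA, aB, aR2}"
    by simp_all
  define N where "N a b \<rho> \<zeta> s' \<longleftrightarrow> (\<forall>i < n. nearest (Suc total) a b c (xs ! i) (xs ! (arr s' \<rho> i - n)) (arr s' \<zeta> i) \<and>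
       (arr s' \<zeta> i < Suc total \<longrightarrow> arr s' \<rho> i - n < n))" for a b \<rho> \<zeta> and s' :: state
  have N_cong: "N a b \<rho> \<zeta> s'' \<longleftrightarrow> N a b \<rho> \<zeta> s'" if "arr s'' \<rho> = arr s' \<rho>" "arr s'' \<zeta> = arr s' \<zeta>" for a b \<rho> \<zeta> s' s''
    using that by (simp add: N_def)
  have keep: "ready s'' \<and> has_output d ol s''"
    if "ready s'" "has_output d ol s'" "frame {rI, rMid, rJ, rHi, rBest, rX, rK, rW, rN, rT} {aK1, aK2, aV, aA, aB, \<rho>, \<zeta>} s' s''"
      "3 < \<rho>" "3 < \<zeta>" for s' s'' \<rho> \<zeta>
    using ready_cong[OF that(1), of s''] has_output_cong[OF that(2), of s''] that(3-5) by (simp add: frame_def)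
  have 1: "runs ?q1 s ((L + 2) * (M * ?K1)) (\<lambda>s1. ready s1 \<and> has_output d ol s1 \<and> N a b aR1 aZ1 s1)"
    unfolding N_def
    by (rule runs_frame[OF runs_queries[OF ready Mq M(2) ne1]]) (use keep[OF ready out, of aR1 aZ1] in auto)
  have 2: "runs ?q2 s1 ((L + 2) * (M * ?K2)) (\<lambda>s2. ready s2 \<and> has_output d ol s2 \<and> N a b aR1 aZ1 s2 \<and> N b a aR2 aZ2 s2)"
    if s1: "ready s1 \<and> has_output d ol s1 \<and> N a b aR1 aZ1 s1" for s1
  proof (rule runs_frame[OF runs_queries[OF conjunct1[OF s1] Mq M(2) ne2]])
    fix s2 assume fr: "frame (regs_of ?q2) (arrs_of ?q2) s1 s2"
      and "\<forall>i < n. nearest (Suc total) b a c (xs ! i) (xs ! (arr s2 aR2 i - n)) (arr s2 aZ2 i) \<and>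
       (arr s2 aZ2 i < Suc total \<longrightarrow> arr s2 aR2 i - n < n)"
    then have "N b a aR2 aZ2 s2"
      by (simp add: N_def)
    moreover have "N a b aR1 aZ1 s2"
      using s1 N_cong[of s2 aR1 s1 aZ1] frame_arr[OF fr] by simp
    ultimately show "ready s2 \<and> has_output d ol s2 \<and> N a b aR1 aZ1 s2 \<and> N b a aR2 aZ2 s2"
      using keep[of s1 aR2 aZ2 s2] s1 fr by simp
  qed
  have 3: "runs ?qm s2 ((L + 2) * (M * ?K3)) (\<lambda>s3. ready s3 \<and> has_output d ol s3 \<and> answered a b c s3)"
    if s2: "ready s2 \<and> has_output d ol s2 \<and> N a b aR1 aZ1 s2 \<and> N b a aR2 aZ2 s2" for s2
  proof (rule runs_frame[OF runs_member_queries[OF conjunct1[OF s2] Mm M(2) abc]])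
    fix s3 assume fr: "frame (regs_of ?qm) (arrs_of ?qm) s2 s3"
      and m: "\<forall>i < n. \<forall>q z. length q = d \<longrightarrow> co q a = co (xs ! i) a \<longrightarrow> co q b = co (xs ! i) b \<longrightarrow> co q c = z \<longrightarrow> z \<le> total \<longrightarrow>
        (member_by upset (set ys) q \<longleftrightarrow> (if upset then z < arr s3 aZW (ny + i) else \<not> total - z < arr s3 aZW (ny + i)))"
    have "N a b aR1 aZ1 s3" "N b a aR2 aZ2 s3"
      using s2 N_cong[of s3 aR1 s2 aZ1] N_cong[of s3 aR2 s2 aZ2] frame_arr[OF fr] by simp_all
    then have "answered a b c s3"
      using m unfolding answered_def N_def by blast
    then show "ready s3 \<and> has_output d ol s3 \<and> answered a b c s3"
      using keep[of s2 aRW aZW s3] s2 fr by simp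
  qed
  have 4: "runs (For rT (Reg 0) ?c) s3 (body_cost n ?c) ?P"
    if s3: "ready s3 \<and> has_output d ol s3 \<and> answered a b c s3" for s3
  proof (rule runs_For_loop_free[where I = "\<lambda>k s'. has_output d (ol @ concat (map (entry a b c s3) [0..<k])) s'"])
    have pres: "ready s' \<and> answered a b c s' \<and> entry a b c s' = entry a b c s3"
      if fr: "frame (insert rT (regs_of ?c)) (arrs_of ?c) s3 s'" for s'
    proof -
      have a: "arr s' k = arr s3 k" if "k \<notin> {2, 3, aQ}" for k
        using frame_arr[OF fr, of k] that by simp
      have "ready s'"
        by (rule ready_cong[OF conjunct1[OF s3]]) (use frame_reg[OF fr] a in simp_all)
      moreover have "answered a b c s'"
        using s3 a by (simp add: answered_def)
      moreover have "entry a b c s' = entry a b c s3"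
        using a by (simp add: entry_def fun_eq_iff)
      ultimately show ?thesis by blast
    qed
    fix k s' assume k: "k < n" "has_output d (ol @ concat (map (entry a b c s3) [0..<k])) s'" "reg s' rT = k"
      and fr: "frame (insert rT (regs_of ?c)) (arrs_of ?c) s3 s'"
    note p = pres[OF fr]
    have "has_output d ((ol @ concat (map (entry a b c s3) [0..<k])) @ entry a b c s' k) (effect ?c s')"
      using effect_emit_entry[OF conjunct1[OF conjunct2[OF p]] abc conjunct1[OF p] k(3,1,2)] .
    then show "has_output d (ol @ concat (map (entry a b c s3) [0..<Suc k])) (set_reg rT (Suc k) (effect ?c s'))"
      using p has_output_cong[of d _ "effect ?c s'"] by simp
  next
    fix s' assume o: "has_output d (ol @ concat (map (entry a b c s3) [0..<n])) s'"
      and fr: "frame (insert rT (regs_of ?c)) (arrs_of ?c) s3 s'"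
    have "ready s'"
      by (rule ready_cong[OF conjunct1[OF s3]]) (use frame_reg[OF fr] frame_arr[OF fr] in simp_all)
    moreover have "\<forall>i < n. good_entries c (xs ! i) (entry a b c s3 i)"
      using good_entries_entry s3 abc by blast
    ultimately show "?P s'"
      using o by blast
  next
    show "has_output d (ol @ concat (map (entry a b c s3) [0..<0])) s'" if "s' = set_reg rT 0 s3" for s'
      using s3 that has_output_cong[of d ol s3 s'] by simp
    show "reg s3 0 = n"
      using s3 by (simp add: ready_def has_input_def)
  qed auto
  have "runs (one_direction d upset a b c) s
    ((L + 2) * (M * ?K1) + ((L + 2) * (M * ?K2) + ((L + 2) * (M * ?K3) + body_cost n ?c))) ?P"
    unfolding one_direction_def
    by (rule runs_Seq[OF 1], rule runs_Seq[OF 2], assumption, rule runs_Seq[OF 3], assumption, rule 4)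
  then show ?thesis
  proof (rule runs_mono)
    have "n + 1 \<le> M" using M(1) by simp
    then have "body_cost n ?c \<le> M * body_cost 0 ?c"
      unfolding body_cost_eq[of n] by (rule mult_le_mono1)
    also have "\<dots> \<le> (L + 2) * (M * body_cost 0 ?c)"
      by simp
    finally show "(L + 2) * (M * ?K1) + ((L + 2) * (M * ?K2) + ((L + 2) * (M * ?K3) + body_cost n ?c))
      \<le> (L + 2) * (M * direction_cost d upset a b c)"
      unfolding direction_cost_def distrib_left[of M] distrib_left[of "L + 2"] by simp
  qed
qed

end


definition three_directions_cost :: "nat \<Rightarrow> bool \<Rightarrow> nat" where
  "three_directions_cost d upset = ((d + 1) * (2 * exp_cost (mul d (Reg 0)) + 30) + 10) +
     (body_cost 0 (Seq (write_block d aQ (Lit 0) (coord d 0 (Reg rT))) (emit_point d)) +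
     (direction_cost d upset 1 2 0 + (direction_cost d upset 0 2 1 + direction_cost d upset 0 1 2)))"

lemma (in small_specified_interval) runs_three_directions:
  assumes M: "2 * (n + ny + 1) \<le> M" "M \<le> 2 ^ L"
  shows "runs (three_directions d upset) (input_state xs ys) ((L + 2) * (M * three_directions_cost d upset))
    (\<lambda>s. \<exists>ol. has_output d ol s \<and> scaffold_list ol \<and> set (map fst ol) = initial_points Q)"
    (is "runs _ _ _ ?P")
proof -
  let ?K0 = "(d + 1) * (2 * exp_cost (mul d (Reg 0)) + 30) + 10"
  let ?w = "Seq (write_block d aQ (Lit 0) (coord d 0 (Reg rT))) (emit_point d)"
  let ?D = "\<lambda>a b c. (L + 2) * (M * direction_cost d upset a b c)"
  let ?min = "map (\<lambda>x. (x, [])) xs"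
  define E where "E c ol s \<longleftrightarrow> (\<exists>e. (\<forall>i < n. good_entries c (xs ! i) (e i)) \<and> has_output d (ol @ concat (map e [0..<n])) s)" for c ol s
  have final: "?P s" if e: "\<And>c i. c < 3 \<Longrightarrow> i < n \<Longrightarrow> good_entries c (xs ! i) (e c i)"
    "has_output d (((?min @ concat (map (e 0) [0..<n])) @ concat (map (e 1) [0..<n])) @ concat (map (e 2) [0..<n])) s" for e s
  proof -
    let ?ol = "?min @ concat (map (\<lambda>c. concat (map (e c) [0..<n])) [0..<3])"
    have "has_output d ?ol s"
      using e(2) by (simp add: numeral_3_eq_3 numeral_2_eq_2)
    then show ?thesis
      using scaffold_list_entries[of xs e, OF xs e(1)] by blast
  qed
  have 1: "runs (one_direction d upset 1 2 0) s (?D 1 2 0) (\<lambda>s'. ready s' \<and> E 0 ?min s')"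
    if "ready s \<and> has_output d ?min s" for s
    unfolding E_def using runs_one_direction[of s ?min 1 2 0 M L] that M by auto
  have 2: "runs (one_direction d upset 0 2 1) s (?D 0 2 1) (\<lambda>s'. ready s' \<and> E 1 ol s')"
    if "ready s \<and> has_output d ol s" for s ol
    unfolding E_def using runs_one_direction[of s ol 0 2 1 M L] that M by auto
  have 3: "runs (one_direction d upset 0 1 2) s (?D 0 1 2) (\<lambda>s'. ready s' \<and> E 2 ol s')"
    if "ready s \<and> has_output d ol s" for s ol
    unfolding E_def using runs_one_direction[of s ol 0 1 2 M L] that M by auto
  have "runs (three_directions d upset) (input_state xs ys)
    ((n + ny + 1) * ?K0 + (body_cost n ?w + (?D 1 2 0 + (?D 0 2 1 + ?D 0 1 2)))) ?P"
    unfolding three_directions_def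
  proof (rule runs_Seq[OF runs_sum_up])
    fix s1 assume "ready s1 \<and> has_output d [] s1"
    then show "runs (Seq (emit_minima d) (Seq (one_direction d upset 1 2 0)
        (Seq (one_direction d upset 0 2 1) (one_direction d upset 0 1 2)))) s1
        (body_cost n ?w + (?D 1 2 0 + (?D 0 2 1 + ?D 0 1 2))) ?P"
    proof (intro runs_Seq[OF runs_emit_minima])
      fix s2 assume s2: "ready s2 \<and> has_output d ?min s2"
      show "runs (Seq (one_direction d upset 1 2 0) (Seq (one_direction d upset 0 2 1) (one_direction d upset 0 1 2))) s2
        (?D 1 2 0 + (?D 0 2 1 + ?D 0 1 2)) ?P"
      proof (rule runs_Seq[OF 1[OF s2]])
        fix s3 assume s3: "ready s3 \<and> E 0 ?min s3"
        then obtain e0 where e0: "\<forall>i < n. good_entries 0 (xs ! i) (e0 i)"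
          "has_output d (?min @ concat (map e0 [0..<n])) s3"
          unfolding E_def by blast
        show "runs (Seq (one_direction d upset 0 2 1) (one_direction d upset 0 1 2)) s3 (?D 0 2 1 + ?D 0 1 2) ?P"
        proof (rule runs_Seq[OF 2[OF conjI[OF conjunct1[OF s3] e0(2)]]])
          fix s4 assume s4: "ready s4 \<and> E 1 (?min @ concat (map e0 [0..<n])) s4"
          then obtain e1 where e1: "\<forall>i < n. good_entries 1 (xs ! i) (e1 i)"
            "has_output d ((?min @ concat (map e0 [0..<n])) @ concat (map e1 [0..<n])) s4"
            unfolding E_def by blast
          show "runs (one_direction d upset 0 1 2) s4 (?D 0 1 2) ?P"
          proof (rule runs_mono[OF 3[OF conjI[OF conjunct1[OF s4] e1(2)]] order_refl])
            fix s5 assume "ready s5 \<and> E 2 ((?min @ concat (map e0 [0..<n])) @ concat (map e1 [0..<n])) s5"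
            then obtain e2 where e2: "\<forall>i < n. good_entries 2 (xs ! i) (e2 i)"
              "has_output d (((?min @ concat (map e0 [0..<n])) @ concat (map e1 [0..<n])) @ concat (map e2 [0..<n])) s5"
              unfolding E_def by blast
            define e where "e c = (if c = 0 then e0 else if c = 1 then e1 else e2)" for c :: nat
            have "good_entries c (xs ! i) (e c i)" if "c < 3" "i < n" for c i
            proof -
              have "c = 0 \<or> c = 1 \<or> c = 2"
                using that by auto
              then show ?thesis
                using e0(1) e1(1) e2(1) that(2) by (auto simp: e_def)
            qed
            then show "?P s5"
              using e2(2) by (intro final[of e]) (simp_all add: e_def)
          qed
        qed
      qed
    qed auto
  qed
  then show ?thesis
  proof (rule runs_mono)
    have "1 \<le> M" "n + 1 \<le> M" "n + ny + 1 \<le> M"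
      using M(1) by auto
    then have "(n + ny + 1) * ?K0 \<le> M * ?K0" "body_cost n ?w \<le> M * body_cost 0 ?w"
      unfolding body_cost_eq[of n] by (auto simp del: mult_Suc mult_Suc_right intro: mult_le_mono1)
    moreover have "M * k \<le> (L + 2) * (M * k)" for k
      by simp
    ultimately have "(n + ny + 1) * ?K0 \<le> (L + 2) * (M * ?K0)" "body_cost n ?w \<le> (L + 2) * (M * body_cost 0 ?w)"
      by (meson order.trans)+
    then show "(n + ny + 1) * ?K0 + (body_cost n ?w + (?D 1 2 0 + (?D 0 2 1 + ?D 0 1 2)))
      \<le> (L + 2) * (M * three_directions_cost d upset)"
      unfolding three_directions_cost_def distrib_left[of M] distrib_left[of "L + 2"] by linarith
  qed
qed


section \<open>The running time bounds\<close>

definition num_passes :: "nat \<Rightarrow> nat" where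
  "num_passes m = nat \<lceil>log 2 (real m)\<rceil>"

lemma le_two_power_num_passes:
  assumes "m > 0"
  shows "m \<le> 2 ^ num_passes m"
proof -
  have "log 2 (real m) \<le> real (num_passes m)"
    unfolding num_passes_def by (rule real_nat_ceiling_ge)
  then have "2 powr log 2 (real m) \<le> 2 powr real (num_passes m)"
    by simp
  then have "real m \<le> 2 ^ num_passes m"
    using assms by (simp add: powr_realpow)
  then show ?thesis
    by (metis of_nat_le_iff of_nat_numeral of_nat_power)
qed

lemma n_log_n_bound:
  "(\<lambda>n. real ((num_passes (2 * (n + 1)) + 2) * (2 * (n + 1) * C))) \<in> O(\<lambda>n. real n * max 1 (log 2 (real n)))"
proof (rule bigoI)
  show "\<forall>\<^sub>F n in sequentially. norm (real ((num_passes (2 * (n + 1)) + 2) * (2 * (n + 1) * C)))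
    \<le> (24 * real C) * norm (real n * max 1 (log 2 (real n)))"
    using eventually_ge_at_top[of 1]
  proof eventually_elim
    fix n :: nat assume n: "1 \<le> n"
    \<comment> \<open>The factor 4 costs two passes more, and rounding costs another one.\<close>
    have "log 2 (real (2 * (n + 1))) \<le> log 2 (4 * real n)"
      using n by simp
    also have "\<dots> = log 2 4 + log 2 (real n)"
      using n by (subst log_mult) auto
    also have "log 2 4 = (2 :: real)"
      using log_pow_cancel[of 2 2] by simp
    finally have "log 2 (real (2 * (n + 1))) \<le> 2 + log 2 (real n)" .
    moreover have "real (num_passes (2 * (n + 1))) \<le> log 2 (real (2 * (n + 1))) + 1"
    proof -
      have "0 \<le> log 2 (real (2 * (n + 1)))"
        by simp
      then have "0 \<le> \<lceil>log 2 (real (2 * (n + 1)))\<rceil>"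
        by linarith
      then have "real (num_passes (2 * (n + 1))) = of_int \<lceil>log 2 (real (2 * (n + 1)))\<rceil>"
        unfolding num_passes_def by (rule of_nat_nat)
      also have "\<dots> \<le> log 2 (real (2 * (n + 1))) + 1"
        by (rule of_int_ceiling_le_add_one)
      finally show ?thesis .
    qed
    ultimately have "real (num_passes (2 * (n + 1)) + 2) \<le> 6 * max 1 (log 2 (real n))"
      by simp
    moreover have "real (2 * (n + 1) * C) \<le> 4 * real n * real C"
    proof -
      have "real (2 * (n + 1)) \<le> 4 * real n"
        using n by simp
      then have "real (2 * (n + 1)) * real C \<le> 4 * real n * real C"
        by (rule mult_right_mono) simp
      then show ?thesis
        by (simp only: of_nat_mult)
    qed
    ultimately have "real (num_passes (2 * (n + 1)) + 2) * real (2 * (n + 1) * C) \<le>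
        (6 * max 1 (log 2 (real n))) * (4 * real n * real C)"
      by (intro mult_mono) auto
    also have "\<dots> = (24 * real C) * (real n * max 1 (log 2 (real n)))"
      by (simp only: mult_ac)
    also have "\<dots> = (24 * real C) * norm (real n * max 1 (log 2 (real n)))"
      by (simp add: abs_mult)
    finally show "norm (real ((num_passes (2 * (n + 1)) + 2) * (2 * (n + 1) * C)))
      \<le> (24 * real C) * norm (real n * max 1 (log 2 (real n)))"
      unfolding norm_of_nat by (simp only: of_nat_mult)
  qed
qed

lemma n_power_4_bound: "(\<lambda>n. real ((n + 1) ^ 4 * C)) \<in> O(\<lambda>n. real n ^ 4)"
proof (rule bigoI)
  show "\<forall>\<^sub>F n in sequentially. norm (real ((n + 1) ^ 4 * C)) \<le> (16 * real C) * norm (real n ^ 4)"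
    using eventually_ge_at_top[of 1]
  proof eventually_elim
    fix n :: nat assume n: "1 \<le> n"
    then have "(real n + 1) ^ 4 \<le> (2 * real n) ^ 4"
      by (intro power_mono) auto
    then have "(real n + 1) ^ 4 * real C \<le> 16 * real n ^ 4 * real C"
      by (intro mult_right_mono) (auto simp: power_mult_distrib)
    then show "norm (real ((n + 1) ^ 4 * C)) \<le> (16 * real C) * norm (real n ^ 4)"
      by (simp add: mult_ac add_ac)
  qed
qed

lemma (in specified_interval) computes_by_joins:
  "computes_initial_scaffold (all_joins d upset) xs ys Q
     ((length xs + length ys + 1) ^ 4 * (join_cost d upset 0 0 0 + 16))"
  by (rule computes_initial_scaffoldI[OF runs_all_joins])

lemma (in specified_interval) computes_by_directions:
  assumes "d \<le> 3"
  shows "computes_initial_scaffold (three_directions d upset) xs ys Q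
    ((num_passes (2 * (length xs + length ys + 1)) + 2) *
      (2 * (length xs + length ys + 1) * three_directions_cost d upset))"
proof -
  interpret small_specified_interval d Q xs ys upset
    by unfold_locales (rule assms)
  show ?thesis
    by (rule computes_initial_scaffoldI[OF runs_three_directions[OF order_refl le_two_power_num_passes]]) simp
qed

text \<open>Both ways of specifying an interval provide the minima and a membership test, which is all that
  the two programs rely on.\<close>

lemma scaffold_algorithms:
  assumes spec: "\<And>Q xs ys. Q \<in> \<Q> \<Longrightarrow> lists_set xs (fst (spec Q)) \<Longrightarrow> lists_set ys (snd (spec Q)) \<Longrightarrow>
      specified_interval d Q xs ys upset"
  shows "\<exists>c T. scaffold_algorithm c spec \<Q> T \<and>
        (d \<in> {2, 3} \<longrightarrow> (\<lambda>n. real (T n)) \<in> O(\<lambda>n. real n * max 1 (log 2 (real n)))) \<and>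
        (d > 3 \<longrightarrow> (\<lambda>n. real (T n)) \<in> O(\<lambda>n. real n ^ 4))"
proof -
  have card: "card (fst (spec Q)) + card (snd (spec Q)) = length xs + length ys"
    if "lists_set xs (fst (spec Q))" "lists_set ys (snd (spec Q))" for Q xs ys
    using that distinct_card by (metis lists_set_def)
  have algorithm: "scaffold_algorithm c spec \<Q> T"
    if c: "\<And>Q xs ys. specified_interval d Q xs ys upset \<Longrightarrow>
      computes_initial_scaffold c xs ys Q (T (length xs + length ys))" for c T
    unfolding scaffold_algorithm_def
  proof (intro ballI allI impI, elim conjE)
    fix Q xs ys assume "Q \<in> \<Q>" and l: "lists_set xs (fst (spec Q))" "lists_set ys (snd (spec Q))"
    then show "computes_initial_scaffold c xs ys Q (T (card (fst (spec Q)) + card (snd (spec Q))))"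
      unfolding card[OF l] by (intro c spec)
  qed
  show ?thesis
  proof (cases "d \<le> 3")
    case True
    let ?T = "\<lambda>n. (num_passes (2 * (n + 1)) + 2) * (2 * (n + 1) * three_directions_cost d upset)"
    have "scaffold_algorithm (three_directions d upset) spec \<Q> ?T"
      by (rule algorithm) (rule specified_interval.computes_by_directions[OF _ True])
    then show ?thesis
      using n_log_n_bound[of "three_directions_cost d upset"] True
      by (intro exI[of _ "three_directions d upset"] exI[of _ ?T] conjI impI) simp_all
  next
    case False
    let ?T = "\<lambda>n. (n + 1) ^ 4 * (join_cost d upset 0 0 0 + 16)"
    have "scaffold_algorithm (all_joins d upset) spec \<Q> ?T"
      by (rule algorithm) (rule specified_interval.computes_by_joins)
    then show ?thesis
      using n_power_4_bound[of "join_cost d upset 0 0 0 + 16"] False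
      by (intro exI[of _ "all_joins d upset"] exI[of _ ?T] conjI impI) simp_all
  qed
qed

theorem theorem3p16:
  fixes d :: nat
  assumes "d \<ge> 2"
  shows
    "(\<exists>c T. scaffold_algorithm c (upset_presentation d) {Q. interval d Q} T \<and>
        (d \<in> {2, 3} \<longrightarrow> (\<lambda>n. real (T n)) \<in> O(\<lambda>n. real n * max 1 (log 2 (real n)))) \<and>
        (d > 3 \<longrightarrow> (\<lambda>n. real (T n)) \<in> O(\<lambda>n. real n ^ 4))) \<and>
     (\<exists>c T. scaffold_algorithm c extrema {Q. interval d Q \<and> finite Q} T \<and>
        (d \<in> {2, 3} \<longrightarrow> (\<lambda>n. real (T n)) \<in> O(\<lambda>n. real n * max 1 (log 2 (real n)))) \<and>
        (d > 3 \<longrightarrow> (\<lambda>n. real (T n)) \<in> O(\<lambda>n. real n ^ 4)))"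
proof (intro conjI scaffold_algorithms)
  fix Q xs ys
  assume "Q \<in> {Q. interval d Q}" and xs: "lists_set xs (fst (upset_presentation d Q))"
    and ys: "lists_set ys (snd (upset_presentation d Q))"
  then interpret nat_interval d Q
    by unfold_locales simp
  show "specified_interval d Q xs ys True"
  proof
    show "distinct xs" "set xs = minima Q"
      using xs by (auto simp: lists_set_def upset_presentation_def)
    show "\<forall>y \<in> set ys. length y = d"
      using ys by (auto simp: lists_set_def upset_presentation_def minima_def up_def space_N_def)
    show "q \<in> Q \<longleftrightarrow> member_by True (set ys) q" if "m \<in> Q" "m \<preceq> q" for m q
      using member_by_upset_presentation[OF that] ys by (simp add: lists_set_def)
  qed
next
  fix Q xs ys
  assume Q: "Q \<in> {Q. interval d Q \<and> finite Q}" and xs: "lists_set xs (fst (extrema Q))"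
    and ys: "lists_set ys (snd (extrema Q))"
  then interpret nat_interval d Q
    by unfold_locales simp
  show "specified_interval d Q xs ys False"
  proof
    show "distinct xs" "set xs = minima Q"
      using xs by (auto simp: lists_set_def extrema_def)
    show "\<forall>y \<in> set ys. length y = d"
      using ys length_eq by (auto simp: lists_set_def extrema_def maxima_def)
    show "q \<in> Q \<longleftrightarrow> member_by False (set ys) q" if "m \<in> Q" "m \<preceq> q" for m q
      using member_by_extrema[OF that] ys Q by (simp add: lists_set_def)
  qed
qed

end
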